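(* Let fixed data and an initial seed $\mathbf s_0$ be given. Assume that the Berenstein–Zelevinsky quantum $\mathcal A$-variety with principal coefficients $\mathscr A_{\mathrm{prin},q}$ exists and that the data defining it are related to the data defining the Fock–Goncharov quantum $\mathcal X$-variety with principal coefficients $\mathscr X_q$ as follows: there is a skew-symmetric integral form $\Lambda$ on $M^\circ$ compatible with the data in the normalization $\Lambda(\{e_{k;\mathbf s_0},\cdot\},f_{j;\mathbf s_0})=\delta_{kj}\,d/d_k$ for $k\in I_{\mathrm{uf}}$, $j\in I$, where $d=\mathrm{lcm}(d_i:i\in I)$. Let $p^*:N\to M^\circ$ be a $p^*$-map. Identify the quantum parameters by $q_{\mathrm{FG}}^{1/d}=q_{\mathrm{BZ}}^{-1/2}$. Then $p^*$ induces, for each seed $\mathbf s$, via $\tilde X^n_{\mathbf s}\mapsto\tilde A^{p^*(n)}_{\mathbf s}$ ($n\in N$), $q_{\mathrm{FG}}^{1/d}\mapsto q_{\mathrm{BZ}}^{-1/2}$ and $t_i\mapsto t_i$, a $*$-algebra homomorphism, again denoted $p^*$, from the quantum $\mathcal X$-torus algebra over $\mathbb C[t_i:i\in I][q_{\mathrm{FG}}^{\pm1/d}]$ to the quantum $\mathcal A$-torus algebra over $\mathbb C[t_i:i\in I][q_{\mathrm{BZ}}^{\pm1/2}]$, and these homomorphisms commute with mutation: for every seed $\mathbf s$, every $k\in I_{\mathrm{uf}}$ with $\mathbf s'$ the mutation of $\mathbf s$ in direction $k$, and every $i\in I$, $$p^*\bigl(\mu^q_{k,\mathbf t}(\tilde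 X_{i;\mathbf s'})\bigr)=\mu^q_{k,\mathbf t}\bigl(p^*(\tilde X_{i;\mathbf s'})\bigr).$$ That is, there is a map of quantum cluster varieties $p:\mathscr A_{\mathrm{prin},q}\to\mathscr X_q$ from the Berenstein–Zelevinsky quantum $\mathcal A$-variety with principal coefficients to the Fock–Goncharov quantum $\mathcal X$-variety with principal coefficients.
   Context: Fixed data: a finite set $I$ with a subset $I_{\mathrm{uf}}$; a lattice $N$ of rank $|I|$ with a saturated sublattice $N_{\mathrm{uf}}$ of rank $|I_{\mathrm{uf}}|$; a skew-symmetric bilinear form $\{\cdot,\cdot\}:N\times N\to\mathbb Q$; positive integers $(d_i)_{i\in I}$ with gcd $1$; a finite-index sublattice $N^\circ\subseteq N$ with $\{N_{\mathrm{uf}},N^\circ\}\subset\mathbb Z$ and $\{N,N_{\mathrm{uf}}\cap N^\circ\}\subset\mathbb Z$; $M^\circ=\operatorname{Hom}(N^\circ,\mathbb Z)$. A seed is $\mathbf s=(e_{i;\mathbf s})_{i\in I}$, a basis of $N$ such that $(e_{i;\mathbf s})_{i\in I_{\mathrm{uf}}}$ is a basis of $N_{\mathrm{uf}}$ and $(d_ie_{i;\mathbf s})_{i\in I}$ is a basis of $N^\circ$; $(f_{i;\mathbf s})_{i\in I}$ is the basis of $M^\circ$ dual to $(d_ie_{i;\mathbf s})$. Put $\hat\epsilon_{ij}=\{e_{i;\mathbf s},e_{j;\mathbf s}\}$, $\epsilon_{ij}=\hat\epsilon_{ij}d_j$ (taken to be integral), $[r]_+=\max(0,r)$ for $r\in\mathbb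 R$. Mutation of $\mathbf s$ in direction $k\in I_{\mathrm{uf}}$: $e_{k;\mathbf s'}=-e_{k;\mathbf s}$, $e_{i;\mathbf s'}=e_{i;\mathbf s}+[\epsilon_{ik}]_+e_{k;\mathbf s}$ for $i\neq k$; "seed" in the claim means a seed reached from $\mathbf s_0$ by mutations. Note $\{e_{k;\mathbf s},\cdot\}=\sum_j\epsilon_{kj}f_{j;\mathbf s}\in M^\circ$ for $k\in I_{\mathrm{uf}}$. A $p^*$-map is a lattice map $p^*:N\to M^\circ$ with $p^*(n)=\{n,\cdot\}$ for $n\in N_{\mathrm{uf}}$, and such that for all $n\in N$ the restriction of $p^*(n)$ to $N_{\mathrm{uf}}\cap N^\circ$ equals $\{n,\cdot\}|_{N_{\mathrm{uf}}\cap N^\circ}$. $\mathbf c$-vectors: $\mathbf c_{i;\mathbf s}=(c_{ij})_{j\in I}\in\mathbb Z^I$ are determined by: $\mathbf c_{i;\mathbf s_0}$ is the $i$-th standard basis vector; under mutation in direction $k$, $c'_{kj}=-c_{kj}$ and $c'_{ij}=c_{ij}+\frac12(|\epsilon_{ik}|c_{kj}+\epsilon_{ik}|c_{kj}|)$ for $i\neq k$. They are known to be sign coherent (all entries $\ge0$ or all $\le0$). For a sign coherent $\mathbf x$, $[\mathbf x]_+=\mathbf x$ if its entries are nonnegative and $0$ otherwise; $\mathbf t^{\mathbf x}=\prod_it_i^{x_i}$. Quantum $\mathcal X$ side (parameter $q=q_{\mathrm{FG}}$): for each seed, the quantum $\mathcal X$-torus algebra over $\mathbb C[t_i:i\in I][q^{\pm1/d}]$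 has basis $\tilde X^n_{\mathbf s}$, $n\in N$, with $\tilde X^n_{\mathbf s}\tilde X^{n'}_{\mathbf s}=q^{\{n,n'\}}\tilde X^{n+n'}_{\mathbf s}$; $\tilde X_{i;\mathbf s}=\tilde X^{e_{i;\mathbf s}}_{\mathbf s}$. Mutation is the isomorphism of noncommutative fraction fields (from that of $\mathbf s'$ to that of $\mathbf s$) with $\mu^q_{k,\mathbf t}(\tilde X_{k;\mathbf s'})=\tilde X_{k;\mathbf s}^{-1}$ and, for $i\ne k$, $$\mu^q_{k,\mathbf t}(\tilde X_{i;\mathbf s'})=\tilde X_{i;\mathbf s}\left(\prod_{\ell=1}^{|\epsilon_{ik}|}\left(\mathbf t^{[\operatorname{sgn}(\epsilon_{ik})\mathbf c_{k;\mathbf s}]_+}+\mathbf t^{[-\operatorname{sgn}(\epsilon_{ik})\mathbf c_{k;\mathbf s}]_+}q^{(2\ell-1)/d_k}\tilde X_{k;\mathbf s}^{-\operatorname{sgn}(\epsilon_{ik})}\right)\right)^{-\operatorname{sgn}(\epsilon_{ik})}.$$ $\mathscr X_q$ is obtained by gluing the spectra of these torus algebras along these mutations. Quantum $\mathcal A$ side (parameter $q=q_{\mathrm{BZ}}$): for each seed, the quantum $\mathcal A$-torus algebra over $\mathbb C[t_i:i\in I][q^{\pm1/2}]$ has basis $\tilde A^m_{\mathbf s}$, $m\in M^\circ$, with $\tilde A^m_{\mathbf s}\tilde A^{m'}_{\mathbf s}=q^{\frac12\Lambda(m,m')}\tilde A^{m+m'}_{\mathbf s}$; $\tilde A_{i;\mathbf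 s}=\tilde A^{f_{i;\mathbf s}}_{\mathbf s}$. The coefficients $t_i$ are central. Mutation is the isomorphism of noncommutative fraction fields (from $\mathbf s'$ to $\mathbf s$) with $\mu^q_{k,\mathbf t}(\tilde A_{i;\mathbf s'})=\tilde A_{i;\mathbf s}$ for $i\ne k$ and $$\mu^q_{k,\mathbf t}(\tilde A_{k;\mathbf s'})=\mathbf t^{[\mathbf c_{k;\mathbf s}]_+}\tilde A_{\mathbf s}^{-f_{k;\mathbf s}+\sum_{j:\epsilon_{kj}>0}\epsilon_{kj}f_{j;\mathbf s}}+\mathbf t^{[-\mathbf c_{k;\mathbf s}]_+}\tilde A_{\mathbf s}^{-f_{k;\mathbf s}-\sum_{j:\epsilon_{kj}<0}\epsilon_{kj}f_{j;\mathbf s}}.$$ These torus algebras and mutations define $\mathscr A_{\mathrm{prin},q}$. On both sides $*$ is the $\mathbb C[t_i:i\in I]$-linear involutive antiautomorphism fixing all $\tilde X^n$ (resp. $\tilde A^m$) and sending $q$ to $q^{-1}$ (and its fractional powers to their inverses). In the displayed identity, $p^*$ is extended to the localization inverting the factors occurring in the mutation formula. A map of quantum cluster varieties $\mathscr A_{\mathrm{prin},q}\to\mathscr X_q$ means such a family of $*$-algebra homomorphisms, one for each seed, commuting with all mutations.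
   Formalization: The formal theorem additionally assumes Λ(p*(e_i),p*(e_j)) = −d{e_i,e_j} for i,j both frozen (initial seed); without it the homomorphism claim can fail, and it is necessary for that claim. *)

theory Defs
  imports
    Complex_Main
    "HOL-Library.Function_Algebras"
    "HOL-Library.Poly_Mapping"
    "HOL-Algebra.Generated_Rings"
begin

section \<open>Lattices\<close>

definition zmul :: "int \<Rightarrow> 'a::ab_group_add \<Rightarrow> 'a" where
  "zmul k x = (\<Sum>j<nat k. x) - (\<Sum>j<nat (- k). x)"

definition zbasis :: "'i::finite set \<Rightarrow> ('i \<Rightarrow> 'a::ab_group_add) \<Rightarrow> 'a set \<Rightarrow> bool" where
  "zbasis J b L \<longleftrightarrow>
     bij_betw (\<lambda>a :: 'i \<Rightarrow> int. \<Sum>j\<in>J. zmul (a j) (b j)) {a. \<forall>j. j \<notin> J \<longrightarrow> a j = 0} L"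

section \<open>Fixed data, seeds and p-star maps\<close>

text \<open>
  The index set I is the finite type \<open>'i\<close>, and the lattice N is the whole type \<open>'n\<close>.
\<close>

record ('i, 'n) fixed_data =
  Iuf :: "'i set"
  Nuf :: "'n set"
  form :: "'n \<Rightarrow> 'n \<Rightarrow> rat"
  dd :: "'i \<Rightarrow> nat"
  Ncirc :: "'n set"

definition is_fixed_data :: "('i::finite, 'n::ab_group_add) fixed_data \<Rightarrow> bool" where
  "is_fixed_data D \<longleftrightarrow>
     (\<exists>b :: 'i \<Rightarrow> 'n. zbasis UNIV b UNIV) \<and>
     (\<exists>b. zbasis (Iuf D) b (Nuf D)) \<and>
     (\<forall>k x. k \<noteq> 0 \<and> zmul k x \<in> Nuf D \<longrightarrow> x \<in> Nuf D) \<and>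
     (\<forall>x y z. form D (x + y) z = form D x z + form D y z) \<and>
     (\<forall>x y z. form D x (y + z) = form D x y + form D x z) \<and>
     (\<forall>x y. form D x y = - form D y x) \<and>
     (\<forall>i. dd D i > 0) \<and> Gcd (range (dd D)) = 1 \<and>
     0 \<in> Ncirc D \<and> (\<forall>x\<in>Ncirc D. \<forall>y\<in>Ncirc D. x - y \<in> Ncirc D) \<and>
     finite (range (\<lambda>x. (\<lambda>y. x + y) ` Ncirc D)) \<and>
     (\<forall>x\<in>Nuf D. \<forall>y\<in>Ncirc D. form D x y \<in> \<int>) \<and>
     (\<forall>x. \<forall>y\<in>Nuf D \<inter> Ncirc D. form D x y \<in> \<int>)"

definition dlcm :: "('i::finite, 'n) fixed_data \<Rightarrow> nat" where
  "dlcm D = Lcm (range (dd D))"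

text \<open>
  The dual lattice \<open>Hom(N\<^sup>\<circ>, \<int>)\<close>: its elements are represented by functions on all of N that
  vanish outside \<open>N\<^sup>\<circ>\<close>, with pointwise addition.
\<close>

definition Mcirc :: "('i, 'n::ab_group_add) fixed_data \<Rightarrow> ('n \<Rightarrow> int) set" where
  "Mcirc D = {\<phi>. (\<forall>x\<in>Ncirc D. \<forall>y\<in>Ncirc D. \<phi> (x + y) = \<phi> x + \<phi> y) \<and> (\<forall>x. x \<notin> Ncirc D \<longrightarrow> \<phi> x = 0)}"

text \<open>
  The element \<open>{n, \<cdot>}\<close> of \<open>M\<^sup>\<circ>\<close>, used only for n in \<open>Nuf\<close>, where the values on \<open>N\<^sup>\<circ>\<close> are
  integers and the floor is exact.
\<close>

definition form_map :: "('i, 'n::ab_group_add) fixed_data \<Rightarrow> 'n \<Rightarrow> ('n \<Rightarrow> int)" where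
  "form_map D n = (\<lambda>x. if x \<in> Ncirc D then \<lfloor>form D n x\<rfloor> else 0)"

definition is_seed :: "('i::finite, 'n::ab_group_add) fixed_data \<Rightarrow> ('i \<Rightarrow> 'n) \<Rightarrow> bool" where
  "is_seed D e \<longleftrightarrow>
     zbasis UNIV e UNIV \<and> zbasis (Iuf D) e (Nuf D) \<and>
     zbasis UNIV (\<lambda>i. zmul (int (dd D i)) (e i)) (Ncirc D)"

definition dual_basis :: "('i, 'n::ab_group_add) fixed_data \<Rightarrow> ('i \<Rightarrow> 'n) \<Rightarrow> 'i \<Rightarrow> ('n \<Rightarrow> int)" where
  "dual_basis D e i =
     (THE \<phi>. \<phi> \<in> Mcirc D \<and> (\<forall>j. \<phi> (zmul (int (dd D j)) (e j)) = (if i = j then 1 else 0)))"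

definition exch_rat :: "('i, 'n) fixed_data \<Rightarrow> ('i \<Rightarrow> 'n) \<Rightarrow> 'i \<Rightarrow> 'i \<Rightarrow> rat" where
  "exch_rat D e i j = form D (e i) (e j) * of_nat (dd D j)"

definition exch_integral :: "('i, 'n) fixed_data \<Rightarrow> ('i \<Rightarrow> 'n) \<Rightarrow> bool" where
  "exch_integral D e \<longleftrightarrow> (\<forall>i j. exch_rat D e i j \<in> \<int>)"

definition exch :: "('i, 'n) fixed_data \<Rightarrow> ('i \<Rightarrow> 'n) \<Rightarrow> 'i \<Rightarrow> 'i \<Rightarrow> int" where
  "exch D e i j = \<lfloor>exch_rat D e i j\<rfloor>"

text \<open>
  A seed together with its c-vectors; row i of the second component is the i-th c-vector.
  The division by 2 below is exact.
\<close>

type_synonym ('i, 'n) cseed = "('i \<Rightarrow> 'n) \<times> ('i \<Rightarrow> 'i \<Rightarrow> int)"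

definition mut_basis ::
    "('i, 'n::ab_group_add) fixed_data \<Rightarrow> 'i \<Rightarrow> ('i \<Rightarrow> 'n) \<Rightarrow> ('i \<Rightarrow> 'n)" where
  "mut_basis D k e = (\<lambda>i. if i = k then - e k else e i + zmul (max 0 (exch D e i k)) (e k))"

definition mut_cvec ::
    "('i, 'n) fixed_data \<Rightarrow> 'i \<Rightarrow> ('i \<Rightarrow> 'n) \<Rightarrow> ('i \<Rightarrow> 'i \<Rightarrow> int) \<Rightarrow> ('i \<Rightarrow> 'i \<Rightarrow> int)" where
  "mut_cvec D k e c = (\<lambda>i j. if i = k then - c k j
     else c i j + (\<bar>exch D e i k\<bar> * c k j + exch D e i k * \<bar>c k j\<bar>) div 2)"

definition mut :: "('i, 'n::ab_group_add) fixed_data \<Rightarrow> 'i \<Rightarrow> ('i, 'n) cseed \<Rightarrow> ('i, 'n) cseed" where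
  "mut D k s = (mut_basis D k (fst s), mut_cvec D k (fst s) (snd s))"

inductive_set reachable ::
    "('i, 'n::ab_group_add) fixed_data \<Rightarrow> ('i \<Rightarrow> 'n) \<Rightarrow> ('i, 'n) cseed set"
  for D :: "('i, 'n) fixed_data" and e0 :: "'i \<Rightarrow> 'n" where
  initial: "(e0, \<lambda>i j. if i = j then 1 else 0) \<in> reachable D e0"
| mutate: "s \<in> reachable D e0 \<Longrightarrow> k \<in> Iuf D \<Longrightarrow> mut D k s \<in> reachable D e0"

definition is_pstar :: "('i, 'n::ab_group_add) fixed_data \<Rightarrow> ('n \<Rightarrow> ('n \<Rightarrow> int)) \<Rightarrow> bool" where
  "is_pstar D p \<longleftrightarrow>
     (\<forall>n. p n \<in> Mcirc D) \<and> (\<forall>n n'. p (n + n') = p n + p n') \<and>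
     (\<forall>n\<in>Nuf D. p n = form_map D n) \<and>
     (\<forall>n. \<forall>x\<in>Nuf D \<inter> Ncirc D. of_int (p n x) = form D n x)"

definition compatible_form ::
    "('i::finite, 'n::ab_group_add) fixed_data \<Rightarrow> ('i \<Rightarrow> 'n) \<Rightarrow>
     (('n \<Rightarrow> int) \<Rightarrow> ('n \<Rightarrow> int) \<Rightarrow> int) \<Rightarrow> bool" where
  "compatible_form D e0 \<Lambda> \<longleftrightarrow>
     (\<forall>a\<in>Mcirc D. \<forall>b\<in>Mcirc D. \<forall>c\<in>Mcirc D. \<Lambda> (a + b) c = \<Lambda> a c + \<Lambda> b c) \<and>
     (\<forall>a\<in>Mcirc D. \<forall>b\<in>Mcirc D. \<forall>c\<in>Mcirc D. \<Lambda> a (b + c) = \<Lambda> a b + \<Lambda> a c) \<and>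
     (\<forall>a\<in>Mcirc D. \<forall>b\<in>Mcirc D. \<Lambda> a b = - \<Lambda> b a) \<and>
     (\<forall>k\<in>Iuf D. \<forall>j. rat_of_int (\<Lambda> (form_map D (e0 k)) (dual_basis D e0 j)) =
        (if k = j then of_nat (dlcm D) / of_nat (dd D k) else 0))"

text \<open>
  The relation between \<open>\<Lambda>\<close> and the form on the frozen directions. When one index is unfrozen
  the same equation is a consequence of \<open>compatible_form\<close> and \<open>is_pstar\<close>, but for two
  frozen indices it does not follow from them. It cannot be dropped: see
  \<open>pstar_alg_hom_necessary\<close> below. It is vacuous if \<open>Iuf\<close> is everything.
\<close>

definition frozen_compatible ::
    "('i::finite, 'n) fixed_data \<Rightarrow> ('i \<Rightarrow> 'n) \<Rightarrow>
     (('n \<Rightarrow> int) \<Rightarrow> ('n \<Rightarrow> int) \<Rightarrow> int) \<Rightarrow> ('n \<Rightarrow> ('n \<Rightarrow> int)) \<Rightarrow> bool" where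
  "frozen_compatible D e0 \<Lambda> p \<longleftrightarrow>
     (\<forall>i j. i \<notin> Iuf D \<and> j \<notin> Iuf D \<longrightarrow>
        rat_of_int (\<Lambda> (p (e0 i)) (p (e0 j))) = - of_nat (dlcm D) * form D (e0 i) (e0 j))"

section \<open>Quantum tori\<close>

text \<open>
  \<open>'i tpoly\<close> is \<open>\<complex>[t\<^sub>i : i \<in> I]\<close> (exponent vectors to coefficients) and \<open>'i coeff\<close> is the
  ring of Laurent polynomials over it in one variable v. On the \<open>\<X>\<close> side v stands for
  \<open>q\<^sup>1\<^sup>/\<^sup>d\<close> with \<open>q = q\<^sub>F\<^sub>G\<close>, on the \<open>\<A>\<close> side for \<open>q\<^sup>1\<^sup>/\<^sup>2\<close> with \<open>q = q\<^sub>B\<^sub>Z\<close>.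
\<close>

type_synonym 'i tpoly = "('i \<Rightarrow>\<^sub>0 nat) \<Rightarrow>\<^sub>0 complex"
type_synonym 'i coeff = "int \<Rightarrow>\<^sub>0 'i tpoly"

definition vpow :: "int \<Rightarrow> 'i coeff" where
  "vpow a = Poly_Mapping.single a 1"

definition tconst :: "'i tpoly \<Rightarrow> 'i coeff" where
  "tconst f = Poly_Mapping.single 0 f"

text \<open>The monomial \<open>t\<^sup>x\<close>, used only for exponent vectors with nonnegative entries.\<close>

definition tmon :: "('i::finite \<Rightarrow> int) \<Rightarrow> 'i coeff" where
  "tmon x = tconst (Poly_Mapping.single (\<Sum>i\<in>UNIV. Poly_Mapping.single i (nat (x i))) 1)"

definition pos_vec :: "('i \<Rightarrow> int) \<Rightarrow> ('i \<Rightarrow> int)" where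
  "pos_vec x = (if \<forall>i. 0 \<le> x i then x else (\<lambda>_. 0))"

definition vbar :: "'i coeff \<Rightarrow> 'i coeff" where
  "vbar c = Poly_Mapping.map_key uminus c"

text \<open>
  The algebra with basis \<open>Z\<^sup>a\<close>, for a in the lattice L, and product
  \<open>Z\<^sup>a Z\<^sup>b = v\<^sup>B\<^sup>(\<^sup>a\<^sup>,\<^sup>b\<^sup>) Z\<^sup>a\<^sup>+\<^sup>b\<close>.
\<close>

definition quantum_torus ::
    "'l::ab_group_add set \<Rightarrow> ('l \<Rightarrow> 'l \<Rightarrow> int) \<Rightarrow> ('l \<Rightarrow>\<^sub>0 'i coeff) ring" where
  "quantum_torus L B =
     \<lparr>carrier = {x. Poly_Mapping.keys x \<subseteq> L},
      monoid.mult = (\<lambda>x y. \<Sum>a\<in>Poly_Mapping.keys x. \<Sum>b\<in>Poly_Mapping.keys y.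
        Poly_Mapping.single (a + b)
          (Poly_Mapping.lookup x a * Poly_Mapping.lookup y b * vpow (B a b))),
      one = Poly_Mapping.single 0 1, zero = 0, add = (+)\<rparr>"

definition zmon :: "'l \<Rightarrow> ('l \<Rightarrow>\<^sub>0 'i coeff)" where
  "zmon a = Poly_Mapping.single a 1"

definition scalar :: "'i coeff \<Rightarrow> ('l::zero \<Rightarrow>\<^sub>0 'i coeff)" where
  "scalar c = Poly_Mapping.single 0 c"

text \<open>The \<open>\<complex>[t]\<close>-linear antiautomorphism that fixes every \<open>Z\<^sup>a\<close> and inverts v.\<close>

definition star :: "('l \<Rightarrow>\<^sub>0 'i coeff) \<Rightarrow> ('l \<Rightarrow>\<^sub>0 'i coeff)" where
  "star x = Poly_Mapping.map vbar x"

text \<open>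
  The torus algebras of different seeds are copies of one algebra, since basis and product
  depend on the lattice and its form only. A single copy is used for all seeds; only the
  generators \<open>zmon (e i)\<close>, respectively \<open>zmon (dual_basis D e i)\<close>, depend on the seed.
  The exponent of v on the \<open>\<X>\<close> side is \<open>d {n, n'}\<close>, an integer if the exchange matrix
  is integral.
\<close>

definition X_torus :: "('i::finite, 'n::ab_group_add) fixed_data \<Rightarrow> ('n \<Rightarrow>\<^sub>0 'i coeff) ring" where
  "X_torus D = quantum_torus UNIV (\<lambda>n n'. \<lfloor>of_nat (dlcm D) * form D n n'\<rfloor>)"

definition A_torus ::
    "('i, 'n::ab_group_add) fixed_data \<Rightarrow> (('n \<Rightarrow> int) \<Rightarrow> ('n \<Rightarrow> int) \<Rightarrow> int) \<Rightarrow>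
     (('n \<Rightarrow> int) \<Rightarrow>\<^sub>0 'i coeff) ring" where
  "A_torus D \<Lambda> = quantum_torus (Mcirc D) \<Lambda>"

text \<open>\<open>F\<close> is a noncommutative field of fractions of \<open>T\<close>, with embedding \<open>\<iota>\<close>.\<close>

definition fraction_skew_field :: "'a ring \<Rightarrow> 'b ring \<Rightarrow> ('a \<Rightarrow> 'b) \<Rightarrow> bool" where
  "fraction_skew_field T F \<iota> \<longleftrightarrow>
     ring F \<and> Units F = carrier F - {\<zero>\<^bsub>F\<^esub>} \<and>
     \<iota> \<in> ring_hom T F \<and> inj_on \<iota> (carrier T) \<and>
     (\<forall>z\<in>carrier F. \<exists>a\<in>carrier T. \<exists>b\<in>carrier T - {\<zero>\<^bsub>T\<^esub>}. z = \<iota> a \<otimes>\<^bsub>F\<^esub> inv\<^bsub>F\<^esub> (\<iota> b))"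

section \<open>Quantum mutations\<close>

text \<open>
  The l-th factor of the \<open>\<X>\<close>-mutation formula for generator i in direction k. The power
  \<open>q\<^sup>(\<^sup>2\<^sup>l\<^sup>-\<^sup>1\<^sup>)\<^sup>/\<^sup>d\<^sub>k\<close> is the power of \<open>v = q\<^sup>1\<^sup>/\<^sup>d\<close> with exponent \<open>(d / d\<^sub>k) (2 l - 1)\<close>.
\<close>

definition X_factor ::
    "('i::finite, 'n::ab_group_add) fixed_data \<Rightarrow> ('i, 'n) cseed \<Rightarrow> 'i \<Rightarrow> 'i \<Rightarrow> nat \<Rightarrow>
     ('n \<Rightarrow>\<^sub>0 'i coeff)" where
  "X_factor D s k i l =
     (let e = fst s; c = snd s; \<sigma> = sgn (exch D e i k) in
        scalar (tmon (pos_vec (\<lambda>j. \<sigma> * c k j))) +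
        Poly_Mapping.single (zmul (- \<sigma>) (e k))
          (tmon (pos_vec (\<lambda>j. - \<sigma> * c k j)) *
           vpow (int (dlcm D div dd D k) * (2 * int l - 1))))"

definition X_factor_index ::
    "('i, 'n) fixed_data \<Rightarrow> ('i, 'n) cseed \<Rightarrow> 'i \<Rightarrow> 'i \<Rightarrow> nat list" where
  "X_factor_index D s k i = [1..<Suc (nat \<bar>exch D (fst s) i k\<bar>)]"

definition X_mutation ::
    "('i::finite, 'n::ab_group_add) fixed_data \<Rightarrow> 'x ring \<Rightarrow> (('n \<Rightarrow>\<^sub>0 'i coeff) \<Rightarrow> 'x) \<Rightarrow>
     ('i, 'n) cseed \<Rightarrow> 'i \<Rightarrow> ('x \<Rightarrow> 'x) \<Rightarrow> bool" where
  "X_mutation D F \<iota> s k \<mu> \<longleftrightarrow>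
     \<mu> \<in> ring_iso F F \<and>
     (\<forall>c. \<mu> (\<iota> (scalar c)) = \<iota> (scalar c)) \<and>
     \<mu> (\<iota> (zmon (fst (mut D k s) k))) = inv\<^bsub>F\<^esub> (\<iota> (zmon (fst s k))) \<and>
     (\<forall>i. i \<noteq> k \<longrightarrow>
        \<mu> (\<iota> (zmon (fst (mut D k s) i))) =
        \<iota> (zmon (fst s i)) \<otimes>\<^bsub>F\<^esub>
          (foldr (\<lambda>l z. \<iota> (X_factor D s k i l) \<otimes>\<^bsub>F\<^esub> z) (X_factor_index D s k i) \<one>\<^bsub>F\<^esub>)
            [^]\<^bsub>F\<^esub> (- sgn (exch D (fst s) i k)))"

definition A_mutation ::
    "('i::finite, 'n::ab_group_add) fixed_data \<Rightarrow> 'a ring \<Rightarrow>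
     ((('n \<Rightarrow> int) \<Rightarrow>\<^sub>0 'i coeff) \<Rightarrow> 'a) \<Rightarrow> ('i, 'n) cseed \<Rightarrow> 'i \<Rightarrow> ('a \<Rightarrow> 'a) \<Rightarrow> bool" where
  "A_mutation D F \<iota> s k \<mu> \<longleftrightarrow>
     (let f = dual_basis D (fst s); f' = dual_basis D (fst (mut D k s));
          c = snd s; \<epsilon> = exch D (fst s) in
     \<mu> \<in> ring_iso F F \<and>
     (\<forall>c. \<mu> (\<iota> (scalar c)) = \<iota> (scalar c)) \<and>
     (\<forall>i. i \<noteq> k \<longrightarrow> \<mu> (\<iota> (zmon (f' i))) = \<iota> (zmon (f i))) \<and>
     \<mu> (\<iota> (zmon (f' k))) =
       \<iota> (Poly_Mapping.single (- f k + (\<Sum>j | \<epsilon> k j > 0. zmul (\<epsilon> k j) (f j)))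
             (tmon (pos_vec (c k))) +
          Poly_Mapping.single (- f k - (\<Sum>j | \<epsilon> k j < 0. zmul (\<epsilon> k j) (f j)))
             (tmon (pos_vec (\<lambda>j. - c k j)))))"

section \<open>Maps of quantum cluster varieties\<close>

text \<open>
  The homomorphisms are taken over the identification of \<open>q\<^sub>F\<^sub>G\<^sup>1\<^sup>/\<^sup>d\<close> with
  \<open>q\<^sub>B\<^sub>Z\<^sup>-\<^sup>1\<^sup>/\<^sup>2\<close>, that is, they invert v.
\<close>

definition star_alg_hom ::
    "('i::finite, 'n::ab_group_add) fixed_data \<Rightarrow> (('n \<Rightarrow> int) \<Rightarrow> ('n \<Rightarrow> int) \<Rightarrow> int) \<Rightarrow>
     (('n \<Rightarrow>\<^sub>0 'i coeff) \<Rightarrow> (('n \<Rightarrow> int) \<Rightarrow>\<^sub>0 'i coeff)) \<Rightarrow> bool" where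
  "star_alg_hom D \<Lambda> P \<longleftrightarrow>
     P \<in> ring_hom (X_torus D) (A_torus D \<Lambda>) \<and>
     (\<forall>f. P (scalar (tconst f)) = scalar (tconst f)) \<and>
     P (scalar (vpow 1)) = scalar (vpow (- 1)) \<and>
     (\<forall>x\<in>carrier (X_torus D). P (star x) = star (P x))"

definition X_localization ::
    "('i::finite, 'n::ab_group_add) fixed_data \<Rightarrow> 'x ring \<Rightarrow> (('n \<Rightarrow>\<^sub>0 'i coeff) \<Rightarrow> 'x) \<Rightarrow>
     ('i, 'n) cseed \<Rightarrow> 'i \<Rightarrow> 'x set" where
  "X_localization D F \<iota> s k =
     generate_ring F (\<iota> ` carrier (X_torus D) \<union>
       {inv\<^bsub>F\<^esub> (\<iota> (X_factor D s k i l)) | i l. i \<noteq> k \<and> l \<in> set (X_factor_index D s k i)})"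

definition extends_to_localization ::
    "('i::finite, 'n::ab_group_add) fixed_data \<Rightarrow>
     'x ring \<Rightarrow> (('n \<Rightarrow>\<^sub>0 'i coeff) \<Rightarrow> 'x) \<Rightarrow>
     'a ring \<Rightarrow> ((('n \<Rightarrow> int) \<Rightarrow>\<^sub>0 'i coeff) \<Rightarrow> 'a) \<Rightarrow>
     ('i, 'n) cseed \<Rightarrow> 'i \<Rightarrow>
     (('n \<Rightarrow>\<^sub>0 'i coeff) \<Rightarrow> (('n \<Rightarrow> int) \<Rightarrow>\<^sub>0 'i coeff)) \<Rightarrow> ('x \<Rightarrow> 'a) \<Rightarrow> bool" where
  "extends_to_localization D FX \<iota>X FA \<iota>A s k P Q \<longleftrightarrow>
     Q \<in> ring_hom (FX\<lparr>carrier := X_localization D FX \<iota>X s k\<rparr>) FA \<and>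
     (\<forall>x\<in>carrier (X_torus D). Q (\<iota>X x) = \<iota>A (P x))"

text \<open>
  A map from the \<open>\<A>\<close> variety to the \<open>\<X>\<close> variety: \<open>P s\<close> is the homomorphism at the seed s,
  and \<open>P s\<close> extended to the localization is required to commute with every mutation
  from s, on the whole torus algebra of the mutated seed. The extension is unique, so
  demanding commutation of all extensions is no restriction.
\<close>

definition quantum_cluster_map ::
    "('i::finite, 'n::ab_group_add) fixed_data \<Rightarrow> ('i \<Rightarrow> 'n) \<Rightarrow>
     (('n \<Rightarrow> int) \<Rightarrow> ('n \<Rightarrow> int) \<Rightarrow> int) \<Rightarrow>
     'x ring \<Rightarrow> (('n \<Rightarrow>\<^sub>0 'i coeff) \<Rightarrow> 'x) \<Rightarrow>
     (('i, 'n) cseed \<Rightarrow> 'i \<Rightarrow> 'x \<Rightarrow> 'x) \<Rightarrow>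
     'a ring \<Rightarrow> ((('n \<Rightarrow> int) \<Rightarrow>\<^sub>0 'i coeff) \<Rightarrow> 'a) \<Rightarrow>
     (('i, 'n) cseed \<Rightarrow> 'i \<Rightarrow> 'a \<Rightarrow> 'a) \<Rightarrow>
     (('i, 'n) cseed \<Rightarrow> ('n \<Rightarrow>\<^sub>0 'i coeff) \<Rightarrow> (('n \<Rightarrow> int) \<Rightarrow>\<^sub>0 'i coeff)) \<Rightarrow> bool" where
  "quantum_cluster_map D e0 \<Lambda> FX \<iota>X \<mu>X FA \<iota>A \<mu>A P \<longleftrightarrow>
     (\<forall>s\<in>reachable D e0. star_alg_hom D \<Lambda> (P s)) \<and>
     (\<forall>s\<in>reachable D e0. \<forall>k\<in>Iuf D.
        (\<forall>x\<in>carrier (X_torus D). \<mu>X s k (\<iota>X x) \<in> X_localization D FX \<iota>X s k) \<and>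
        (\<exists>Q. extends_to_localization D FX \<iota>X FA \<iota>A s k (P s) Q) \<and>
        (\<forall>Q. extends_to_localization D FX \<iota>X FA \<iota>A s k (P s) Q \<longrightarrow>
           (\<forall>x\<in>carrier (X_torus D). Q (\<mu>X s k (\<iota>X x)) = \<mu>A s k (\<iota>A (P (mut D k s) x)))))"

definition pstar_alg ::
    "('n \<Rightarrow> ('n \<Rightarrow> int)) \<Rightarrow> ('n \<Rightarrow>\<^sub>0 'i coeff) \<Rightarrow> (('n \<Rightarrow> int) \<Rightarrow>\<^sub>0 'i coeff)" where
  "pstar_alg p x =
     (\<Sum>n\<in>Poly_Mapping.keys x. Poly_Mapping.single (p n) (vbar (Poly_Mapping.lookup x n)))"

lemma pstar_alg_hom_necessary:
  fixes D :: "('i::finite, 'n::ab_group_add) fixed_data"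
  assumes hom: "(pstar_alg p :: ('n \<Rightarrow>\<^sub>0 'i coeff) \<Rightarrow> _) \<in> ring_hom (X_torus D) (A_torus D \<Lambda>)"
    and add: "\<And>n n'. p (n + n') = p n + p n'"
  shows "\<Lambda> (p n) (p n') = - \<lfloor>of_nat (dlcm D) * form D n n'\<rfloor>"
proof -
  have inj: "inj (uminus :: int \<Rightarrow> int)" by simp
  have vb: "vbar (vpow a) = (vpow (- a) :: 'i coeff)" for a
    using map_key_single[OF inj, of "- a" "1 :: 'i tpoly"] by (simp add: vbar_def vpow_def)
  have v0: "vpow 0 = (1 :: 'i coeff)" by (simp add: vpow_def)
  have vn0: "vpow a \<noteq> (0 :: 'i coeff)" for a
    unfolding vpow_def by (metis lookup_single_eq lookup_zero zero_neq_one)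
  have vb1: "vbar (1 :: 'i coeff) = 1" using vb[of 0] v0 by simp
  have one: "pstar_alg p (zmon m :: 'n \<Rightarrow>\<^sub>0 'i coeff) = zmon (p m)" for m
    by (simp add: pstar_alg_def zmon_def vb1)
  let ?B = "\<lfloor>of_nat (dlcm D) * form D n n'\<rfloor>"
  have mem: "(zmon m :: 'n \<Rightarrow>\<^sub>0 'i coeff) \<in> carrier (X_torus D)" for m
    by (simp add: X_torus_def quantum_torus_def)
  have L: "zmon n \<otimes>\<^bsub>X_torus D\<^esub> zmon n' = Poly_Mapping.single (n + n') (vpow ?B :: 'i coeff)"
    by (simp add: X_torus_def quantum_torus_def zmon_def)
  have R: "(zmon (p n) :: _ \<Rightarrow>\<^sub>0 'i coeff) \<otimes>\<^bsub>A_torus D \<Lambda>\<^esub> zmon (p n') =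
      Poly_Mapping.single (p n + p n') (vpow (\<Lambda> (p n) (p n')))"
    by (simp add: A_torus_def quantum_torus_def zmon_def)
  have "Poly_Mapping.single (p (n + n')) (vpow (- ?B) :: 'i coeff) =
      Poly_Mapping.single (p n + p n') (vpow (\<Lambda> (p n) (p n')))"
    using ring_hom_mult[OF hom mem mem, of n n'] unfolding L R one
    by (simp add: pstar_alg_def vn0 vb)
  then have "vpow (- ?B) = (vpow (\<Lambda> (p n) (p n')) :: 'i coeff)"
    by (metis add lookup_single_eq)
  then have "Poly_Mapping.keys (vpow (- ?B) :: 'i coeff) = Poly_Mapping.keys (vpow (\<Lambda> (p n) (p n')) :: 'i coeff)"
    by simp
  then have "- ?B = \<Lambda> (p n) (p n')"
    by (simp add: vpow_def)
  then show ?thesis by simp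
qed

end

theory Submission
  imports Defs
begin

text \<open>
  Write \<open>A\<^sup>m\<close> for the monomials of the \<open>\<A>\<close>-torus, \<open>y = {e\<^sub>k, \<cdot>}\<close> and \<open>\<delta> = d / d\<^sub>k\<close>. The compatibility
  condition at the initial seed extends linearly to \<open>\<Lambda>({n, \<cdot>}, m) = m(d n)\<close> for unfrozen n
  (\<open>Lam_form_map\<close>). No seed occurs in this relation, so it has two consequences at every seed. First,
  \<open>\<Lambda>(p n, p n') = - d {n, n'}\<close> (\<open>Lam_p\<close>), hence \<open>X\<^sup>n \<mapsto> A\<^sup>p\<^sup>n\<close> is a homomorphism that inverts v
  (\<open>pstar_star_alg_hom\<close>). Second, \<open>A\<^sup>y\<close> commutes with \<open>A\<^sup>m\<close> up to the power of v with
  exponent \<open>2 \<delta>\<close> times the coefficient of \<open>f\<^sub>k\<close> in m.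

  The exchange relation sends the monomial of the new dual basis vector \<open>f'\<close> to
  \<open>(T_minus + T_plus v\<^sup>\<delta> A\<^sup>y) A\<^sup>f\<^sup>'\<close>, where \<open>T_plus\<close> and \<open>T_minus\<close> are the two central monomials in the
  coefficients t, and it fixes the monomials without \<open>f'\<close>. If m contains \<open>f'\<close> with multiplicity
  \<open>n \<ge> 0\<close>, collecting the n binomials on the left shifts their powers of v, and the image of
  \<open>A\<^sup>m\<close> is the product of \<open>T_minus + T_plus v\<^sup>\<delta>\<^sup>(\<^sup>2\<^sup>l\<^sup>-\<^sup>1\<^sup>) A\<^sup>y\<close> for \<open>l = 1, \<dots>, n\<close>, times \<open>A\<^sup>m\<close>
  (\<open>exchange_zmon\<close>). The multiplicity of \<open>f'\<close> in the image under p of the mutated basis vector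
  \<open>e'\<^sub>i\<close> is \<open>- \<epsilon>\<^sub>i\<^sub>k\<close>, so this product has as many factors as the \<open>\<X>\<close>-mutation, and they
  are the images of those factors. For \<open>\<epsilon>\<^sub>i\<^sub>k > 0\<close> the same formula is used for the inverse monomial,
  with the other term of the exchange relation factored out (\<open>commute_generator\<close>). Since the
  generators and their inverses generate the torus algebra, all of it commutes with mutation
  (\<open>commuting_all\<close>).

  That the homomorphism extends to the localization is an Ore argument. The denominators are
  the nonzero Laurent polynomials in \<open>X\<^sub>k\<close>; they have common multiples because conjugation by a
  monomial permutes them (\<open>cyclic_ore\<close>), and p maps them to nonzero elements because \<open>y \<noteq> 0\<close>
  (\<open>extension_exists\<close>).
\<close>

section \<open>Integer multiples and additive maps on lattices\<close>

lemma zmul_diff_of_nat: "zmul (int m - int n) x = (\<Sum>j<m. x) - (\<Sum>j<n. x)"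
proof -
  have rep_add: "(\<Sum>j<a + b. x) = (\<Sum>j<a. x) + (\<Sum>j<b. x)" for a b :: nat
    by (induction a) (simp_all add: add.assoc)
  show ?thesis
  proof (cases "n \<le> m")
    case True
    then obtain r where "m = n + r" using le_Suc_ex by blast
    then show ?thesis by (simp add: zmul_def rep_add)
  next
    case False
    then obtain r where "n = m + r" by (metis le_Suc_ex nat_le_linear)
    then show ?thesis by (simp add: zmul_def rep_add)
  qed
qed

lemma zmul_0 [simp]: "zmul 0 x = 0"
  by (simp add: zmul_def)

lemma zmul_1 [simp]: "zmul 1 x = x"
  by (simp add: zmul_def)

lemma zmul_add: "zmul (a + b) x = zmul a x + zmul b x"
proof -
  obtain m n where a: "a = int m - int n" by (metis int_diff_cases)
  obtain m' n' where b: "b = int m' - int n'" by (metis int_diff_cases)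
  have rep_add: "(\<Sum>j<c + d. x) = (\<Sum>j<c. x) + (\<Sum>j<d. x)" for c d :: nat
    by (induction c) (simp_all add: add.assoc)
  have "a + b = int (m + m') - int (n + n')" by (simp add: a b)
  then show ?thesis
    unfolding a b by (simp only: zmul_diff_of_nat rep_add) (simp add: algebra_simps)
qed

lemma zmul_uminus: "zmul (- a) x = - zmul a x"
  by (simp add: zmul_def)

lemma zmul_diff: "zmul (a - b) x = zmul a x - zmul b x"
  using zmul_add[of a "- b" x] by (simp add: zmul_uminus)

lemma zmul_closed:
  assumes "P 0" and "P x" and "\<And>u v. P u \<Longrightarrow> P v \<Longrightarrow> P (u - v)"
  shows "P (zmul a x)"
proof (induction a rule: int_induct[where k = 0])
  case base
  show ?case using assms(1) by simp
next
  case (step1 i)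
  have "P (- x)" using assms(3)[OF assms(1,2)] by simp
  then have "P (zmul i x - - x)" using assms(3) step1 by blast
  then show ?case by (simp add: zmul_add)
next
  case (step2 i)
  then show ?case using assms(2,3) by (simp add: zmul_diff)
qed

definition sublattice :: "'a::ab_group_add set \<Rightarrow> bool" where
  "sublattice L \<longleftrightarrow> 0 \<in> L \<and> (\<forall>x\<in>L. \<forall>y\<in>L. x - y \<in> L)"

lemma sublattice_UNIV [simp]: "sublattice UNIV"
  by (simp add: sublattice_def)

lemma sublattice_zero: "sublattice L \<Longrightarrow> 0 \<in> L"
  by (simp add: sublattice_def)

lemma sublattice_diff: "sublattice L \<Longrightarrow> x \<in> L \<Longrightarrow> y \<in> L \<Longrightarrow> x - y \<in> L"
  by (simp add: sublattice_def)

lemma sublattice_uminus: "sublattice L \<Longrightarrow> x \<in> L \<Longrightarrow> - x \<in> L"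
  using sublattice_diff[of L 0 x] by (simp add: sublattice_zero)

lemma sublattice_add: "sublattice L \<Longrightarrow> x \<in> L \<Longrightarrow> y \<in> L \<Longrightarrow> x + y \<in> L"
  using sublattice_diff[of L x "- y"] by (simp add: sublattice_uminus)

lemma sublattice_zmul: "sublattice L \<Longrightarrow> x \<in> L \<Longrightarrow> zmul a x \<in> L"
  by (rule zmul_closed) (auto simp: sublattice_zero sublattice_diff)

lemma sublattice_sum: "sublattice L \<Longrightarrow> (\<And>j. j \<in> J \<Longrightarrow> f j \<in> L) \<Longrightarrow> sum f J \<in> L"
  by (induction J rule: infinite_finite_induct) (auto simp: sublattice_zero sublattice_add)

definition additive_on :: "'a::ab_group_add set \<Rightarrow> ('a \<Rightarrow> 'b::ab_group_add) \<Rightarrow> bool" where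
  "additive_on L f \<longleftrightarrow> (\<forall>x\<in>L. \<forall>y\<in>L. f (x + y) = f x + f y)"

lemma additive_on_add: "additive_on L f \<Longrightarrow> x \<in> L \<Longrightarrow> y \<in> L \<Longrightarrow> f (x + y) = f x + f y"
  by (simp add: additive_on_def)

lemma additive_on_0: "additive_on L f \<Longrightarrow> sublattice L \<Longrightarrow> f 0 = 0"
  using additive_on_add[of L f 0 0] by (simp add: sublattice_zero)

lemma additive_on_diff:
  "additive_on L f \<Longrightarrow> sublattice L \<Longrightarrow> x \<in> L \<Longrightarrow> y \<in> L \<Longrightarrow> f (x - y) = f x - f y"
  using additive_on_add[of L f "x - y" y] by (simp add: sublattice_diff)

lemma additive_on_uminus: "additive_on L f \<Longrightarrow> sublattice L \<Longrightarrow> x \<in> L \<Longrightarrow> f (- x) = - f x"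
  using additive_on_diff[of L f 0 x] by (simp add: sublattice_zero additive_on_0)

lemma additive_on_zmul:
  assumes "additive_on L f" "sublattice L" "x \<in> L"
  shows "f (zmul a x) = zmul a (f x)"
proof (induction a rule: int_induct[where k = 0])
  case base
  show ?case using assms by (simp add: additive_on_0)
next
  case (step1 i)
  then show ?case using assms by (simp add: zmul_add additive_on_add sublattice_zmul)
next
  case (step2 i)
  then show ?case using assms by (simp add: zmul_diff additive_on_diff sublattice_zmul)
qed

lemma additive_on_sum:
  assumes "additive_on L f" "sublattice L" "\<And>j. j \<in> J \<Longrightarrow> g j \<in> L"
  shows "f (sum g J) = (\<Sum>j\<in>J. f (g j))"
  using assms(3)
  by (induction J rule: infinite_finite_induct)
    (auto simp: additive_on_0[OF assms(1,2)] additive_on_add[OF assms(1)] sublattice_sum[OF assms(2)])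

lemma zmul_ring: "zmul a (r :: 'a::ring_1) = of_int a * r"
proof -
  have "zmul a (1 :: 'a) = of_int a"
    by (induction a rule: int_induct[where k = 0]) (auto simp: zmul_add zmul_diff)
  then show ?thesis
    using additive_on_zmul[of UNIV "\<lambda>s. s * r" "1 :: 'a" a]
    by (simp add: additive_on_def algebra_simps)
qed

lemma zmul_int: "zmul a (r :: int) = a * r"
  by (simp add: zmul_ring)

lemma zmul_apply: "zmul a \<phi> x = zmul a (\<phi> x)"
  using additive_on_zmul[of UNIV "\<lambda>\<phi>. \<phi> x" \<phi> a] by (simp add: additive_on_def)

lemma zmul_add_right: "zmul a (x + y) = zmul a x + zmul a y"
  by (induction a rule: int_induct[where k = 0]) (auto simp: zmul_add zmul_diff algebra_simps)

lemma zmul_zmul: "zmul a (zmul b x) = zmul (a * b) x"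
  by (induction a rule: int_induct[where k = 0]) (auto simp: zmul_add zmul_diff algebra_simps)

lemma zmul_uminus_right: "zmul a (- x) = - zmul a x"
proof -
  have "additive_on UNIV (zmul a :: 'a \<Rightarrow> 'a)" by (simp add: additive_on_def zmul_add_right)
  then show ?thesis by (rule additive_on_uminus) simp_all
qed

lemma zmul_sum: "zmul (\<Sum>j\<in>J. f j) x = (\<Sum>j\<in>J. zmul (f j) x)"
  using additive_on_sum[of UNIV "\<lambda>a. zmul a x" J f] by (simp add: additive_on_def zmul_add)

lemma bilinear_zmul_left:
  assumes "\<And>x y z. B (x + y) z = B x z + B y z"
  shows "B (zmul a x) z = of_int a * (B x z :: 'r::ring_1)"
  using additive_on_zmul[of UNIV "\<lambda>x. B x z" x a] assms by (simp add: additive_on_def zmul_ring)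


section \<open>Bases\<close>

lemma zbasis_induct:
  assumes "zbasis J b L" and "x \<in> L" and "P 0" and "\<And>j. j \<in> J \<Longrightarrow> P (b j)"
    and "\<And>x y. P x \<Longrightarrow> P y \<Longrightarrow> P (x - y)"
  shows "P x"
proof -
  have L: "sublattice (Collect P)" using assms by (simp add: sublattice_def)
  obtain a where "x = (\<Sum>j\<in>J. zmul (a j) (b j))"
    using assms(1,2) by (auto simp: zbasis_def bij_betw_def)
  moreover have "(\<Sum>j\<in>J. zmul (a j) (b j)) \<in> Collect P"
    using assms(4) by (intro sublattice_sum[OF L] sublattice_zmul[OF L]) simp
  ultimately show ?thesis by simp
qed

lemma zbasis_in: "zbasis J b L \<Longrightarrow> j \<in> J \<Longrightarrow> b j \<in> L"
proof -
  assume b: "zbasis J b L" and j: "j \<in> J"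
  let ?a = "\<lambda>i. if i = j then 1 else 0 :: int"
  have "(\<Sum>i\<in>J. zmul (?a i) (b i)) = (\<Sum>i\<in>J. if i = j then b i else 0)"
    by (rule sum.cong) auto
  also have "\<dots> = b j" using j by simp
  finally have "(\<Sum>i\<in>J. zmul (?a i) (b i)) = b j" .
  moreover have "(\<Sum>i\<in>J. zmul (?a i) (b i)) \<in> L"
    using bij_betw_apply[of _ _ L ?a] b j unfolding zbasis_def by fastforce
  ultimately show "b j \<in> L" by simp
qed

text \<open>The multiples of \<open>b j\<close> have different coordinate vectors, all on the j-th axis.\<close>

lemma zbasis_zmul_eq_0:
  assumes "zbasis J b L" "j \<in> J" "zmul a (b j) = 0"
  shows "a = 0"
proof -
  let ?f = "\<lambda>a :: 'a \<Rightarrow> int. \<Sum>j\<in>J. zmul (a j) (b j)"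
  let ?a = "\<lambda>i. if i = j then a else 0"
  have "?f ?a = (\<Sum>i\<in>J. if i = j then zmul a (b i) else 0)"
    by (rule sum.cong) auto
  also have "\<dots> = ?f (\<lambda>_. 0)" using assms(2,3) by simp
  finally have "?a = (\<lambda>_. 0)"
    using assms(1,2) unfolding zbasis_def bij_betw_def inj_on_def by force
  then show ?thesis by (meson)
qed

text \<open>
  This provides dual basis vectors in the form in which the dual lattice is represented:
  coordinate functions, continued by 0 outside the lattice.
\<close>

lemma zbasis_coordinate:
  assumes b: "zbasis UNIV b L" and L: "sublattice L"
  obtains \<phi> :: "'a::ab_group_add \<Rightarrow> int"
  where "additive_on L \<phi>" "\<And>x. x \<notin> L \<Longrightarrow> \<phi> x = 0"
    "\<And>j. \<phi> (b j) = (if i = j then 1 else 0)"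
proof -
  let ?f = "\<lambda>a. \<Sum>j\<in>UNIV. zmul (a j) (b j)"
  have bij: "bij_betw ?f UNIV L" using b by (simp add: zbasis_def)
  define g where "g = inv_into UNIV ?f"
  have gf: "g (?f a) = a" for a
    unfolding g_def by (rule inv_into_f_f) (use bij in \<open>auto simp: bij_betw_def\<close>)
  have fg: "?f (g x) = x" if "x \<in> L" for x
  proof -
    have "x \<in> ?f ` UNIV" using bij that unfolding bij_betw_def by blast
    then obtain a where "x = ?f a" by blast
    then show ?thesis using gf by simp
  qed
  define \<phi> where "\<phi> x = (if x \<in> L then g x i else 0)" for x
  have g_add: "g (x + y) = (\<lambda>j. g x j + g y j)" if "x \<in> L" "y \<in> L" for x y
  proof -
    have "x + y = ?f (\<lambda>j. g x j + g y j)"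
      by (simp only: zmul_add sum.distrib fg that)
    then show ?thesis using gf by simp
  qed
  have g_b: "g (b j) = (\<lambda>l. if l = j then 1 else 0)" for j
  proof -
    have "?f (\<lambda>l. if l = j then 1 else 0) = (\<Sum>l\<in>UNIV. if l = j then b l else 0)"
      by (rule sum.cong) auto
    then have "b j = ?f (\<lambda>l. if l = j then 1 else 0)" by simp
    then show ?thesis using gf by simp
  qed
  show ?thesis
  proof (rule that[of \<phi>])
    show "additive_on L \<phi>" by (simp add: additive_on_def \<phi>_def g_add sublattice_add[OF L])
    show "\<phi> x = 0" if "x \<notin> L" for x using that by (simp add: \<phi>_def)
    show "\<phi> (b j) = (if i = j then 1 else 0)" for j
      using zbasis_in[OF b] by (simp add: \<phi>_def g_b)
  qed
qed

text \<open>
  The change of coordinates negates the k-th coordinate and adds a combination of the others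
  to it. It is an involution, hence bijective.
\<close>

lemma zbasis_mutate:
  assumes b: "zbasis J b L" and k: "k \<in> J"
    and b': "\<And>i. b' i = (if i = k then - b k else b i + zmul (t i) (b k))"
  shows "zbasis J b' L"
proof -
  let ?C = "{a :: 'a \<Rightarrow> int. \<forall>j. j \<notin> J \<longrightarrow> a j = 0}"
  define \<psi> where "\<psi> a = a(k := (\<Sum>j\<in>J - {k}. a j * t j) - a k)" for a :: "'a \<Rightarrow> int"
  have inC: "\<psi> a \<in> ?C" if "a \<in> ?C" for a using that k by (auto simp: \<psi>_def)
  have inv: "\<psi> (\<psi> a) = a" for a by (auto simp: \<psi>_def fun_eq_iff intro!: sum.cong)
  have "bij_betw \<psi> ?C ?C" by (rule bij_betw_byWitness[where f' = \<psi>]) (use inC inv in auto)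
  then have "bij_betw ((\<lambda>a. \<Sum>j\<in>J. zmul (a j) (b j)) \<circ> \<psi>) ?C L"
    using b unfolding zbasis_def by (rule bij_betw_trans)
  moreover have "(\<Sum>j\<in>J. zmul (\<psi> a j) (b j)) = (\<Sum>j\<in>J. zmul (a j) (b' j))" for a
  proof -
    have "(\<Sum>j\<in>J. zmul (a j) (b' j)) = zmul (a k) (b' k) + (\<Sum>j\<in>J - {k}. zmul (a j) (b' j))"
      using k by (simp add: sum.remove)
    also have "\<dots> = - zmul (a k) (b k) +
        (\<Sum>j\<in>J - {k}. zmul (a j) (b j) + zmul (a j * t j) (b k))"
      by (simp add: b' zmul_uminus_right zmul_add_right zmul_zmul)
    also have "\<dots> = zmul (\<psi> a k) (b k) + (\<Sum>j\<in>J - {k}. zmul (a j) (b j))"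
      by (simp add: sum.distrib \<psi>_def zmul_diff zmul_sum)
    also have "(\<Sum>j\<in>J - {k}. zmul (a j) (b j)) = (\<Sum>j\<in>J - {k}. zmul (\<psi> a j) (b j))"
      by (rule sum.cong) (auto simp: \<psi>_def)
    also have "zmul (\<psi> a k) (b k) + \<dots> = (\<Sum>j\<in>J. zmul (\<psi> a j) (b j))"
      using k by (simp add: sum.remove)
    finally show ?thesis by simp
  qed
  ultimately show ?thesis by (simp add: zbasis_def comp_def)
qed

lemma zbasis_sublattice:
  assumes "zbasis J b L"
  shows "sublattice L"
proof -
  let ?C = "{a :: 'a \<Rightarrow> int. \<forall>j. j \<notin> J \<longrightarrow> a j = 0}"
  let ?f = "\<lambda>a. \<Sum>j\<in>J. zmul (a j) (b j)"
  have L: "L = ?f ` ?C" using assms by (simp add: zbasis_def bij_betw_def)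
  have "0 \<in> L" unfolding L by (rule image_eqI[of _ _ "\<lambda>_. 0"]) auto
  moreover have "x - y \<in> L" if xy: "x \<in> L" "y \<in> L" for x y
  proof -
    obtain a where a: "x = ?f a" "a \<in> ?C" using xy(1) unfolding L by blast
    obtain c where c: "y = ?f c" "c \<in> ?C" using xy(2) unfolding L by blast
    have "x - y = ?f (\<lambda>j. a j - c j)" by (simp add: a(1) c(1) zmul_diff sum_subtractf)
    then show ?thesis unfolding L image_iff
      by (intro bexI[of _ "\<lambda>j. a j - c j"]) (use a(2) c(2) in simp_all)
  qed
  ultimately show ?thesis by (simp add: sublattice_def)
qed

section \<open>Seeds and their dual bases\<close>

locale cluster_data =
  fixes D :: "('i::finite, 'n::ab_group_add) fixed_data"
  assumes fixed: "is_fixed_data D"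
begin

lemma form_add_left: "form D (x + y) z = form D x z + form D y z"
  and form_add_right: "form D x (y + z) = form D x y + form D x z"
  and form_skew: "form D x y = - form D y x"
  using fixed unfolding is_fixed_data_def by (elim conjE, blast)+

lemma form_self: "form D x x = 0"
  using form_skew[of x x] by simp

lemma form_zmul_left: "form D (zmul a x) z = of_int a * form D x z"
  by (rule bilinear_zmul_left) (rule form_add_left)

lemma form_zmul_right: "form D z (zmul a x) = of_int a * form D z x"
  using form_zmul_left[of a x z] form_skew[of z "zmul a x"] form_skew[of z x] by simp

lemma form_uminus_left: "form D (- x) z = - form D x z"
  using additive_on_uminus[of UNIV "\<lambda>x. form D x z" x] by (simp add: additive_on_def form_add_left)

lemma form_diff_left: "form D (x - y) z = form D x z - form D y z"
  using form_add_left[of x "- y" z] by (simp add: form_uminus_left)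

lemma form_uminus_right: "form D z (- x) = - form D z x"
  using form_uminus_left[of x z] form_skew[of z "- x"] form_skew[of z x] by simp

lemma dd_pos: "dd D i > 0"
  using fixed unfolding is_fixed_data_def by (elim conjE) blast

definition delta :: "'i \<Rightarrow> int" where
  "delta k = int (dlcm D div dd D k)"

lemma dlcm_eq_delta: "int (dlcm D) = delta k * int (dd D k)"
proof -
  have "dd D k dvd dlcm D" by (simp add: dlcm_def dvd_Lcm)
  then show ?thesis unfolding delta_def by (metis dvd_div_mult_self of_nat_mult)
qed

lemma sublattice_Ncirc: "sublattice (Ncirc D)"
  using fixed unfolding is_fixed_data_def sublattice_def by (elim conjE) blast

lemma sublattice_Nuf: "sublattice (Nuf D)"
proof -
  have "\<exists>b. zbasis (Iuf D) b (Nuf D)" using fixed unfolding is_fixed_data_def by (elim conjE)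
  then show ?thesis using zbasis_sublattice by blast
qed

lemma form_Nuf_Ncirc: "x \<in> Nuf D \<Longrightarrow> y \<in> Ncirc D \<Longrightarrow> form D x y \<in> \<int>"
  using fixed unfolding is_fixed_data_def by (elim conjE) blast

lemma Mcirc_additive: "\<phi> \<in> Mcirc D \<Longrightarrow> additive_on (Ncirc D) \<phi>"
  by (simp add: Mcirc_def additive_on_def)

lemma Mcirc_outside: "\<phi> \<in> Mcirc D \<Longrightarrow> x \<notin> Ncirc D \<Longrightarrow> \<phi> x = 0"
  by (simp add: Mcirc_def)

lemma sublattice_Mcirc: "sublattice (Mcirc D)"
  unfolding sublattice_def Mcirc_def by simp

lemma form_map_eq: "x \<in> Nuf D \<Longrightarrow> y \<in> Ncirc D \<Longrightarrow> of_int (form_map D x y) = form D x y"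
  using form_Nuf_Ncirc[of x y] by (simp add: form_map_def)

lemma form_map_in: "x \<in> Nuf D \<Longrightarrow> form_map D x \<in> Mcirc D"
proof -
  assume x: "x \<in> Nuf D"
  have "form_map D x (y + z) = form_map D x y + form_map D x z"
    if "y \<in> Ncirc D" "z \<in> Ncirc D" for y z
  proof -
    have "rat_of_int (form_map D x (y + z)) = rat_of_int (form_map D x y + form_map D x z)"
      using x that by (simp add: form_map_eq sublattice_add[OF sublattice_Ncirc] form_add_right)
    then show ?thesis by (simp only: of_int_eq_iff)
  qed
  then show ?thesis by (simp add: Mcirc_def) (simp add: form_map_def)
qed

lemma form_map_diff:
  assumes "x \<in> Nuf D" "y \<in> Nuf D"
  shows "form_map D (x - y) = form_map D x - form_map D y"
proof
  fix z
  show "form_map D (x - y) z = (form_map D x - form_map D y) z"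
  proof (cases "z \<in> Ncirc D")
    case True
    have "rat_of_int (form_map D (x - y) z) = rat_of_int (form_map D x z - form_map D y z)"
      using assms True by (simp add: form_map_eq sublattice_diff[OF sublattice_Nuf] form_diff_left)
    then show ?thesis by (simp only: of_int_eq_iff) simp
  qed (simp add: form_map_def)
qed

text \<open>The coefficient of the j-th dual basis vector of the seed e in \<open>\<phi>\<close>.\<close>

definition coord :: "('i \<Rightarrow> 'n) \<Rightarrow> ('n \<Rightarrow> int) \<Rightarrow> 'i \<Rightarrow> int" where
  "coord e \<phi> j = \<phi> (zmul (int (dd D j)) (e j))"

lemma coord_add: "coord e (\<phi> + \<psi>) j = coord e \<phi> j + coord e \<psi> j"
  and coord_diff: "coord e (\<phi> - \<psi>) j = coord e \<phi> j - coord e \<psi> j"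
  and coord_uminus: "coord e (- \<phi>) j = - coord e \<phi> j"
  and coord_0: "coord e 0 j = 0"
  by (simp_all add: coord_def)

lemma coord_zmul: "coord e (zmul a \<phi>) j = a * coord e \<phi> j"
  by (simp add: coord_def zmul_apply) (simp add: zmul_int)

lemma coord_sum: "coord e (sum g J) j = (\<Sum>l\<in>J. coord e (g l) j)"
  using additive_on_sum[of UNIV "\<lambda>\<phi>. coord e \<phi> j" J g] by (simp add: additive_on_def coord_add)

lemma seed_bases:
  assumes "is_seed D e"
  shows "zbasis UNIV e UNIV" "zbasis (Iuf D) e (Nuf D)"
    "zbasis UNIV (\<lambda>i. zmul (int (dd D i)) (e i)) (Ncirc D)"
  using assms by (simp_all add: is_seed_def)

lemma seed_scaled_in: "is_seed D e \<Longrightarrow> zmul (int (dd D i)) (e i) \<in> Ncirc D"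
  using zbasis_in[OF seed_bases(3), of e i] by simp

lemma seed_Nuf: "is_seed D e \<Longrightarrow> k \<in> Iuf D \<Longrightarrow> e k \<in> Nuf D"
  using zbasis_in[OF seed_bases(2)] by blast

lemma Mcirc_eqI:
  assumes "is_seed D e" "\<phi> \<in> Mcirc D" "\<psi> \<in> Mcirc D" "\<And>j. coord e \<phi> j = coord e \<psi> j"
  shows "\<phi> = \<psi>"
proof
  fix x
  show "\<phi> x = \<psi> x"
  proof (cases "x \<in> Ncirc D")
    case True
    have "x \<in> Ncirc D \<and> \<phi> x = \<psi> x"
    proof (rule zbasis_induct[OF seed_bases(3)[OF assms(1)] True])
      show "0 \<in> Ncirc D \<and> \<phi> 0 = \<psi> 0"
        using assms sublattice_Ncirc
        by (simp add: additive_on_0[OF Mcirc_additive] sublattice_zero)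
      show "zmul (int (dd D j)) (e j) \<in> Ncirc D \<and>
          \<phi> (zmul (int (dd D j)) (e j)) = \<psi> (zmul (int (dd D j)) (e j))" for j
        using assms(4)[of j] seed_scaled_in[OF assms(1)] by (simp add: coord_def)
      show "x - y \<in> Ncirc D \<and> \<phi> (x - y) = \<psi> (x - y)"
        if "x \<in> Ncirc D \<and> \<phi> x = \<psi> x" "y \<in> Ncirc D \<and> \<phi> y = \<psi> y" for x y
        using that assms sublattice_Ncirc
        by (simp add: additive_on_diff[OF Mcirc_additive] sublattice_diff)
    qed
    then show ?thesis by simp
  qed (metis Mcirc_outside assms(2,3))
qed

lemma dual_basis_spec:
  assumes "is_seed D e"
  shows "dual_basis D e i \<in> Mcirc D \<and> (\<forall>j. coord e (dual_basis D e i) j = (if i = j then 1 else 0))"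
proof -
  obtain \<phi> :: "'n \<Rightarrow> int" where \<phi>: "additive_on (Ncirc D) \<phi>" "\<And>x. x \<notin> Ncirc D \<Longrightarrow> \<phi> x = 0"
    "\<And>j. \<phi> (zmul (int (dd D j)) (e j)) = (if i = j then 1 else 0)"
    using zbasis_coordinate[OF seed_bases(3)[OF assms] sublattice_Ncirc] by metis
  have \<phi>M: "\<phi> \<in> Mcirc D" using \<phi>(1,2) by (simp add: Mcirc_def additive_on_def)
  show ?thesis unfolding dual_basis_def coord_def
  proof (rule theI2[of _ \<phi>])
    show "\<phi> \<in> Mcirc D \<and> (\<forall>j. \<phi> (zmul (int (dd D j)) (e j)) = (if i = j then 1 else 0))"
      using \<phi>M \<phi>(3) by simp
    show "\<psi> = \<phi>"
      if "\<psi> \<in> Mcirc D \<and> (\<forall>j. \<psi> (zmul (int (dd D j)) (e j)) = (if i = j then 1 else 0))" for \<psi>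
      using that \<phi>M \<phi>(3) by (intro Mcirc_eqI[OF assms]) (simp_all add: coord_def)
  qed
qed

lemma dual_basis_in: "is_seed D e \<Longrightarrow> dual_basis D e i \<in> Mcirc D"
  and coord_dual_basis: "is_seed D e \<Longrightarrow> coord e (dual_basis D e i) j = (if i = j then 1 else 0)"
  using dual_basis_spec by blast+

lemma Mcirc_expand:
  assumes "is_seed D e" "\<phi> \<in> Mcirc D"
  shows "\<phi> = (\<Sum>j\<in>UNIV. zmul (coord e \<phi> j) (dual_basis D e j))"
  using assms
  by (intro Mcirc_eqI[of e])
    (auto simp: coord_sum coord_zmul coord_dual_basis dual_basis_in if_distrib cong: if_cong
      intro!: sublattice_sum[OF sublattice_Mcirc] sublattice_zmul[OF sublattice_Mcirc])


section \<open>Mutation of seeds\<close>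

lemma exch_eq:
  "exch_integral D e \<Longrightarrow> of_int (exch D e i j) = form D (e i) (e j) * of_nat (dd D j)"
  by (simp add: exch_integral_def exch_def exch_rat_def)

lemma exch_skew_symmetrizable:
  assumes "exch_integral D e"
  shows "int (dd D i) * exch D e i k = - exch D e k i * int (dd D k)"
proof -
  have "rat_of_int (int (dd D i) * exch D e i k) = rat_of_int (- exch D e k i * int (dd D k))"
    using form_skew[of "e i" "e k"] by (simp add: exch_eq[OF assms])
  then show ?thesis by (simp only: of_int_eq_iff)
qed

lemma exch_self: "exch_integral D e \<Longrightarrow> exch D e k k = 0"
  using exch_eq[of e k k] by (simp add: form_self)

lemma exch_skew_pos_part:
  assumes "exch_integral D e"
  shows "int (dd D i) * max 0 (exch D e i k) = max 0 (- exch D e k i) * int (dd D k)"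
proof -
  have "int (dd D i) * max 0 (exch D e i k) = max 0 (int (dd D i) * exch D e i k)"
    by (simp add: max_mult_distrib_left)
  also have "\<dots> = max 0 (- exch D e k i) * int (dd D k)"
    by (simp add: exch_skew_symmetrizable[OF assms] max_mult_distrib_right)
  finally show ?thesis .
qed

lemma mut_basis_scaled:
  assumes "exch_integral D e"
  shows "zmul (int (dd D i)) (mut_basis D k e i) =
    (if i = k then - zmul (int (dd D k)) (e k)
     else zmul (int (dd D i)) (e i) + zmul (max 0 (- exch D e k i)) (zmul (int (dd D k)) (e k)))"
  using exch_skew_pos_part[OF assms, of i k]
  by (simp add: mut_basis_def zmul_uminus_right zmul_add_right zmul_zmul)

lemma seed_mutate:
  assumes "is_seed D e" "exch_integral D e" "k \<in> Iuf D"
  shows "is_seed D (mut_basis D k e)"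
  unfolding is_seed_def
proof (intro conjI)
  show "zbasis UNIV (mut_basis D k e) UNIV"
    by (rule zbasis_mutate[OF seed_bases(1)[OF assms(1)], of k]) (auto simp: mut_basis_def)
  show "zbasis (Iuf D) (mut_basis D k e) (Nuf D)"
    by (rule zbasis_mutate[OF seed_bases(2)[OF assms(1)] assms(3)]) (auto simp: mut_basis_def)
  show "zbasis UNIV (\<lambda>i. zmul (int (dd D i)) (mut_basis D k e i)) (Ncirc D)"
    by (rule zbasis_mutate[OF seed_bases(3)[OF assms(1)], of k])
      (auto simp: mut_basis_scaled[OF assms(2)])
qed

text \<open>
  The scaled vectors \<open>d\<^sub>j e'\<^sub>j\<close> are integral combinations of the \<open>d\<^sub>i e\<^sub>i\<close>, because
  \<open>d\<^sub>j [\<epsilon>\<^sub>j\<^sub>k]\<^sub>+ = [- \<epsilon>\<^sub>k\<^sub>j]\<^sub>+ d\<^sub>k\<close>. So the pairings with them stay integers.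
\<close>

lemma exch_integral_mutate:
  assumes "exch_integral D e"
  shows "exch_integral D (mut_basis D k e)"
proof -
  have int: "form D (e i) (e j) * of_nat (dd D j) \<in> \<int>" for i j
    using exch_eq[OF assms, of i j] by (metis Ints_of_int)
  have "form D (mut_basis D k e i) (mut_basis D k e j) * of_nat (dd D j) \<in> \<int>" for i j
  proof (cases "j = k")
    case True
    then show ?thesis using int[of i k]
      by (simp add: mut_basis_def form_uminus_left form_uminus_right form_add_left form_zmul_left
          form_self)
  next
    case False
    have scaled: "form D x (mut_basis D k e j) * of_nat (dd D j) =
        form D x (e j) * of_nat (dd D j) +
        of_int (max 0 (- exch D e k j)) * (form D x (e k) * of_nat (dd D k))" for x
      using arg_cong[OF mut_basis_scaled[OF assms, of j k], of "form D x"] False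
      by (simp add: form_zmul_right form_add_right mult_ac)
    have *: "form D (e l) (mut_basis D k e j) * of_nat (dd D j) \<in> \<int>" for l
      unfolding scaled by (intro Ints_add Ints_mult int Ints_of_int)
    show ?thesis
    proof (cases "i = k")
      case True
      then show ?thesis using *[of k] by (simp add: mut_basis_def form_uminus_left)
    next
      case False
      have "form D (mut_basis D k e i) (mut_basis D k e j) * of_nat (dd D j) =
          form D (e i) (mut_basis D k e j) * of_nat (dd D j) +
          of_int (max 0 (exch D e i k)) * (form D (e k) (mut_basis D k e j) * of_nat (dd D j))"
        using False by (simp add: mut_basis_def[of D k e] form_add_left form_zmul_left algebra_simps)
      then show ?thesis using * by (metis Ints_add Ints_mult Ints_of_int)
    qed
  qed
  then show ?thesis by (simp add: exch_integral_def exch_rat_def)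
qed

lemma reachable_seed:
  assumes "is_seed D e0" "exch_integral D e0" "s \<in> reachable D e0"
  shows "is_seed D (fst s) \<and> exch_integral D (fst s)"
  using assms(3)
  by induction (auto simp: assms(1,2) mut_def seed_mutate exch_integral_mutate)

context
  fixes e :: "'i \<Rightarrow> 'n" and k :: 'i
  assumes e: "is_seed D e" "exch_integral D e" and k: "k \<in> Iuf D"
begin

lemma coord_form_map: "coord e (form_map D (e k)) j = exch D e k j"
proof -
  have "rat_of_int (coord e (form_map D (e k)) j) = rat_of_int (exch D e k j)"
    using e k by (simp add: coord_def form_map_eq seed_Nuf seed_scaled_in form_zmul_right exch_eq)
  then show ?thesis by (simp only: of_int_eq_iff)
qed

lemma coord_mut_basis:
  assumes "\<phi> \<in> Mcirc D"
  shows "coord (mut_basis D k e) \<phi> j =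
    (if j = k then - coord e \<phi> k else coord e \<phi> j + max 0 (- exch D e k j) * coord e \<phi> k)"
proof -
  note add = Mcirc_additive[OF assms] and in_circ = seed_scaled_in[OF e(1)]
  show ?thesis
    unfolding coord_def mut_basis_scaled[OF e(2)]
    by (auto simp: additive_on_uminus[OF add sublattice_Ncirc] additive_on_add[OF add]
        additive_on_zmul[OF add sublattice_Ncirc] sublattice_zmul[OF sublattice_Ncirc] in_circ zmul_int)
qed

lemma dual_basis_mut_other: "i \<noteq> k \<Longrightarrow> dual_basis D (mut_basis D k e) i = dual_basis D e i"
  using e k by (intro Mcirc_eqI[of "mut_basis D k e"])
    (auto simp: seed_mutate dual_basis_in coord_dual_basis coord_mut_basis)

lemma dual_basis_mut_same:
  "dual_basis D (mut_basis D k e) k =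
    - dual_basis D e k - (\<Sum>j | exch D e k j < 0. zmul (exch D e k j) (dual_basis D e j))"
proof (rule Mcirc_eqI[of "mut_basis D k e"])
  let ?h = "- dual_basis D e k - (\<Sum>j | exch D e k j < 0. zmul (exch D e k j) (dual_basis D e j))"
  show hM: "?h \<in> Mcirc D"
    using e by (intro sublattice_diff[OF sublattice_Mcirc] sublattice_uminus[OF sublattice_Mcirc]
        sublattice_sum[OF sublattice_Mcirc] sublattice_zmul[OF sublattice_Mcirc] dual_basis_in)
  have "coord e ?h j = - (if k = j then 1 else 0) - (if exch D e k j < 0 then exch D e k j else 0)"
    for j
    using e by (simp add: coord_diff coord_uminus coord_sum coord_zmul coord_dual_basis
        if_distrib cong: if_cong)
  then show "coord (mut_basis D k e) (dual_basis D (mut_basis D k e) k) j =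
      coord (mut_basis D k e) ?h j" for j
    using e k by (auto simp: coord_dual_basis seed_mutate coord_mut_basis[OF hM] exch_self)
qed (use e k in \<open>simp_all add: seed_mutate dual_basis_in\<close>)

text \<open>
  Together with the formula for the new dual basis vector \<open>f'\<^sub>k\<close> this shows that the two terms
  of the exchange relation have exponents \<open>f'\<^sub>k\<close> and \<open>f'\<^sub>k + y\<close> with \<open>y = {e\<^sub>k, \<cdot>}\<close>: it is a binomial
  in \<open>A\<^sup>y\<close> times a monomial.
\<close>

lemma exchange_exponents:
  "- dual_basis D e k + (\<Sum>j | exch D e k j > 0. zmul (exch D e k j) (dual_basis D e j)) =
    dual_basis D (mut_basis D k e) k + form_map D (e k)"
proof -
  let ?g = "\<lambda>j. zmul (exch D e k j) (dual_basis D e j)"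
  have "form_map D (e k) = (\<Sum>j\<in>UNIV. ?g j)"
    using Mcirc_expand[OF e(1) form_map_in[OF seed_Nuf[OF e(1) k]]] by (simp add: coord_form_map)
  also have "\<dots> = (\<Sum>j\<in>{j. exch D e k j > 0} \<union> {j. exch D e k j < 0}. ?g j)"
    by (rule sum.mono_neutral_right) auto
  also have "\<dots> = (\<Sum>j | exch D e k j > 0. ?g j) + (\<Sum>j | exch D e k j < 0. ?g j)"
    by (rule sum.union_disjoint) auto
  finally show ?thesis by (simp add: dual_basis_mut_same)
qed

end

end


section \<open>The compatible form\<close>

locale compatible_data = cluster_data D
  for D :: "('i::finite, 'n::ab_group_add) fixed_data" +
  fixes e0 :: "'i \<Rightarrow> 'n" and \<Lambda> :: "('n \<Rightarrow> int) \<Rightarrow> ('n \<Rightarrow> int) \<Rightarrow> int"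
    and p :: "'n \<Rightarrow> ('n \<Rightarrow> int)"
  assumes seed0: "is_seed D e0" and integral0: "exch_integral D e0"
    and compatible: "compatible_form D e0 \<Lambda>" and pstar: "is_pstar D p"
    and frozen: "frozen_compatible D e0 \<Lambda> p"
begin

lemma Lam_additive_left: "c \<in> Mcirc D \<Longrightarrow> additive_on (Mcirc D) (\<lambda>a. \<Lambda> a c)"
  and Lam_additive_right: "a \<in> Mcirc D \<Longrightarrow> additive_on (Mcirc D) (\<Lambda> a)"
  and Lam_skew: "a \<in> Mcirc D \<Longrightarrow> b \<in> Mcirc D \<Longrightarrow> \<Lambda> a b = - \<Lambda> b a"
  using compatible unfolding compatible_form_def additive_on_def by blast+

lemma p_in: "p n \<in> Mcirc D"
  and p_add: "p (n + n') = p n + p n'"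
  and p_Nuf: "n \<in> Nuf D \<Longrightarrow> p n = form_map D n"
  and p_restrict: "x \<in> Nuf D \<Longrightarrow> x \<in> Ncirc D \<Longrightarrow> of_int (p n x) = form D n x"
  using pstar by (auto simp: is_pstar_def)

lemma p_additive: "additive_on UNIV p"
  by (simp add: additive_on_def p_add)

lemma p_0: "p 0 = 0"
  and p_uminus: "p (- n) = - p n"
  and p_diff: "p (n - n') = p n - p n'"
  and p_zmul: "p (zmul a n) = zmul a (p n)"
  using additive_on_0[OF p_additive] additive_on_uminus[OF p_additive]
    additive_on_diff[OF p_additive] additive_on_zmul[OF p_additive] by simp_all

lemma dlcm_multiple_Ncirc: "zmul (int (dlcm D)) n \<in> Ncirc D"
proof (rule zbasis_induct[OF seed_bases(1)[OF seed0], of n])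
  show "zmul (int (dlcm D)) (e0 j) \<in> Ncirc D" for j
    using sublattice_zmul[OF sublattice_Ncirc seed_scaled_in[OF seed0], of "delta j" j]
    by (simp add: zmul_zmul dlcm_eq_delta[of j])
next
  show "zmul (int (dlcm D)) 0 \<in> Ncirc D"
    using zmul_zmul[of "int (dlcm D)" 0 "0 :: 'n"] sublattice_zero[OF sublattice_Ncirc] by simp
next
  show "zmul (int (dlcm D)) (x - y) \<in> Ncirc D"
    if "zmul (int (dlcm D)) x \<in> Ncirc D" "zmul (int (dlcm D)) y \<in> Ncirc D" for x y
    using sublattice_diff[OF sublattice_Ncirc that] zmul_add_right[of "int (dlcm D)" x "- y"]
    by (simp add: zmul_uminus_right)
qed simp

text \<open>
  The compatibility condition refers to the initial seed, but it extends linearly to a relation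
  in which no seed occurs. This is why every seed inherits it.
\<close>

lemma Lam_form_map:
  assumes n: "n \<in> Nuf D" and m: "m \<in> Mcirc D"
  shows "\<Lambda> (form_map D n) m = m (zmul (int (dlcm D)) n)"
proof -
  let ?d = "int (dlcm D)"
  note m_add = Mcirc_additive[OF m]
  have zd: "zmul ?d (x - y) = zmul ?d x - zmul ?d y" for x y :: 'n
    using zmul_add_right[of ?d x "- y"] by (simp add: zmul_uminus_right)
  have "n \<in> Nuf D \<and> \<Lambda> (form_map D n) m = m (zmul ?d n)"
  proof (rule zbasis_induct[OF seed_bases(2)[OF seed0] n])
    have "form_map D 0 = 0"
      using form_map_diff[OF n n] by simp
    then show "0 \<in> Nuf D \<and> \<Lambda> (form_map D 0) m = m (zmul ?d 0)"
      using additive_on_0[OF Lam_additive_left[OF m] sublattice_Mcirc] zd[of 0 0]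
        additive_on_0[OF m_add sublattice_Ncirc]
      by (simp add: sublattice_zero[OF sublattice_Nuf])
  next
    fix k assume k: "k \<in> Iuf D"
    let ?y = "form_map D (e0 k)" and ?f = "dual_basis D e0" and ?\<delta> = "delta k"
    have yM: "?y \<in> Mcirc D" using form_map_in seed_Nuf[OF seed0 k] .
    have val: "\<Lambda> ?y (?f j) = (if k = j then ?\<delta> else 0)" for j
    proof -
      have "rat_of_int (\<Lambda> ?y (?f j)) = (if k = j then of_nat (dlcm D) / of_nat (dd D k) else 0)"
        using compatible k by (simp add: compatible_form_def)
      also have "\<dots> = rat_of_int (if k = j then ?\<delta> else 0)"
        using arg_cong[OF dlcm_eq_delta[of k], of rat_of_int] dd_pos[of k] by (auto simp: field_simps)
      finally show ?thesis by (simp only: of_int_eq_iff)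
    qed
    have "\<Lambda> ?y m = \<Lambda> ?y (\<Sum>j\<in>UNIV. zmul (coord e0 m j) (?f j))"
      using Mcirc_expand[OF seed0 m] by simp
    also have "\<dots> = (\<Sum>j\<in>UNIV. coord e0 m j * \<Lambda> ?y (?f j))"
      using seed0 sublattice_Mcirc
      by (simp add: additive_on_sum[OF Lam_additive_right[OF yM]] sublattice_zmul dual_basis_in
          additive_on_zmul[OF Lam_additive_right[OF yM]] zmul_int)
    also have "\<dots> = ?\<delta> * m (zmul (int (dd D k)) (e0 k))"
      by (simp add: val if_distrib cong: if_cong) (simp add: coord_def)
    also have "\<dots> = m (zmul ?d (e0 k))"
      using additive_on_zmul[OF m_add sublattice_Ncirc seed_scaled_in[OF seed0], of ?\<delta> k]
      by (simp add: zmul_zmul zmul_int dlcm_eq_delta[of k])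
    finally show "e0 k \<in> Nuf D \<and> \<Lambda> ?y m = m (zmul ?d (e0 k))"
      using seed_Nuf[OF seed0 k] by simp
  next
    fix x y
    assume "x \<in> Nuf D \<and> \<Lambda> (form_map D x) m = m (zmul ?d x)"
      "y \<in> Nuf D \<and> \<Lambda> (form_map D y) m = m (zmul ?d y)"
    then show "x - y \<in> Nuf D \<and> \<Lambda> (form_map D (x - y)) m = m (zmul ?d (x - y))"
      using additive_on_diff[OF Lam_additive_left[OF m] sublattice_Mcirc]
        additive_on_diff[OF m_add sublattice_Ncirc] sublattice_diff[OF sublattice_Nuf]
      by (simp add: form_map_diff form_map_in zd dlcm_multiple_Ncirc)
  qed
  then show ?thesis by simp
qed

lemma Lam_seed:
  assumes "is_seed D e" "k \<in> Iuf D" "m \<in> Mcirc D"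
  shows "\<Lambda> (form_map D (e k)) m = delta k * coord e m k"
  using additive_on_zmul[OF Mcirc_additive[OF assms(3)] sublattice_Ncirc seed_scaled_in[OF assms(1)],
      of "delta k" k]
  by (simp add: Lam_form_map seed_Nuf assms coord_def zmul_zmul zmul_int dlcm_eq_delta[of k])

lemma Lam_p_Nuf:
  assumes "n \<in> Nuf D"
  shows "of_int (\<Lambda> (p n) (p n')) = - of_nat (dlcm D) * form D n n'"
proof -
  have "rat_of_int (\<Lambda> (p n) (p n')) = form D n' (zmul (int (dlcm D)) n)"
    using Lam_form_map[OF assms p_in, of n'] assms
    by (simp add: p_Nuf p_restrict dlcm_multiple_Ncirc sublattice_zmul[OF sublattice_Nuf])
  then show ?thesis using form_skew[of n' n] by (simp add: form_zmul_right)
qed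

text \<open>
  The minus sign is the inversion of v by the homomorphism. By bilinearity it suffices to
  compare both sides on the initial seed: pairs with an unfrozen vector are covered by the
  previous lemma, pairs of frozen vectors by \<open>frozen_compatible\<close>.
\<close>

lemma Lam_p: "of_int (\<Lambda> (p n) (p n')) = - of_nat (dlcm D) * form D n n'"
proof -
  let ?P = "\<lambda>n n'. rat_of_int (\<Lambda> (p n) (p n')) = - of_nat (dlcm D) * form D n n'"
  have skew: "?P n' n" if "?P n n'" for n n'
    using that Lam_skew[OF p_in p_in, of n' n] form_skew[of n' n] by simp
  have diff: "?P (x - y) n" if "?P x n" "?P y n" for x y n
    using that additive_on_diff[OF Lam_additive_left[OF p_in] sublattice_Mcirc p_in p_in, of x y n]
    by (simp add: p_diff form_diff_left algebra_simps)
  have zero: "?P 0 n" for n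
    using diff[of n n n] skew
    using additive_on_0[OF Lam_additive_left[OF p_in] sublattice_Mcirc, of n] form_diff_left[of 0 0 n]
    by (simp add: p_0)
  have basis: "?P (e0 i) (e0 j)" for i j
  proof (cases "i \<in> Iuf D \<or> j \<in> Iuf D")
    case True
    then show ?thesis using Lam_p_Nuf seed_Nuf[OF seed0] skew by blast
  next
    case False
    then show ?thesis using frozen by (simp add: frozen_compatible_def)
  qed
  have "?P n (e0 j)" for n j
    by (rule zbasis_induct[OF seed_bases(1)[OF seed0], of n]) (use zero basis diff in auto)
  then have "?P (e0 j) n" for n j using skew by blast
  then show ?thesis
    by (intro zbasis_induct[OF seed_bases(1)[OF seed0], of n "\<lambda>n. ?P n n'"])
      (use zero diff in auto)
qed

definition BX :: "'n \<Rightarrow> 'n \<Rightarrow> int" where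
  "BX n n' = \<lfloor>of_nat (dlcm D) * form D n n'\<rfloor>"

lemma BX_eq: "BX n n' = - \<Lambda> (p n) (p n')"
proof -
  have "of_nat (dlcm D) * form D n n' = of_int (- \<Lambda> (p n) (p n'))"
    by (simp add: Lam_p)
  then show ?thesis unfolding BX_def by (metis floor_of_int)
qed

end

section \<open>Quantum tori\<close>

lemma poly_mapping_sum_single: "x = (\<Sum>a\<in>Poly_Mapping.keys x. Poly_Mapping.single a (Poly_Mapping.lookup x a))"
  by (rule poly_mapping_eqI) (auto simp: lookup_sum lookup_single when_def in_keys_iff)

lemma poly_mapping_additive_induct [consumes 1, case_names zero single add]:
  fixes x :: "'a \<Rightarrow>\<^sub>0 'b::comm_monoid_add"
  assumes "Poly_Mapping.keys x \<subseteq> L" and "P 0" and "\<And>a c. a \<in> L \<Longrightarrow> P (Poly_Mapping.single a c)"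
    and "\<And>x y. Poly_Mapping.keys x \<subseteq> L \<Longrightarrow> Poly_Mapping.keys y \<subseteq> L \<Longrightarrow> P x \<Longrightarrow> P y \<Longrightarrow> P (x + y)"
  shows "P x"
proof -
  let ?s = "\<lambda>K. \<Sum>a\<in>K. Poly_Mapping.single a (Poly_Mapping.lookup x a)"
  have "Poly_Mapping.keys (?s K) \<subseteq> L \<and> P (?s K)" if "finite K" "K \<subseteq> L" for K
    using that
  proof (induction K rule: finite_induct)
    case (insert a K)
    then show ?case
      using keys_add[of "Poly_Mapping.single a (Poly_Mapping.lookup x a)" "?s K"]
      by (auto intro!: assms(3,4) split: if_splits)
  qed (simp add: assms(2))
  then show ?thesis using assms(1) poly_mapping_sum_single[of x] by (metis finite_keys)
qed

lemma poly_mapping_additive_induct_UNIV [case_names zero single add]: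
  fixes x :: "'a \<Rightarrow>\<^sub>0 'b::comm_monoid_add"
  assumes "P 0" and "\<And>a c. P (Poly_Mapping.single a c)" and "\<And>x y. P x \<Longrightarrow> P y \<Longrightarrow> P (x + y)"
  shows "P x"
  using poly_mapping_additive_induct[of x UNIV P] assms by simp

lemma vpow_add: "vpow (a + b) = vpow a * vpow b"
  by (simp add: vpow_def mult_single)

lemma vpow_0: "vpow 0 = 1"
  by (simp add: vpow_def)

lemma lookup_vbar: "Poly_Mapping.lookup (vbar c) a = Poly_Mapping.lookup c (- a)"
  by (simp add: vbar_def map_key.rep_eq)

lemma vbar_0 [simp]: "vbar 0 = 0"
  and vbar_add: "vbar (c + d) = vbar c + vbar d"
  and vbar_vbar [simp]: "vbar (vbar c) = c"
  by (rule poly_mapping_eqI, simp add: lookup_vbar lookup_add)+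

lemma vbar_single: "vbar (Poly_Mapping.single a f) = Poly_Mapping.single (- a) f"
  by (rule poly_mapping_eqI) (auto simp: lookup_vbar lookup_single when_def)

lemma vbar_vpow: "vbar (vpow a) = vpow (- a)"
  by (simp add: vpow_def vbar_single)

lemma vbar_1 [simp]: "vbar 1 = 1"
  using vbar_vpow[of 0] by (simp add: vpow_0)

lemma vbar_tconst: "vbar (tconst f) = tconst f"
  by (simp add: tconst_def vbar_single)

lemma vbar_mult: "vbar (c * d) = vbar c * vbar d"
proof (induction c rule: poly_mapping_additive_induct_UNIV)
  case (single a f)
  show ?case
  proof (induction d rule: poly_mapping_additive_induct_UNIV)
    case (single b g)
    show ?case by (simp add: mult_single vbar_single add.commute)
  qed (simp_all add: distrib_left vbar_add)
qed (simp_all add: distrib_right vbar_add)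

definition qmul ::
    "('l::ab_group_add \<Rightarrow> 'l \<Rightarrow> int) \<Rightarrow> ('l \<Rightarrow>\<^sub>0 'i coeff) \<Rightarrow> ('l \<Rightarrow>\<^sub>0 'i coeff) \<Rightarrow> ('l \<Rightarrow>\<^sub>0 'i coeff)" where
  "qmul B x y = (\<Sum>a\<in>Poly_Mapping.keys x. \<Sum>b\<in>Poly_Mapping.keys y.
     Poly_Mapping.single (a + b) (Poly_Mapping.lookup x a * Poly_Mapping.lookup y b * vpow (B a b)))"

lemma quantum_torus_simps [simp]:
  "carrier (quantum_torus L B) = {x. Poly_Mapping.keys x \<subseteq> L}"
  "monoid.mult (quantum_torus L B) = qmul B"
  "one (quantum_torus L B) = zmon 0"
  "zero (quantum_torus L B) = 0"
  "add (quantum_torus L B) = (+)"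
  by (simp_all add: quantum_torus_def qmul_def fun_eq_iff zmon_def)

text \<open>
  The product may be computed over any finite sets containing the two supports. This turns
  it into a biadditive operation, so that identities need only be checked on monomials.
\<close>

lemma qmul_superset:
  assumes "finite K" "Poly_Mapping.keys x \<subseteq> K" "finite K'" "Poly_Mapping.keys y \<subseteq> K'"
  shows "qmul B x y = (\<Sum>a\<in>K. \<Sum>b\<in>K'.
    Poly_Mapping.single (a + b) (Poly_Mapping.lookup x a * Poly_Mapping.lookup y b * vpow (B a b)))"
proof -
  let ?g = "\<lambda>a b. Poly_Mapping.single (a + b)
    (Poly_Mapping.lookup x a * Poly_Mapping.lookup y b * vpow (B a b))"
  have "(\<Sum>a\<in>Poly_Mapping.keys x. \<Sum>b\<in>Poly_Mapping.keys y. ?g a b) =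
      (\<Sum>a\<in>Poly_Mapping.keys x. \<Sum>b\<in>K'. ?g a b)"
    using assms by (intro sum.cong refl sum.mono_neutral_left) (auto simp: in_keys_iff)
  also have "\<dots> = (\<Sum>a\<in>K. \<Sum>b\<in>K'. ?g a b)"
    using assms by (intro sum.mono_neutral_left) (auto simp: in_keys_iff)
  finally show ?thesis by (simp add: qmul_def)
qed

lemma qmul_add_left: "qmul B (x + x') y = qmul B x y + qmul B x' y"
proof -
  let ?K = "Poly_Mapping.keys x \<union> Poly_Mapping.keys x'"
  note eq = qmul_superset[where K = ?K and K' = "Poly_Mapping.keys y"]
  show ?thesis
    by (simp add: eq keys_add lookup_add distrib_right single_add sum.distrib)
qed

lemma qmul_add_right: "qmul B y (x + x') = qmul B y x + qmul B y x'"
proof -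
  let ?K = "Poly_Mapping.keys x \<union> Poly_Mapping.keys x'"
  note eq = qmul_superset[where K' = ?K and K = "Poly_Mapping.keys y"]
  show ?thesis
    by (simp add: eq keys_add lookup_add distrib_right distrib_left single_add sum.distrib)
qed

lemma qmul_0_left [simp]: "qmul B 0 y = 0"
  and qmul_0_right [simp]: "qmul B y 0 = 0"
  by (simp_all add: qmul_def)

lemma qmul_single:
  "qmul B (Poly_Mapping.single a c) (Poly_Mapping.single b d) =
    Poly_Mapping.single (a + b) (c * d * vpow (B a b))"
  by (simp add: qmul_superset[where K = "{a}" and K' = "{b}"])

lemma keys_qmul:
  assumes "\<And>a b. a \<in> L \<Longrightarrow> b \<in> L \<Longrightarrow> a + b \<in> L"
    and "Poly_Mapping.keys x \<subseteq> L" "Poly_Mapping.keys y \<subseteq> L"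
  shows "Poly_Mapping.keys (qmul B x y) \<subseteq> L"
  using assms(2)
proof (induction x rule: poly_mapping_additive_induct)
  case (single a c)
  show ?case using assms(3)
  proof (induction y rule: poly_mapping_additive_induct)
    case (single b d)
    then show ?case using assms(1) \<open>a \<in> L\<close> by (auto simp: qmul_single split: if_splits)
  next
    case (add y y')
    then show ?case
      using keys_add[of "qmul B (Poly_Mapping.single a c) y" "qmul B (Poly_Mapping.single a c) y'"]
      by (auto simp: qmul_add_right)
  qed simp_all
next
  case (add x x')
  then show ?case using keys_add[of "qmul B x y" "qmul B x' y"] by (auto simp: qmul_add_left)
qed simp_all

text \<open>Associativity on monomials is the cocycle identity, which holds for bilinear forms.\<close>

lemma qmul_assoc:
  assumes L: "sublattice L"
    and B: "\<And>a. a \<in> L \<Longrightarrow> additive_on L (B a)" "\<And>b. b \<in> L \<Longrightarrow> additive_on L (\<lambda>a. B a b)"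
    and keys: "Poly_Mapping.keys x \<subseteq> L" "Poly_Mapping.keys y \<subseteq> L" "Poly_Mapping.keys z \<subseteq> L"
  shows "qmul B (qmul B x y) z = qmul B x (qmul B y z)"
  using keys(1)
proof (induction x rule: poly_mapping_additive_induct)
  case (single a c)
  note a = single
  show ?case using keys(2)
  proof (induction y rule: poly_mapping_additive_induct)
    case (single a' c')
    note a' = single
    show ?case using keys(3)
    proof (induction z rule: poly_mapping_additive_induct)
      case (single a'' c'')
      then show ?case using a a'
        by (simp add: qmul_single add.assoc additive_on_add[OF B(1)] additive_on_add[OF B(2)]
            vpow_add mult_ac)
    qed (simp_all add: qmul_add_right)
  qed (simp_all add: qmul_add_right qmul_add_left)
qed (simp_all add: qmul_add_left)

lemma ring_quantum_torus:
  fixes B :: "'l::ab_group_add \<Rightarrow> 'l \<Rightarrow> int"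
  assumes L: "sublattice L"
    and B: "\<And>a. a \<in> L \<Longrightarrow> additive_on L (B a)" "\<And>b. b \<in> L \<Longrightarrow> additive_on L (\<lambda>a. B a b)"
  shows "ring (quantum_torus L B :: ('l \<Rightarrow>\<^sub>0 'i coeff) ring)"
proof (rule ringI)
  let ?T = "quantum_torus L B :: ('l \<Rightarrow>\<^sub>0 'i coeff) ring"
  note L0 = sublattice_zero[OF L]
  show "abelian_group ?T"
  proof (rule abelian_groupI)
    show "x \<oplus>\<^bsub>?T\<^esub> y \<in> carrier ?T" if "x \<in> carrier ?T" "y \<in> carrier ?T" for x y
      using that keys_add[of x y] by auto
    show "\<exists>y\<in>carrier ?T. y \<oplus>\<^bsub>?T\<^esub> x = \<zero>\<^bsub>?T\<^esub>" if "x \<in> carrier ?T" for x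
      using that by (intro bexI[of _ "- x"]) (auto simp: in_keys_iff subset_iff)
  qed (simp_all add: add_ac)
  have one_left: "qmul B (zmon 0) x = x" if "Poly_Mapping.keys x \<subseteq> L" for x :: "'l \<Rightarrow>\<^sub>0 'i coeff"
    using that
  proof (induction x rule: poly_mapping_additive_induct)
    case (single a c)
    then show ?case using additive_on_0[OF B(2)[OF single] L] by (simp add: zmon_def qmul_single vpow_0 del: single_one)
  qed (simp_all add: qmul_add_right)
  have one_right: "qmul B x (zmon 0) = x" if "Poly_Mapping.keys x \<subseteq> L" for x :: "'l \<Rightarrow>\<^sub>0 'i coeff"
    using that
  proof (induction x rule: poly_mapping_additive_induct)
    case (single a c)
    then show ?case using additive_on_0[OF B(1)[OF single] L] by (simp add: zmon_def qmul_single vpow_0 del: single_one)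
  qed (simp_all add: qmul_add_left)
  show "Group.monoid ?T"
  proof (rule monoidI)
    show "x \<otimes>\<^bsub>?T\<^esub> y \<in> carrier ?T" if "x \<in> carrier ?T" "y \<in> carrier ?T" for x y
      using that keys_qmul[of L x y B] sublattice_add[OF L] by simp
    show "\<one>\<^bsub>?T\<^esub> \<in> carrier ?T" using L0 by (simp add: zmon_def)
    show "x \<otimes>\<^bsub>?T\<^esub> y \<otimes>\<^bsub>?T\<^esub> z = x \<otimes>\<^bsub>?T\<^esub> (y \<otimes>\<^bsub>?T\<^esub> z)"
      if "x \<in> carrier ?T" "y \<in> carrier ?T" "z \<in> carrier ?T" for x y z
      using that qmul_assoc[OF L B] by simp
  qed (simp_all add: one_left one_right)
qed (simp_all add: qmul_add_left qmul_add_right)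


section \<open>The algebra homomorphism induced by a lattice map\<close>

lemma pstar_alg_superset:
  assumes "finite K" "Poly_Mapping.keys x \<subseteq> K"
  shows "pstar_alg p x = (\<Sum>n\<in>K. Poly_Mapping.single (p n) (vbar (Poly_Mapping.lookup x n)))"
  unfolding pstar_alg_def using assms by (intro sum.mono_neutral_left) (auto simp: in_keys_iff)

lemma pstar_alg_0 [simp]: "pstar_alg p 0 = 0"
  by (simp add: pstar_alg_def)

lemma pstar_alg_add: "pstar_alg p (x + y) = pstar_alg p x + pstar_alg p y"
  by (simp add: pstar_alg_superset[where K = "Poly_Mapping.keys x \<union> Poly_Mapping.keys y"]
      keys_add lookup_add vbar_add single_add sum.distrib)

lemma pstar_alg_single: "pstar_alg p (Poly_Mapping.single n c) = Poly_Mapping.single (p n) (vbar c)"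
  by (simp add: pstar_alg_superset[where K = "{n}"])

lemma keys_pstar_alg: "Poly_Mapping.keys (pstar_alg p x) \<subseteq> range p"
proof (induction x rule: poly_mapping_additive_induct_UNIV)
  case (add x y)
  then show ?case using keys_add[of "pstar_alg p x" "pstar_alg p y"] by (auto simp: pstar_alg_add)
qed (auto simp: pstar_alg_single)

lemma pstar_alg_qmul:
  assumes "\<And>n n'. p (n + n') = p n + p n'" and "\<And>n n'. B' (p n) (p n') = - B n n'"
  shows "pstar_alg p (qmul B x y) = qmul B' (pstar_alg p x) (pstar_alg p y)"
proof (induction x rule: poly_mapping_additive_induct_UNIV)
  case (single a c)
  show ?case
  proof (induction y rule: poly_mapping_additive_induct_UNIV)
    case (single b d)
    show ?case by (simp add: qmul_single pstar_alg_single assms vbar_mult vbar_vpow)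
  qed (simp_all add: qmul_add_right pstar_alg_add)
qed (simp_all add: qmul_add_left pstar_alg_add)

lemma lookup_star: "Poly_Mapping.lookup (star x) a = vbar (Poly_Mapping.lookup x a)"
  by (simp add: star_def map.rep_eq when_def)

lemma star_0 [simp]: "star 0 = 0"
  by (rule poly_mapping_eqI) (simp add: lookup_star)

lemma star_add: "star (x + y) = star x + star y"
  by (rule poly_mapping_eqI) (simp add: lookup_star lookup_add vbar_add)

lemma star_single: "star (Poly_Mapping.single a c) = Poly_Mapping.single a (vbar c)"
  by (rule poly_mapping_eqI) (simp add: lookup_star lookup_single when_def)

lemma pstar_alg_star: "pstar_alg p (star x) = star (pstar_alg p x)"
  by (induction x rule: poly_mapping_additive_induct_UNIV)
    (simp_all add: star_add star_single pstar_alg_single pstar_alg_add)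

text \<open>Distinct monomials of x do not collide, so no cancellation can occur.\<close>

lemma pstar_alg_nonzero:
  assumes "inj_on p (Poly_Mapping.keys x)" "x \<noteq> 0"
  shows "pstar_alg p x \<noteq> 0"
proof -
  obtain n where n: "n \<in> Poly_Mapping.keys x"
    using assms(2) by (metis all_not_in_conv not_in_keys_iff_lookup_eq_zero lookup_zero poly_mapping_eqI)
  have "Poly_Mapping.lookup (pstar_alg p x) (p n) =
      (\<Sum>m\<in>Poly_Mapping.keys x. if m = n then vbar (Poly_Mapping.lookup x m) else 0)"
    unfolding pstar_alg_def lookup_sum
    by (rule sum.cong) (use assms(1) n in \<open>auto simp: lookup_single when_def inj_on_def\<close>)
  also have "\<dots> = vbar (Poly_Mapping.lookup x n)" using n by simp
  also have "\<dots> \<noteq> 0" using n by (metis in_keys_iff vbar_0 vbar_vbar)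
  finally show ?thesis by auto
qed


section \<open>Extending homomorphisms to Ore localizations\<close>

text \<open>
  The extension is constructed as a relation: z and w correspond if they are represented by
  the same right fraction \<open>a s\<^sup>-\<^sup>1\<close>. The Ore condition provides common denominators; they
  show that the relation is a graph of a function and is closed under the ring operations.
\<close>

lemma ore_extension:
  fixes T :: "'t ring" and F :: "'f ring" and K :: "'k ring"
  assumes T: "ring T" and F: "ring F" and K: "ring K"
    and \<iota>: "\<iota> \<in> ring_hom T F" "inj_on \<iota> (carrier T)" and \<phi>: "\<phi> \<in> ring_hom T K"
    and S: "S \<subseteq> carrier T" "\<one>\<^bsub>T\<^esub> \<in> S" "\<And>s t. s \<in> S \<Longrightarrow> t \<in> S \<Longrightarrow> s \<otimes>\<^bsub>T\<^esub> t \<in> S"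
    and ore: "\<And>a s. a \<in> carrier T \<Longrightarrow> s \<in> S \<Longrightarrow>
      \<exists>t\<in>S. \<exists>b\<in>carrier T. a \<otimes>\<^bsub>T\<^esub> t = s \<otimes>\<^bsub>T\<^esub> b"
    and units: "\<And>s. s \<in> S \<Longrightarrow> \<iota> s \<in> Units F" "\<And>s. s \<in> S \<Longrightarrow> \<phi> s \<in> Units K"
    and H: "H \<subseteq> \<iota> ` carrier T \<union> (\<lambda>s. inv\<^bsub>F\<^esub> (\<iota> s)) ` S"
  shows "\<exists>Q\<in>ring_hom (F\<lparr>carrier := generate_ring F H\<rparr>) K.
    \<forall>x\<in>carrier T. \<iota> x \<in> generate_ring F H \<longrightarrow> Q (\<iota> x) = \<phi> x"
proof -
  interpret T: ring T by (rule T)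
  interpret F: ring F by (rule F)
  interpret K: ring K by (rule K)
  interpret i: ring_hom_ring T F \<iota> by (rule ring_hom_ringI2[OF T F \<iota>(1)])
  interpret f: ring_hom_ring T K \<phi> by (rule ring_hom_ringI2[OF T K \<phi>])
  have ST: "s \<in> carrier T" if "s \<in> S" for s using S(1) that by blast
  define R where "R z w \<longleftrightarrow> z \<in> carrier F \<and> w \<in> carrier K \<and>
    (\<exists>s\<in>S. \<exists>a\<in>carrier T. z \<otimes>\<^bsub>F\<^esub> \<iota> s = \<iota> a \<and> w \<otimes>\<^bsub>K\<^esub> \<phi> s = \<phi> a)" for z w
  have R_I: "R z w" if "z \<in> carrier F" "w \<in> carrier K" "s \<in> S" "a \<in> carrier T"
    "z \<otimes>\<^bsub>F\<^esub> \<iota> s = \<iota> a" "w \<otimes>\<^bsub>K\<^esub> \<phi> s = \<phi> a" for z w s a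
    using that unfolding R_def by blast
  have R_unique: "w = w'" if R: "R z w" "R z w'" for z w w'
  proof -
    obtain s a where 1: "z \<in> carrier F" "w \<in> carrier K" "s \<in> S" "a \<in> carrier T"
      "z \<otimes>\<^bsub>F\<^esub> \<iota> s = \<iota> a" "w \<otimes>\<^bsub>K\<^esub> \<phi> s = \<phi> a" using R(1) unfolding R_def by blast
    obtain s' a' where 2: "w' \<in> carrier K" "s' \<in> S" "a' \<in> carrier T"
      "z \<otimes>\<^bsub>F\<^esub> \<iota> s' = \<iota> a'" "w' \<otimes>\<^bsub>K\<^esub> \<phi> s' = \<phi> a'" using R(2) unfolding R_def by blast
    obtain t b where 3: "t \<in> S" "b \<in> carrier T" "s \<otimes>\<^bsub>T\<^esub> t = s' \<otimes>\<^bsub>T\<^esub> b"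
      using ore[OF ST[OF 1(3)] 2(2)] by blast
    note c = ST[OF 1(3)] ST[OF 2(2)] ST[OF 3(1)]
    have "\<iota> (a \<otimes>\<^bsub>T\<^esub> t) = z \<otimes>\<^bsub>F\<^esub> \<iota> (s \<otimes>\<^bsub>T\<^esub> t)"
      using 1 c by (simp add: F.m_assoc flip: 1(5))
    also have "\<dots> = \<iota> (a' \<otimes>\<^bsub>T\<^esub> b)"
      unfolding 3(3) using 1 2 3 c by (simp add: F.m_assoc flip: 2(4))
    finally have eq: "a \<otimes>\<^bsub>T\<^esub> t = a' \<otimes>\<^bsub>T\<^esub> b"
      using \<iota>(2) 1 2 3 c by (simp add: inj_on_def)
    let ?u = "\<phi> (s \<otimes>\<^bsub>T\<^esub> t)"
    have u: "?u \<in> Units K" using units(2) S(3) 1 3 by blast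
    have "w \<otimes>\<^bsub>K\<^esub> ?u = \<phi> (a \<otimes>\<^bsub>T\<^esub> t)"
      using 1 c by (simp add: K.m_assoc flip: 1(6))
    also have "\<dots> = w' \<otimes>\<^bsub>K\<^esub> \<phi> (s' \<otimes>\<^bsub>T\<^esub> b)"
      unfolding eq using 1 2 3 c by (simp add: K.m_assoc flip: 2(5))
    finally have "w \<otimes>\<^bsub>K\<^esub> ?u = w' \<otimes>\<^bsub>K\<^esub> ?u" by (simp only: 3(3))
    then have "w \<otimes>\<^bsub>K\<^esub> ?u \<otimes>\<^bsub>K\<^esub> inv\<^bsub>K\<^esub> ?u = w' \<otimes>\<^bsub>K\<^esub> ?u \<otimes>\<^bsub>K\<^esub> inv\<^bsub>K\<^esub> ?u" by simp
    then show "w = w'" using u 1(2) 2(1) by (simp add: K.m_assoc K.Units_closed del: f.hom_mult)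
  qed
  have R_incl: "R (\<iota> x) (\<phi> x)" if "x \<in> carrier T" for x
    using that S(2) by (intro R_I[of _ _ "\<one>\<^bsub>T\<^esub>" x]) simp_all
  have R_inv: "R (inv\<^bsub>F\<^esub> (\<iota> s)) (inv\<^bsub>K\<^esub> (\<phi> s))" if "s \<in> S" for s
    using that units by (intro R_I[of _ _ s "\<one>\<^bsub>T\<^esub>"]) simp_all
  have R_uminus: "R (\<ominus>\<^bsub>F\<^esub> z) (\<ominus>\<^bsub>K\<^esub> w)" if R: "R z w" for z w
  proof -
    obtain s a where 1: "z \<in> carrier F" "w \<in> carrier K" "s \<in> S" "a \<in> carrier T"
      "z \<otimes>\<^bsub>F\<^esub> \<iota> s = \<iota> a" "w \<otimes>\<^bsub>K\<^esub> \<phi> s = \<phi> a" using R unfolding R_def by blast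
    show ?thesis
      using 1 ST[OF 1(3)] by (intro R_I[of _ _ s "\<ominus>\<^bsub>T\<^esub> a"]) (simp_all add: F.l_minus K.l_minus)
  qed
  have R_ops: "R (z \<oplus>\<^bsub>F\<^esub> z') (w \<oplus>\<^bsub>K\<^esub> w') \<and> R (z \<otimes>\<^bsub>F\<^esub> z') (w \<otimes>\<^bsub>K\<^esub> w')"
    if R: "R z w" "R z' w'" for z w z' w'
  proof
    obtain s a where 1: "z \<in> carrier F" "w \<in> carrier K" "s \<in> S" "a \<in> carrier T"
      "z \<otimes>\<^bsub>F\<^esub> \<iota> s = \<iota> a" "w \<otimes>\<^bsub>K\<^esub> \<phi> s = \<phi> a" using R(1) unfolding R_def by blast
    obtain s' a' where 2: "z' \<in> carrier F" "w' \<in> carrier K" "s' \<in> S" "a' \<in> carrier T"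
      "z' \<otimes>\<^bsub>F\<^esub> \<iota> s' = \<iota> a'" "w' \<otimes>\<^bsub>K\<^esub> \<phi> s' = \<phi> a'" using R(2) unfolding R_def by blast
    note c = ST[OF 1(3)] ST[OF 2(3)]
    obtain t b where 3: "t \<in> S" "b \<in> carrier T" "s \<otimes>\<^bsub>T\<^esub> t = s' \<otimes>\<^bsub>T\<^esub> b"
      using ore[OF ST[OF 1(3)] 2(3)] by blast
    show "R (z \<oplus>\<^bsub>F\<^esub> z') (w \<oplus>\<^bsub>K\<^esub> w')"
    proof (rule R_I[of _ _ "s \<otimes>\<^bsub>T\<^esub> t" "a \<otimes>\<^bsub>T\<^esub> t \<oplus>\<^bsub>T\<^esub> a' \<otimes>\<^bsub>T\<^esub> b"])
      have "z \<otimes>\<^bsub>F\<^esub> \<iota> (s \<otimes>\<^bsub>T\<^esub> t) = \<iota> (a \<otimes>\<^bsub>T\<^esub> t)"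
        using 1 c ST[OF 3(1)] by (simp add: F.m_assoc flip: 1(5))
      moreover have "z' \<otimes>\<^bsub>F\<^esub> \<iota> (s \<otimes>\<^bsub>T\<^esub> t) = \<iota> (a' \<otimes>\<^bsub>T\<^esub> b)"
        unfolding 3(3) using 2 3 c by (simp add: F.m_assoc flip: 2(5))
      ultimately show "(z \<oplus>\<^bsub>F\<^esub> z') \<otimes>\<^bsub>F\<^esub> \<iota> (s \<otimes>\<^bsub>T\<^esub> t) = \<iota> (a \<otimes>\<^bsub>T\<^esub> t \<oplus>\<^bsub>T\<^esub> a' \<otimes>\<^bsub>T\<^esub> b)"
        using 1 2 3 c ST[OF 3(1)] by (simp add: F.l_distr del: i.hom_mult)
      have "w \<otimes>\<^bsub>K\<^esub> \<phi> (s \<otimes>\<^bsub>T\<^esub> t) = \<phi> (a \<otimes>\<^bsub>T\<^esub> t)"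
        using 1 c ST[OF 3(1)] by (simp add: K.m_assoc flip: 1(6))
      moreover have "w' \<otimes>\<^bsub>K\<^esub> \<phi> (s \<otimes>\<^bsub>T\<^esub> t) = \<phi> (a' \<otimes>\<^bsub>T\<^esub> b)"
        unfolding 3(3) using 2 3 c by (simp add: K.m_assoc flip: 2(6))
      ultimately show "(w \<oplus>\<^bsub>K\<^esub> w') \<otimes>\<^bsub>K\<^esub> \<phi> (s \<otimes>\<^bsub>T\<^esub> t) = \<phi> (a \<otimes>\<^bsub>T\<^esub> t \<oplus>\<^bsub>T\<^esub> a' \<otimes>\<^bsub>T\<^esub> b)"
        using 1 2 3 c ST[OF 3(1)] by (simp add: K.l_distr del: f.hom_mult)
    qed (use 1 2 3(1,2) c ST[OF 3(1)] S(3)[OF 1(3) 3(1)] in simp_all)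
    obtain t b where 4: "t \<in> S" "b \<in> carrier T" "a' \<otimes>\<^bsub>T\<^esub> t = s \<otimes>\<^bsub>T\<^esub> b"
      using ore[OF 2(4) 1(3)] by blast
    note ct = ST[OF 4(1)]
    show "R (z \<otimes>\<^bsub>F\<^esub> z') (w \<otimes>\<^bsub>K\<^esub> w')"
    proof (rule R_I[of _ _ "s' \<otimes>\<^bsub>T\<^esub> t" "a \<otimes>\<^bsub>T\<^esub> b"])
      have "z' \<otimes>\<^bsub>F\<^esub> \<iota> (s' \<otimes>\<^bsub>T\<^esub> t) = \<iota> (s \<otimes>\<^bsub>T\<^esub> b)"
        unfolding 4(3)[symmetric] using 2 c ct by (simp add: F.m_assoc flip: 2(5))
      then show "z \<otimes>\<^bsub>F\<^esub> z' \<otimes>\<^bsub>F\<^esub> \<iota> (s' \<otimes>\<^bsub>T\<^esub> t) = \<iota> (a \<otimes>\<^bsub>T\<^esub> b)"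
        using 1 2 4 c ct F.m_assoc[of z z' "\<iota> (s' \<otimes>\<^bsub>T\<^esub> t)"] F.m_assoc[of z "\<iota> s" "\<iota> b"] by simp
      have "w' \<otimes>\<^bsub>K\<^esub> \<phi> (s' \<otimes>\<^bsub>T\<^esub> t) = \<phi> (s \<otimes>\<^bsub>T\<^esub> b)"
        unfolding 4(3)[symmetric] using 2 c ct by (simp add: K.m_assoc flip: 2(6))
      then show "w \<otimes>\<^bsub>K\<^esub> w' \<otimes>\<^bsub>K\<^esub> \<phi> (s' \<otimes>\<^bsub>T\<^esub> t) = \<phi> (a \<otimes>\<^bsub>T\<^esub> b)"
        using 1 2 4 c ct K.m_assoc[of w w' "\<phi> (s' \<otimes>\<^bsub>T\<^esub> t)"] K.m_assoc[of w "\<phi> s" "\<phi> b"] by simp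
    qed (use 1 2 4 c ct S(3) in simp_all)
  qed
  let ?G = "generate_ring F H"
  have R_total: "\<exists>w. R z w" if "z \<in> ?G" for z
    using that
  proof induction
    case one
    show ?case using R_incl[of "\<one>\<^bsub>T\<^esub>"] by auto
  next
    case (incl h)
    then show ?case using H R_incl R_inv by blast
  qed (use R_uminus R_ops in blast)+
  define Q where "Q z = (THE w. R z w)" for z
  have Q_eq: "Q z = w" if "R z w" for z w
    unfolding Q_def using that R_unique by blast
  have Q: "R z (Q z)" if "z \<in> ?G" for z
    using R_total[OF that] Q_eq by auto
  have "Q \<in> ring_hom (F\<lparr>carrier := ?G\<rparr>) K"
  proof (rule ring_hom_memI)
    show "Q x \<in> carrier K" if "x \<in> carrier (F\<lparr>carrier := ?G\<rparr>)" for x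
      using Q[of x] that by (simp add: R_def)
    show "Q (x \<otimes>\<^bsub>F\<lparr>carrier := ?G\<rparr>\<^esub> y) = Q x \<otimes>\<^bsub>K\<^esub> Q y"
      if "x \<in> carrier (F\<lparr>carrier := ?G\<rparr>)" "y \<in> carrier (F\<lparr>carrier := ?G\<rparr>)" for x y
      using that Q_eq R_ops Q by simp
    show "Q (x \<oplus>\<^bsub>F\<lparr>carrier := ?G\<rparr>\<^esub> y) = Q x \<oplus>\<^bsub>K\<^esub> Q y"
      if "x \<in> carrier (F\<lparr>carrier := ?G\<rparr>)" "y \<in> carrier (F\<lparr>carrier := ?G\<rparr>)" for x y
      using that Q_eq R_ops Q by simp
    show "Q \<one>\<^bsub>F\<lparr>carrier := ?G\<rparr>\<^esub> = \<one>\<^bsub>K\<^esub>"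
      using Q_eq[OF R_incl[of "\<one>\<^bsub>T\<^esub>"]] by simp
  qed
  then show ?thesis using Q_eq R_incl by blast
qed

section \<open>Monomials in quantum tori with skew-symmetric form\<close>

locale torus_form =
  fixes L :: "'l::ab_group_add set" and B :: "'l \<Rightarrow> 'l \<Rightarrow> int"
  assumes L: "sublattice L"
    and additive_right: "\<And>a. a \<in> L \<Longrightarrow> additive_on L (B a)"
    and skew: "\<And>a b. a \<in> L \<Longrightarrow> b \<in> L \<Longrightarrow> B a b = - B b a"
begin

lemma additive_left: "b \<in> L \<Longrightarrow> additive_on L (\<lambda>a. B a b)"
  unfolding additive_on_def
proof (intro ballI)
  fix x y assume "b \<in> L" "x \<in> L" "y \<in> L"
  then show "B (x + y) b = B x b + B y b"
    using skew[of "x + y" b] skew[of x b] skew[of y b] additive_on_add[OF additive_right[of b]]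
    by (simp add: sublattice_add[OF L])
qed

lemma self: "a \<in> L \<Longrightarrow> B a a = 0"
  using skew[of a a] by simp

lemmas right_0 = additive_on_0[OF additive_right L]
  and left_0 = additive_on_0[OF additive_left L]
  and right_add = additive_on_add[OF additive_right]
  and left_add = additive_on_add[OF additive_left]
  and right_uminus = additive_on_uminus[OF additive_right L]
  and left_uminus = additive_on_uminus[OF additive_left L]
  and right_zmul = additive_on_zmul[OF additive_right L]
  and left_zmul = additive_on_zmul[OF additive_left L]

abbreviation T :: "('l \<Rightarrow>\<^sub>0 'i coeff) ring" where
  "T \<equiv> quantum_torus L B"

lemma ring_T: "ring T"
  by (rule ring_quantum_torus[OF L additive_right additive_left])

lemma single_in: "a \<in> L \<Longrightarrow> Poly_Mapping.single a c \<in> carrier T"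
  by simp

lemma zmon_in: "a \<in> L \<Longrightarrow> zmon a \<in> carrier T"
  unfolding zmon_def by (rule single_in)

lemma scalar_in: "scalar c \<in> carrier T"
  unfolding scalar_def by (rule single_in) (rule sublattice_zero[OF L])

lemma scalar_single: "b \<in> L \<Longrightarrow> qmul B (scalar c) (Poly_Mapping.single b d) = Poly_Mapping.single b (c * d)"
  by (simp add: scalar_def qmul_single left_0 vpow_0)

lemma scalar_central:
  assumes "x \<in> carrier T"
  shows "qmul B (scalar c) x = qmul B x (scalar c)"
proof -
  have "Poly_Mapping.keys x \<subseteq> L" using assms by simp
  then show ?thesis
    by (induction rule: poly_mapping_additive_induct)
      (simp_all add: scalar_def qmul_single left_0 right_0 vpow_0 mult.commute
        qmul_add_left qmul_add_right)
qed

lemma zmon_mult: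
  "a \<in> L \<Longrightarrow> b \<in> L \<Longrightarrow> qmul B (zmon a) (zmon b) = qmul B (scalar (vpow (B a b))) (zmon (a + b))"
  by (simp add: zmon_def scalar_single sublattice_add[OF L]) (simp add: qmul_single)

lemma zmon_uminus: "a \<in> L \<Longrightarrow> qmul B (zmon a) (zmon (- a)) = zmon 0"
  and zmon_uminus_left: "a \<in> L \<Longrightarrow> qmul B (zmon (- a)) (zmon a) = zmon 0"
  by (simp_all add: zmon_def qmul_single right_uminus left_uminus self vpow_0 del: single_one)

lemma cyclic_commute:
  assumes u: "u \<in> L" and keys: "Poly_Mapping.keys x \<subseteq> range (\<lambda>a. zmul a u)"
    "Poly_Mapping.keys y \<subseteq> range (\<lambda>a. zmul a u)"
  shows "qmul B x y = qmul B y x"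
  using keys(1)
proof (induction x rule: poly_mapping_additive_induct)
  case (single a c)
  show ?case using keys(2)
  proof (induction y rule: poly_mapping_additive_induct)
    case (single b d)
    have "B a b = 0" "B b a = 0"
      using \<open>a \<in> range _\<close> \<open>b \<in> range _\<close> u
      by (auto simp: right_zmul left_zmul self sublattice_zmul[OF L] zmul_int)
    then show ?case by (simp add: qmul_single add.commute mult.commute)
  qed (simp_all add: qmul_add_left qmul_add_right)
qed (simp_all add: qmul_add_left qmul_add_right)

text \<open>
  The Ore condition for denominators that are Laurent polynomials in one monomial. For a
  monomial a, the conjugate \<open>t = a\<^sup>-\<^sup>1 s a\<close> satisfies \<open>a t = s a\<close>, and it has the support of s because
  conjugation only rescales monomials. For a sum, the product of the denominators found for
  the summands works for both, as they commute.
\<close>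

lemma cyclic_ore:
  fixes a s :: "'l \<Rightarrow>\<^sub>0 'i coeff"
  assumes u: "u \<in> L" and a: "a \<in> carrier T"
    and s: "s \<noteq> 0" "Poly_Mapping.keys s \<subseteq> range (\<lambda>j. zmul j u)"
    and domain: "\<And>x y :: 'l \<Rightarrow>\<^sub>0 'i coeff. x \<in> carrier T \<Longrightarrow> y \<in> carrier T \<Longrightarrow> x \<noteq> 0 \<Longrightarrow> y \<noteq> 0 \<Longrightarrow> qmul B x y \<noteq> 0"
  shows "\<exists>t b. t \<noteq> 0 \<and> Poly_Mapping.keys t \<subseteq> range (\<lambda>j. zmul j u) \<and> b \<in> carrier T \<and>
    qmul B a t = qmul B s b"
proof -
  interpret T: ring "T :: ('l \<Rightarrow>\<^sub>0 'i coeff) ring" by (rule ring_T)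
  let ?C = "range (\<lambda>j. zmul j u)"
  have CL: "?C \<subseteq> L" using sublattice_zmul[OF L u] by blast
  have C_add: "x + y \<in> ?C" if "x \<in> ?C" "y \<in> ?C" for x y
    using that by (auto simp flip: zmul_add)
  have assoc: "qmul B (qmul B x y) z = qmul B x (qmul B y z)"
    if "Poly_Mapping.keys x \<subseteq> L" "Poly_Mapping.keys y \<subseteq> L" "Poly_Mapping.keys z \<subseteq> L"
    for x y z :: "'l \<Rightarrow>\<^sub>0 'i coeff"
    using T.m_assoc that by simp
  have closed: "Poly_Mapping.keys (qmul B x y) \<subseteq> L"
    if "Poly_Mapping.keys x \<subseteq> L" "Poly_Mapping.keys y \<subseteq> L" for x y :: "'l \<Rightarrow>\<^sub>0 'i coeff"
    using T.m_closed that by simp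
  have sL: "Poly_Mapping.keys s \<subseteq> L" using s CL by blast
  have keys_a: "Poly_Mapping.keys a \<subseteq> L" using a by simp
  then show ?thesis
  proof (induction a rule: poly_mapping_additive_induct)
    case zero
    show ?case using s by (intro exI[of _ s] exI[of _ 0]) simp
  next
    case (single n c)
    then have n: "- n \<in> L" "Poly_Mapping.keys (zmon n :: 'l \<Rightarrow>\<^sub>0 'i coeff) \<subseteq> L"
      "Poly_Mapping.keys (zmon (- n) :: 'l \<Rightarrow>\<^sub>0 'i coeff) \<subseteq> L"
      "Poly_Mapping.keys (scalar c :: 'l \<Rightarrow>\<^sub>0 'i coeff) \<subseteq> L"
      using sublattice_uminus[OF L] zmon_in[of n] zmon_in[of "- n"] scalar_in[of c] by simp_all
    let ?t = "qmul B (zmon (- n)) (qmul B s (zmon n))"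
    have t_keys: "Poly_Mapping.keys ?t \<subseteq> ?C"
      using s(2)
    proof (induction s rule: poly_mapping_additive_induct)
      case (single b d)
      then show ?case by (simp add: zmon_def qmul_single)
    next
      case (add x y)
      then show ?case
        using keys_add[of "qmul B (zmon (- n)) (qmul B x (zmon n))"
            "qmul B (zmon (- n)) (qmul B y (zmon n))"]
        by (auto simp: qmul_add_left qmul_add_right)
    qed simp
    have nt: "qmul B (zmon n) ?t = qmul B s (zmon n)"
    proof -
      have "qmul B (zmon n) ?t = qmul B (qmul B (zmon n) (zmon (- n))) (qmul B s (zmon n))"
        using n sL by (simp add: assoc closed)
      moreover have "qmul B (zmon n) (zmon (- n)) = (zmon 0 :: 'l \<Rightarrow>\<^sub>0 'i coeff)"
        by (rule zmon_uminus[OF single])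
      ultimately show ?thesis
        using T.l_one[of "qmul B s (zmon n)"] closed[OF sL n(2)] by simp
    qed
    have "?t \<noteq> 0"
    proof
      assume "?t = 0"
      then have "qmul B s (zmon n) = 0" using nt by simp
      moreover have "zmon n \<noteq> (0 :: 'l \<Rightarrow>\<^sub>0 'i coeff)"
        unfolding zmon_def by (metis lookup_single_eq lookup_zero zero_neq_one)
      ultimately show False using domain[of s "zmon n"] sL n s by simp
    qed
    moreover have "qmul B (Poly_Mapping.single n c) ?t = qmul B s (Poly_Mapping.single n c)"
    proof -
      have c: "Poly_Mapping.single n c = qmul B (scalar c) (zmon n)"
        using single by (simp add: zmon_def scalar_single)
      have "qmul B (Poly_Mapping.single n c) ?t = qmul B (scalar c) (qmul B (zmon n) ?t)"
        unfolding c using n t_keys CL by (intro assoc) auto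
      also have "\<dots> = qmul B (scalar c) (qmul B s (zmon n))"
        unfolding nt ..
      also have "\<dots> = qmul B (qmul B s (scalar c)) (zmon n)"
        using n sL scalar_central[of s c] by (simp flip: assoc)
      finally show ?thesis unfolding c using n sL by (simp add: assoc)
    qed
    ultimately show ?case
      using t_keys single by (intro exI[of _ ?t] exI[of _ "Poly_Mapping.single n c"]) simp
  next
    case (add x y)
    then obtain t b t' b' where 1: "t \<noteq> 0" "Poly_Mapping.keys t \<subseteq> ?C"
        "Poly_Mapping.keys b \<subseteq> L" "qmul B x t = qmul B s b"
      and 2: "t' \<noteq> 0" "Poly_Mapping.keys t' \<subseteq> ?C"
        "Poly_Mapping.keys b' \<subseteq> L" "qmul B y t' = qmul B s b'"
      by auto
    have L12: "Poly_Mapping.keys t \<subseteq> L" "Poly_Mapping.keys t' \<subseteq> L" using 1 2 CL by blast+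
    let ?b = "qmul B b t' + qmul B b' t"
    have comm: "qmul B t t' = qmul B t' t" using cyclic_commute[OF u] 1 2 by blast
    have "qmul B (x + y) (qmul B t t') = qmul B (qmul B x t) t' + qmul B (qmul B y t') t"
      using add L12 unfolding qmul_add_left by (simp add: assoc) (simp add: comm)
    also have "\<dots> = qmul B s ?b"
      using sL 1 2 L12 by (simp add: assoc qmul_add_right)
    finally have "qmul B (x + y) (qmul B t t') = qmul B s ?b" .
    moreover have "qmul B t t' \<noteq> 0" using domain[of t t'] 1 2 L12 by simp
    moreover have "Poly_Mapping.keys (qmul B t t') \<subseteq> ?C"
      using keys_qmul[OF C_add] 1 2 by blast
    moreover have "?b \<in> carrier T"
      using T.a_closed[of "qmul B b t'" "qmul B b' t"] closed 1 2 L12 by simp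
    ultimately show ?case by blast
  qed
qed

end


section \<open>Exchange homomorphisms\<close>

text \<open>
  An abstract form of a mutation on the \<open>\<A>\<close>-side. The degree is the coefficient of the exchanged
  vector f, monomials of degree 0 are fixed, and the monomial of f goes to a binomial in the
  monomial of z times the monomial of \<open>f + r\<close>. Splitting off either term of the binomial is
  allowed, which is what r is for: a mutation has two such descriptions, with opposite z.
\<close>

locale exchange_hom = torus_form L B + F: ring F
  for L :: "'l::ab_group_add set" and B and F :: "'f ring" +
  fixes \<iota> :: "('l \<Rightarrow>\<^sub>0 'i coeff) \<Rightarrow> 'f" and g :: "'f \<Rightarrow> 'f"
    and deg :: "'l \<Rightarrow> int" and f r z :: 'l and U W :: "'i coeff" and \<kappa> \<rho> :: int
  assumes \<iota>_hom: "\<iota> \<in> ring_hom T F" and g_hom: "g \<in> ring_hom F F"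
    and g_scalar: "g (\<iota> (scalar c)) = \<iota> (scalar c)"
    and in_L: "f \<in> L" "r \<in> L" "z \<in> L"
    and deg: "additive_on L deg" "deg f = 1" "deg r = 0" "deg z = 0"
    and B_z: "m \<in> L \<Longrightarrow> B m z = \<kappa> * deg m" and B_r: "m \<in> L \<Longrightarrow> B m r = \<rho> * deg m"
    and g_fixed: "m \<in> L \<Longrightarrow> deg m = 0 \<Longrightarrow> g (\<iota> (zmon m)) = \<iota> (zmon m)"
    and g_f: "g (\<iota> (zmon f)) =
      \<iota> (Poly_Mapping.single (f + r) U + Poly_Mapping.single (f + r + z) W)"
begin

lemma \<iota>_closed: "x \<in> carrier T \<Longrightarrow> \<iota> x \<in> carrier F"
  using \<iota>_hom by (rule ring_hom_closed)

lemma \<iota>_mult: "x \<in> carrier T \<Longrightarrow> y \<in> carrier T \<Longrightarrow> \<iota> (qmul B x y) = \<iota> x \<otimes>\<^bsub>F\<^esub> \<iota> y"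
  using ring_hom_mult[OF \<iota>_hom, of x y] by simp

definition factor :: "int \<Rightarrow> ('l \<Rightarrow>\<^sub>0 'i coeff)" where
  "factor l = Poly_Mapping.single 0 U + Poly_Mapping.single z (W * vpow (\<kappa> * (2 * l - 1)))"

definition factors :: "int list \<Rightarrow> 'f" where
  "factors ls = foldr (\<lambda>l x. \<iota> (factor l) \<otimes>\<^bsub>F\<^esub> x) ls \<one>\<^bsub>F\<^esub>"

lemma factor_in: "factor l \<in> carrier T"
  using ring.ring_simprules(1)[OF ring_T, of "Poly_Mapping.single 0 U"
      "Poly_Mapping.single z (W * vpow (\<kappa> * (2 * l - 1)))"]
    sublattice_zero[OF L] in_L
  by (simp add: factor_def)

lemma factors_closed: "factors ls \<in> carrier F"
  by (induction ls) (simp_all add: factors_def \<iota>_closed[OF factor_in])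

lemma factors_Nil: "factors [] = \<one>\<^bsub>F\<^esub>"
  and factors_Cons: "factors (l # ls) = \<iota> (factor l) \<otimes>\<^bsub>F\<^esub> factors ls"
  by (simp_all add: factors_def)

lemma factor_commute: "qmul B (factor l) (factor l') = qmul B (factor l') (factor l)"
  using in_L sublattice_zero[OF L]
  by (simp add: factor_def qmul_add_left qmul_add_right qmul_single self left_0 right_0 mult.commute
      add_ac)

lemma zmon_factor:
  assumes "m \<in> L"
  shows "qmul B (zmon m) (factor l) = qmul B (factor (l + deg m)) (zmon m)"
proof -
  have "B z m = - (\<kappa> * deg m)" using skew[OF in_L(3) assms] B_z[OF assms] by simp
  then show ?thesis
    using assms
    by (simp add: factor_def zmon_def qmul_add_left qmul_add_right qmul_single left_0 right_0 vpow_0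
        B_z add.commute mult.assoc flip: vpow_add) (simp add: algebra_simps)
qed

lemma zmon_factors:
  assumes "m \<in> L"
  shows "\<iota> (zmon m) \<otimes>\<^bsub>F\<^esub> factors ls = factors (map (\<lambda>l. l + deg m) ls) \<otimes>\<^bsub>F\<^esub> \<iota> (zmon m)"
proof (induction ls)
  case Nil
  then show ?case by (simp add: factors_Nil \<iota>_closed[OF zmon_in[OF assms]])
next
  case (Cons l ls)
  note closed = \<iota>_closed[OF zmon_in[OF assms]] \<iota>_closed[OF factor_in] factors_closed
  have "\<iota> (zmon m) \<otimes>\<^bsub>F\<^esub> factors (l # ls) = \<iota> (qmul B (zmon m) (factor l)) \<otimes>\<^bsub>F\<^esub> factors ls"
    by (simp add: factors_Cons \<iota>_mult[OF zmon_in[OF assms] factor_in] F.m_assoc closed)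
  also have "\<dots> = \<iota> (factor (l + deg m)) \<otimes>\<^bsub>F\<^esub> (\<iota> (zmon m) \<otimes>\<^bsub>F\<^esub> factors ls)"
    unfolding zmon_factor[OF assms]
    by (simp add: \<iota>_mult[OF factor_in zmon_in[OF assms]] F.m_assoc closed)
  also have "\<dots> = factors (map (\<lambda>l. l + deg m) (l # ls)) \<otimes>\<^bsub>F\<^esub> \<iota> (zmon m)"
    unfolding Cons by (simp add: factors_Cons F.m_assoc closed)
  finally show ?case .
qed

lemma factors_append: "factors (ls @ ls') = factors ls \<otimes>\<^bsub>F\<^esub> factors ls'"
  by (induction ls) (simp_all add: factors_Nil factors_Cons F.m_assoc factors_closed \<iota>_closed[OF factor_in])

lemma factors_snoc: "factors ls \<otimes>\<^bsub>F\<^esub> \<iota> (factor l) = factors (l # ls)"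
proof (induction ls)
  case Nil
  then show ?case by (simp add: factors_Nil factors_Cons \<iota>_closed[OF factor_in])
next
  case (Cons l' ls)
  note closed = \<iota>_closed[OF factor_in] factors_closed
  have "factors (l' # ls) \<otimes>\<^bsub>F\<^esub> \<iota> (factor l) = \<iota> (factor l') \<otimes>\<^bsub>F\<^esub> (factors ls \<otimes>\<^bsub>F\<^esub> \<iota> (factor l))"
    by (simp add: factors_Cons F.m_assoc closed)
  also have "\<dots> = \<iota> (qmul B (factor l') (factor l)) \<otimes>\<^bsub>F\<^esub> factors ls"
    unfolding Cons by (simp add: factors_Cons F.m_assoc closed \<iota>_mult[OF factor_in factor_in])
  also have "\<dots> = factors (l # l' # ls)"
    unfolding factor_commute[of l' l]
    by (simp add: factors_Cons F.m_assoc closed \<iota>_mult[OF factor_in factor_in])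
  finally show ?case .
qed

lemma factors_rev: "factors (rev ls) = factors ls"
proof (induction ls)
  case (Cons l ls)
  then show ?case using factors_snoc[of "rev ls" l] factors_snoc[of ls l]
    by (simp add: factors_append factors_Cons[of _ "[]"] factors_Nil \<iota>_closed[OF factor_in])
qed simp

text \<open>
  Peel off one factor \<open>f\<close> at a time. Its image contributes \<open>factor 1\<close> and the monomial
  \<open>f + r\<close>, and moving this monomial to the right past the factors collected so far shifts
  their indices by one.
\<close>

lemma exchange_zmon:
  assumes "m \<in> L" "deg m = int n"
  shows "g (\<iota> (zmon m)) = factors (map int [1..<Suc n]) \<otimes>\<^bsub>F\<^esub> \<iota> (zmon (m + zmul (int n) r))"
  using assms
proof (induction n arbitrary: m)
  case 0
  then show ?case using g_fixed[of m] by (simp add: factors_Nil \<iota>_closed[OF zmon_in])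
next
  case (Suc n)
  define m1 where "m1 = m - f"
  have m1: "m1 \<in> L" "deg m1 = int n" and m: "m = f + m1"
    using Suc.prems in_L deg(2) by (simp_all add: m1_def sublattice_diff[OF L] additive_on_diff[OF deg(1) L])
  define m2 where "m2 = m1 + zmul (int n) r"
  have m2: "m2 \<in> L" using m1 in_L by (simp add: m2_def sublattice_add[OF L] sublattice_zmul[OF L])
  have fr: "f + r \<in> L" using in_L by (simp add: sublattice_add[OF L])
  have deg_fr: "deg (f + r) = 1" using in_L deg by (simp add: additive_on_add[OF deg(1)])
  note closed = \<iota>_closed[OF zmon_in[OF fr]] \<iota>_closed[OF zmon_in[OF in_L(1)]]
    \<iota>_closed[OF zmon_in[OF m1(1)]] \<iota>_closed[OF zmon_in[OF m2]] \<iota>_closed[OF scalar_in]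
    \<iota>_closed[OF factor_in] factors_closed
  have g_f': "g (\<iota> (zmon f)) = \<iota> (factor 1) \<otimes>\<^bsub>F\<^esub> \<iota> (zmon (f + r))"
  proof -
    have "B z (f + r) = - \<kappa>" using skew[OF in_L(3) fr] B_z[OF fr] deg_fr by simp
    then have "qmul B (factor 1) (zmon (f + r)) =
        Poly_Mapping.single (f + r) U + Poly_Mapping.single (f + r + z) W"
      using fr by (simp add: factor_def zmon_def qmul_add_left qmul_single left_0 vpow_0 add.commute
          mult.assoc flip: vpow_add)
    then show ?thesis unfolding g_f using \<iota>_mult[OF factor_in zmon_in[OF fr]] by metis
  qed
  \<comment> \<open>Passing from f to \<open>f + r\<close> does not change the commutation factor, as the two
     contributions of r cancel.\<close>
  have B_eq: "B (f + r) m2 = B f m1"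
  proof -
    have "B r m1 = - (\<rho> * int n)" using skew[OF in_L(2) m1(1)] B_r[OF m1(1)] m1(2) by simp
    moreover have "B f r = \<rho>" using B_r[OF in_L(1)] deg(2) by simp
    ultimately show ?thesis
      using in_L m1(1) sublattice_zmul[OF L in_L(2)] fr
      by (simp add: m2_def right_add left_add right_zmul self zmul_int)
  qed
  have scalar_split: "zmon (a + b) = qmul B (scalar (vpow (- B a b))) (qmul B (zmon a) (zmon b))"
    if "a \<in> L" "b \<in> L" for a b
    using that by (simp add: zmon_def qmul_single scalar_single sublattice_add[OF L] vpow_0 flip: vpow_add)
  have in_T: "qmul B (zmon a) (zmon b) \<in> carrier T" if "a \<in> L" "b \<in> L" for a b
    using ring.ring_simprules(5)[OF ring_T zmon_in[OF that(1)] zmon_in[OF that(2)]] by simp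
  let ?\<sigma> = "\<iota> (scalar (vpow (- B f m1)))" and ?P = "factors (map int [1..<Suc n])"
  have split: "\<iota> (zmon (a + b)) = \<iota> (scalar (vpow (- B a b))) \<otimes>\<^bsub>F\<^esub> (\<iota> (zmon a) \<otimes>\<^bsub>F\<^esub> \<iota> (zmon b))"
    if "a \<in> L" "b \<in> L" for a b
    using that
    by (simp only: scalar_split[of a b] \<iota>_mult[OF scalar_in in_T] \<iota>_mult[OF zmon_in zmon_in])
  have central: "?\<sigma> \<otimes>\<^bsub>F\<^esub> \<iota> (factor l) = \<iota> (factor l) \<otimes>\<^bsub>F\<^esub> ?\<sigma>" for l
    using scalar_central[OF factor_in] \<iota>_mult[OF factor_in scalar_in] \<iota>_mult[OF scalar_in factor_in] by metis
  have central': "?\<sigma> \<otimes>\<^bsub>F\<^esub> factors ls = factors ls \<otimes>\<^bsub>F\<^esub> ?\<sigma>" for ls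
  proof (induction ls)
    case (Cons l ls)
    have "?\<sigma> \<otimes>\<^bsub>F\<^esub> factors (l # ls) = \<iota> (factor l) \<otimes>\<^bsub>F\<^esub> (?\<sigma> \<otimes>\<^bsub>F\<^esub> factors ls)"
      using central closed by (simp add: factors_Cons flip: F.m_assoc)
    then show ?case unfolding Cons by (simp add: factors_Cons F.m_assoc closed)
  qed (simp add: factors_Nil closed)
  have shift: "1 # map (\<lambda>l. l + 1) (map int [1..<Suc n]) = map int [1..<Suc (Suc n)]"
    by (simp add: upt_conv_Cons map_Suc_upt[symmetric] del: upt_Suc)
  have "g (\<iota> (zmon m)) = ?\<sigma> \<otimes>\<^bsub>F\<^esub> (g (\<iota> (zmon f)) \<otimes>\<^bsub>F\<^esub> g (\<iota> (zmon m1)))"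
    unfolding m split[OF in_L(1) m1(1)]
    by (simp add: ring_hom_mult[OF g_hom] closed g_scalar)
  also have "\<dots> = ?\<sigma> \<otimes>\<^bsub>F\<^esub> (\<iota> (factor 1) \<otimes>\<^bsub>F\<^esub> \<iota> (zmon (f + r)) \<otimes>\<^bsub>F\<^esub> (?P \<otimes>\<^bsub>F\<^esub> \<iota> (zmon m2)))"
    unfolding g_f' Suc.IH[OF m1] m2_def ..
  also have "\<dots> = ?\<sigma> \<otimes>\<^bsub>F\<^esub> (\<iota> (factor 1) \<otimes>\<^bsub>F\<^esub> (\<iota> (zmon (f + r)) \<otimes>\<^bsub>F\<^esub> ?P) \<otimes>\<^bsub>F\<^esub> \<iota> (zmon m2))"
    by (simp add: F.m_assoc closed)
  also have "\<dots> = ?\<sigma> \<otimes>\<^bsub>F\<^esub> factors (map int [1..<Suc (Suc n)]) \<otimes>\<^bsub>F\<^esub> (\<iota> (zmon (f + r)) \<otimes>\<^bsub>F\<^esub> \<iota> (zmon m2))"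
    unfolding zmon_factors[OF fr] deg_fr shift[symmetric] factors_Cons by (simp add: F.m_assoc closed)
  also have "\<dots> = factors (map int [1..<Suc (Suc n)]) \<otimes>\<^bsub>F\<^esub> (?\<sigma> \<otimes>\<^bsub>F\<^esub> (\<iota> (zmon (f + r)) \<otimes>\<^bsub>F\<^esub> \<iota> (zmon m2)))"
    unfolding central' by (simp add: F.m_assoc closed)
  also have "?\<sigma> \<otimes>\<^bsub>F\<^esub> (\<iota> (zmon (f + r)) \<otimes>\<^bsub>F\<^esub> \<iota> (zmon m2)) = \<iota> (zmon (f + r + m2))"
    using split[OF fr m2] by (simp add: B_eq)
  also have "f + r + m2 = m + zmul (int (Suc n)) r"
    using zmul_add[of 1 "int n" r] by (simp add: m m2_def add_ac)
  finally show ?case .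
qed

end

section \<open>Units in generated subrings\<close>

definition units_in :: "('f, 'm) ring_scheme \<Rightarrow> 'f set \<Rightarrow> 'f set" where
  "units_in F G = {u \<in> Units F. u \<in> G \<and> inv\<^bsub>F\<^esub> u \<in> G}"

lemma (in ring) inv_mult_Units:
  "u \<in> Units R \<Longrightarrow> v \<in> Units R \<Longrightarrow> inv (u \<otimes> v) = inv v \<otimes> inv u"
proof -
  assume u: "u \<in> Units R" and v: "v \<in> Units R"
  then have c: "u \<in> carrier R" "v \<in> carrier R" "inv u \<in> carrier R" "inv v \<in> carrier R" by auto
  have "inv v \<otimes> inv u \<otimes> (u \<otimes> v) = inv v \<otimes> (inv u \<otimes> u) \<otimes> v" using c by (simp add: m_assoc)
  then have "inv v \<otimes> inv u \<otimes> (u \<otimes> v) = \<one>" using u v c by simp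
  then show ?thesis using u v c inv_unique'[of "u \<otimes> v" "inv v \<otimes> inv u"]
    by (metis Units_inv_closed Units_m_closed Units_r_inv inv_unique m_closed)
qed

context ring
begin

lemma units_in_mult:
  assumes "u \<in> units_in R (generate_ring R H)" "v \<in> units_in R (generate_ring R H)"
  shows "u \<otimes> v \<in> units_in R (generate_ring R H)"
  using assms by (auto simp: units_in_def inv_mult_Units intro: generate_ring.eng_mult)

lemma units_in_inv: "u \<in> units_in R G \<Longrightarrow> inv u \<in> units_in R G"
  by (simp add: units_in_def)

lemma units_in_one: "\<one> \<in> units_in R (generate_ring R H)"
  by (simp add: units_in_def generate_ring.one)

lemma units_in_foldr:
  assumes "\<And>l. l \<in> set ls \<Longrightarrow> h l \<in> units_in R (generate_ring R H)"
  shows "foldr (\<lambda>l z. h l \<otimes> z) ls \<one> \<in> units_in R (generate_ring R H)"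
  using assms by (induction ls) (auto simp: units_in_one intro: units_in_mult)

lemma hom_foldr:
  assumes Q: "Q \<in> ring_hom (R\<lparr>carrier := generate_ring R H\<rparr>) K"
    and "\<And>l. l \<in> set ls \<Longrightarrow> h l \<in> generate_ring R H"
  shows "Q (foldr (\<lambda>l z. h l \<otimes> z) ls \<one>) = foldr (\<lambda>l z. Q (h l) \<otimes>\<^bsub>K\<^esub> z) ls \<one>\<^bsub>K\<^esub>"
proof -
  have "foldr (\<lambda>l z. h l \<otimes> z) ls \<one> \<in> generate_ring R H \<and> ?thesis"
    using assms(2)
    by (induction ls)
      (use ring_hom_one[OF Q] ring_hom_mult[OF Q]
        in \<open>auto intro: generate_ring.one generate_ring.eng_mult\<close>)
  then show ?thesis ..
qed

lemma hom_units_in: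
  assumes Q: "Q \<in> ring_hom (R\<lparr>carrier := G\<rparr>) K" and K: "ring K" and u: "u \<in> units_in R G"
  shows "Q u \<in> Units K" "Q (inv u) = inv\<^bsub>K\<^esub> (Q u)"
proof -
  interpret K: ring K by (rule K)
  have mem: "u \<in> G" "inv u \<in> G" "u \<in> Units R" using u by (simp_all add: units_in_def)
  have c: "Q u \<in> carrier K" "Q (inv u) \<in> carrier K"
    using ring_hom_closed[OF Q] mem by simp_all
  have 1: "Q (inv u) \<otimes>\<^bsub>K\<^esub> Q u = \<one>\<^bsub>K\<^esub>" "Q u \<otimes>\<^bsub>K\<^esub> Q (inv u) = \<one>\<^bsub>K\<^esub>"
    using ring_hom_mult[OF Q, of "inv u" u] ring_hom_mult[OF Q, of u "inv u"] ring_hom_one[OF Q] mem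
    by simp_all
  then show *: "Q u \<in> Units K" using c unfolding Units_def by blast
  then show "Q (inv u) = inv\<^bsub>K\<^esub> (Q u)"
    using 1 c K.inv_unique[of "Q (inv u)" "Q u" "inv\<^bsub>K\<^esub> (Q u)"] by auto
qed

end

lemma fraction_skew_fieldD:
  assumes "fraction_skew_field T F \<iota>"
  shows "ring F" "Units F = carrier F - {\<zero>\<^bsub>F\<^esub>}" "\<iota> \<in> ring_hom T F" "inj_on \<iota> (carrier T)"
  using assms by (simp_all add: fraction_skew_field_def)

lemma fraction_unit:
  assumes F: "fraction_skew_field T F \<iota>" and T: "ring T"
    and x: "x \<in> carrier T" "x \<noteq> \<zero>\<^bsub>T\<^esub>"
  shows "\<iota> x \<in> Units F"
proof -
  note D = fraction_skew_fieldD[OF F]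
  interpret T: ring T by (rule T)
  interpret i: ring_hom_ring T F \<iota> by (rule ring_hom_ringI2[OF T D(1,3)])
  have "\<iota> x \<noteq> \<iota> \<zero>\<^bsub>T\<^esub>" using inj_on_eq_iff[OF D(4) x(1) T.zero_closed] x(2) by simp
  then show ?thesis using x D(2) by simp
qed

lemma single_eq_0_iff: "Poly_Mapping.single a c = 0 \<longleftrightarrow> c = 0"
  by (metis lookup_single_eq lookup_zero single_zero)

lemma zmon_nonzero: "(zmon a :: _ \<Rightarrow>\<^sub>0 'i coeff) \<noteq> 0"
  by (simp add: zmon_def single_eq_0_iff)

lemma tmon_nonzero: "tmon x \<noteq> 0"
  by (simp add: tmon_def tconst_def single_eq_0_iff)

lemma vbar_tmon: "vbar (tmon x) = tmon x"
  by (simp add: tmon_def vbar_tconst)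


section \<open>The map of quantum cluster varieties\<close>

locale quantum_data = compatible_data D e0 \<Lambda> p
  for D :: "('i::finite, 'n::ab_group_add) fixed_data" and e0 \<Lambda> p +
  fixes FX :: "'x ring" and \<iota>X :: "('n \<Rightarrow>\<^sub>0 'i coeff) \<Rightarrow> 'x"
    and FA :: "'a ring" and \<iota>A :: "(('n \<Rightarrow> int) \<Rightarrow>\<^sub>0 'i coeff) \<Rightarrow> 'a"
  assumes fracX: "fraction_skew_field (X_torus D) FX \<iota>X"
    and fracA: "fraction_skew_field (A_torus D \<Lambda>) FA \<iota>A"
begin

sublocale X: torus_form UNIV BX
proof
  show "additive_on UNIV (BX a)" for a
    using additive_on_add[OF Lam_additive_right[OF p_in] p_in p_in]
    by (simp add: additive_on_def BX_eq p_add)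
  show "BX a b = - BX b a" for a b
    using Lam_skew[OF p_in p_in, of a b] by (simp add: BX_eq)
qed simp

sublocale A: torus_form "Mcirc D" \<Lambda>
  by (rule torus_form.intro[OF sublattice_Mcirc Lam_additive_right Lam_skew])

lemma X_torus_eq: "X_torus D = quantum_torus UNIV BX"
proof -
  have "BX = (\<lambda>n n'. \<lfloor>of_nat (dlcm D) * form D n n'\<rfloor>)" by (simp add: fun_eq_iff BX_def)
  then show ?thesis by (simp add: X_torus_def)
qed

lemma A_torus_eq: "A_torus D \<Lambda> = quantum_torus (Mcirc D) \<Lambda>"
  by (simp add: A_torus_def)

lemma carrier_X: "x \<in> carrier (X_torus D)"
  by (simp add: X_torus_eq)

sublocale FX: ring FX by (rule fraction_skew_fieldD(1)[OF fracX])
sublocale FA: ring FA by (rule fraction_skew_fieldD(1)[OF fracA])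

lemmas \<iota>X_hom = fraction_skew_fieldD(3)[OF fracX, unfolded X_torus_eq]
  and \<iota>A_hom = fraction_skew_fieldD(3)[OF fracA, unfolded A_torus_eq]

lemma \<iota>X_closed: "\<iota>X x \<in> carrier FX"
  using ring_hom_closed[OF \<iota>X_hom] by simp

lemma \<iota>A_closed: "Poly_Mapping.keys x \<subseteq> Mcirc D \<Longrightarrow> \<iota>A x \<in> carrier FA"
  using ring_hom_closed[OF \<iota>A_hom] by simp

lemma \<iota>X_mult: "\<iota>X (qmul BX x y) = \<iota>X x \<otimes>\<^bsub>FX\<^esub> \<iota>X y"
  using ring_hom_mult[OF \<iota>X_hom, of x y] by simp

lemma \<iota>X_add: "\<iota>X (x + y) = \<iota>X x \<oplus>\<^bsub>FX\<^esub> \<iota>X y"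
  using ring_hom_add[OF \<iota>X_hom, of x y] by simp

lemma \<iota>X_one: "\<iota>X (zmon 0) = \<one>\<^bsub>FX\<^esub>"
  using ring_hom_one[OF \<iota>X_hom] by simp

lemma \<iota>A_mult:
  "Poly_Mapping.keys x \<subseteq> Mcirc D \<Longrightarrow> Poly_Mapping.keys y \<subseteq> Mcirc D \<Longrightarrow>
    \<iota>A (qmul \<Lambda> x y) = \<iota>A x \<otimes>\<^bsub>FA\<^esub> \<iota>A y"
  using ring_hom_mult[OF \<iota>A_hom, of x y] by simp

lemma \<iota>A_add:
  "Poly_Mapping.keys x \<subseteq> Mcirc D \<Longrightarrow> Poly_Mapping.keys y \<subseteq> Mcirc D \<Longrightarrow>
    \<iota>A (x + y) = \<iota>A x \<oplus>\<^bsub>FA\<^esub> \<iota>A y"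
  using ring_hom_add[OF \<iota>A_hom, of x y] by simp

lemma \<iota>A_one: "\<iota>A (zmon 0) = \<one>\<^bsub>FA\<^esub>"
  using ring_hom_one[OF \<iota>A_hom] by simp

lemma \<iota>X_unit: "x \<noteq> 0 \<Longrightarrow> \<iota>X x \<in> Units FX"
  using fraction_unit[OF fracX] X.ring_T by (simp add: X_torus_eq)

lemma \<iota>A_unit: "Poly_Mapping.keys x \<subseteq> Mcirc D \<Longrightarrow> x \<noteq> 0 \<Longrightarrow> \<iota>A x \<in> Units FA"
  using fraction_unit[OF fracA] A.ring_T by (simp add: A_torus_eq)

lemma keys_zmon_A: "m \<in> Mcirc D \<Longrightarrow> Poly_Mapping.keys (zmon m :: _ \<Rightarrow>\<^sub>0 'i coeff) \<subseteq> Mcirc D"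
  by (simp add: zmon_def)

lemma keys_pstar: "Poly_Mapping.keys (pstar_alg p x) \<subseteq> Mcirc D"
  using keys_pstar_alg[of p x] p_in by blast

lemma pstar_mult: "pstar_alg p (qmul BX x y) = qmul \<Lambda> (pstar_alg p x) (pstar_alg p y)"
  by (rule pstar_alg_qmul) (simp_all add: p_add BX_eq)

lemma pstar_zmon: "pstar_alg p (zmon n) = zmon (p n)"
  by (simp add: zmon_def pstar_alg_single)

lemma pstar_scalar: "pstar_alg p (scalar c) = scalar (vbar c)"
  by (simp add: scalar_def pstar_alg_single p_0)

lemma pstar_ring_hom: "pstar_alg p \<in> ring_hom (X_torus D) (A_torus D \<Lambda>)"
  unfolding X_torus_eq A_torus_eq
  by (rule ring_hom_memI) (simp_all add: keys_pstar pstar_mult pstar_alg_add pstar_zmon p_0)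

lemma pstar_star_alg_hom: "star_alg_hom D \<Lambda> (pstar_alg p)"
  using pstar_ring_hom
  by (simp add: star_alg_hom_def pstar_scalar vbar_tconst vbar_vpow pstar_alg_star)

lemma inv_\<iota>X_zmon: "inv\<^bsub>FX\<^esub> (\<iota>X (zmon n)) = \<iota>X (zmon (- n))"
proof -
  have "\<iota>X (zmon (- n)) \<otimes>\<^bsub>FX\<^esub> \<iota>X (zmon n) = \<one>\<^bsub>FX\<^esub>"
    by (simp add: X.zmon_uminus_left \<iota>X_one flip: \<iota>X_mult)
  then show ?thesis
    using FX.inv_unique[of "\<iota>X (zmon (- n))" "\<iota>X (zmon n)" "inv\<^bsub>FX\<^esub> (\<iota>X (zmon n))"]
      \<iota>X_unit[OF zmon_nonzero] \<iota>X_closed by auto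
qed

lemma inv_\<iota>A_zmon:
  assumes "m \<in> Mcirc D"
  shows "inv\<^bsub>FA\<^esub> (\<iota>A (zmon m)) = \<iota>A (zmon (- m))"
proof -
  note m = keys_zmon_A[OF assms] keys_zmon_A[OF sublattice_uminus[OF sublattice_Mcirc assms]]
  have "\<iota>A (zmon (- m)) \<otimes>\<^bsub>FA\<^esub> \<iota>A (zmon m) = \<one>\<^bsub>FA\<^esub>"
    using arg_cong[OF A.zmon_uminus_left[OF assms], of \<iota>A] \<iota>A_mult[OF m(2,1)] \<iota>A_one by simp
  then show ?thesis
    using FA.inv_unique[of "\<iota>A (zmon (- m))" "\<iota>A (zmon m)" "inv\<^bsub>FA\<^esub> (\<iota>A (zmon m))"]
      \<iota>A_unit[OF m(1) zmon_nonzero] \<iota>A_closed m by auto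
qed

lemma X_domain:
  fixes x y :: "'n \<Rightarrow>\<^sub>0 'i coeff"
  assumes "x \<noteq> 0" "y \<noteq> 0"
  shows "qmul BX x y \<noteq> 0"
proof
  assume 0: "qmul BX x y = 0"
  interpret i: ring_hom_ring "quantum_torus UNIV BX" FX \<iota>X
    by (rule ring_hom_ringI2[OF X.ring_T FX.ring_axioms \<iota>X_hom])
  have "\<iota>X 0 \<in> Units FX"
    using \<iota>X_unit[OF \<open>x \<noteq> 0\<close>] \<iota>X_unit[OF \<open>y \<noteq> 0\<close>] \<iota>X_mult[of x y] by (simp add: 0)
  then show False using i.hom_zero fraction_skew_fieldD(2)[OF fracX] by simp
qed

context
  fixes e :: "'i \<Rightarrow> 'n" and c :: "'i \<Rightarrow> 'i \<Rightarrow> int" and k :: 'i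
  assumes e: "is_seed D e" "exch_integral D e" and k: "k \<in> Iuf D"
begin

abbreviation (input) "y \<equiv> form_map D (e k)"
abbreviation (input) "e' \<equiv> mut_basis D k e"
abbreviation (input) "f' \<equiv> dual_basis D e' k"
abbreviation (input) "T_plus \<equiv> tmon (pos_vec (c k)) :: 'i coeff"
abbreviation (input) "T_minus \<equiv> tmon (pos_vec (\<lambda>j. - c k j)) :: 'i coeff"
abbreviation (input) "G \<equiv> X_localization D FX \<iota>X (e, c) k"

lemma e': "is_seed D e'"
  by (rule seed_mutate[OF e k])

lemma y_in: "y \<in> Mcirc D"
  by (rule form_map_in[OF seed_Nuf[OF e(1) k]])

lemma p_e_k: "p (e k) = y"
  by (rule p_Nuf[OF seed_Nuf[OF e(1) k]])

lemma e_k_zmul: "zmul a (e k) = 0 \<Longrightarrow> a = 0"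
  using zbasis_zmul_eq_0[OF seed_bases(1)[OF e(1)]] by simp

lemma delta_pos: "delta k > 0"
proof -
  have "dlcm D > 0" unfolding dlcm_def using dd_pos Lcm_0_iff[of "range (dd D)"] by (metis finite finite_imageI gr0I imageE less_irrefl)
  then have "delta k * int (dd D k) > 0" using dlcm_eq_delta[of k] by simp
  then show ?thesis using dd_pos[of k] by (simp add: zero_less_mult_iff)
qed

text \<open>
  The map p itself need not be injective, so its algebra map may kill elements. On multiples of
  \<open>e\<^sub>k\<close> it is injective because \<open>p e\<^sub>k = y\<close> and \<open>\<Lambda> (y, f\<^sub>k) > 0\<close>.
\<close>

lemma inj_p_cyclic: "inj_on p (range (\<lambda>a. zmul a (e k)))"
proof -
  have "y \<noteq> 0"
    using Lam_seed[OF e(1) k dual_basis_in[OF e(1)], of k] delta_pos coord_dual_basis[OF e(1), of k k]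
      A.left_0[OF dual_basis_in[OF e(1)], of k] by auto
  then obtain x where x: "y x \<noteq> 0" by (auto simp: fun_eq_iff)
  have "a = b" if "zmul a y = zmul b y" for a b
    using fun_cong[OF that, of x] x by (simp add: zmul_apply zmul_int)
  then show ?thesis by (auto simp: inj_on_def p_zmul p_e_k)
qed

lemma X_factor_keys:
  "Poly_Mapping.keys (X_factor D (e, c) k i l :: 'n \<Rightarrow>\<^sub>0 'i coeff) \<subseteq> range (\<lambda>a. zmul a (e k))"
proof -
  have "0 \<in> range (\<lambda>a. zmul a (e k))" by (rule range_eqI[of _ _ 0]) simp
  moreover have "Poly_Mapping.keys (X_factor D (e, c) k i l :: 'n \<Rightarrow>\<^sub>0 'i coeff) \<subseteq>
      {0, zmul (- sgn (exch D e i k)) (e k)}"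
    unfolding X_factor_def Let_def scalar_def
    by (rule order_trans[OF keys_add]) auto
  ultimately show ?thesis by auto
qed

lemma X_factor_nonzero:
  assumes "exch D e i k \<noteq> 0"
  shows "(X_factor D (e, c) k i l :: 'n \<Rightarrow>\<^sub>0 'i coeff) \<noteq> 0"
proof
  assume 0: "(X_factor D (e, c) k i l :: 'n \<Rightarrow>\<^sub>0 'i coeff) = 0"
  have "zmul (- sgn (exch D e i k)) (e k) \<noteq> 0" using e_k_zmul[of "- sgn (exch D e i k)"] assms by (auto simp: sgn_0_0)
  then have "Poly_Mapping.lookup (X_factor D (e, c) k i l :: 'n \<Rightarrow>\<^sub>0 'i coeff) 0 =
      tmon (pos_vec (\<lambda>j. sgn (exch D e i k) * c k j))"
    by (simp add: X_factor_def Let_def scalar_def lookup_add lookup_single)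
  then show False using 0 tmon_nonzero by (metis lookup_zero)
qed

lemma index_nonzero: "l \<in> set (X_factor_index D (e, c) k i) \<Longrightarrow> exch D e i k \<noteq> 0"
  by (auto simp: X_factor_index_def)


subsection \<open>Extension to the localization\<close>

text \<open>
  The products of factors of the mutation formula are in general not an Ore set, since
  conjugation by monomials shifts the powers of q in them. The denominators are therefore taken
  to be all nonzero Laurent polynomials in \<open>X\<^sub>k\<close>. Their images are nonzero, hence invertible.
\<close>

lemma extension_exists:
  "\<exists>Q. extends_to_localization D FX \<iota>X FA \<iota>A (e, c) k (pstar_alg p) Q"
proof -
  let ?C = "range (\<lambda>a. zmul a (e k))"
  define S where "S = {s :: 'n \<Rightarrow>\<^sub>0 'i coeff. s \<noteq> 0 \<and> Poly_Mapping.keys s \<subseteq> ?C}"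
  let ?T = "quantum_torus UNIV BX :: ('n \<Rightarrow>\<^sub>0 'i coeff) ring"
  let ?H = "\<iota>X ` carrier (X_torus D) \<union> {inv\<^bsub>FX\<^esub> (\<iota>X (X_factor D (e, c) k i l)) | i l.
    i \<noteq> k \<and> l \<in> set (X_factor_index D (e, c) k i)}"
  have C_add: "a + b \<in> ?C" if "a \<in> ?C" "b \<in> ?C" for a b
    using that by (auto simp flip: zmul_add)
  have "\<exists>Q\<in>ring_hom (FX\<lparr>carrier := generate_ring FX ?H\<rparr>) FA.
    \<forall>x\<in>carrier ?T. \<iota>X x \<in> generate_ring FX ?H \<longrightarrow> Q (\<iota>X x) = (\<iota>A \<circ> pstar_alg p) x"
  proof (rule ore_extension[where S = S])
    show "ring ?T" by (rule X.ring_T)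
    show "\<iota>X \<in> ring_hom ?T FX" by (rule \<iota>X_hom)
    show "inj_on \<iota>X (carrier ?T)"
      using fraction_skew_fieldD(4)[OF fracX] by (simp add: X_torus_eq)
    show "\<iota>A \<circ> pstar_alg p \<in> ring_hom ?T FA"
      using ring_hom_trans[OF pstar_ring_hom fraction_skew_fieldD(3)[OF fracA]] by (simp add: X_torus_eq)
    show "\<one>\<^bsub>?T\<^esub> \<in> S"
      using zmon_nonzero range_eqI[of "0 :: 'n" "\<lambda>a. zmul a (e k)" 0]
      by (simp add: S_def) (simp add: zmon_def del: single_one)
    show "s \<otimes>\<^bsub>?T\<^esub> t \<in> S" if "s \<in> S" "t \<in> S" for s t
      using that X_domain[of s t] keys_qmul[OF C_add, of s t BX] by (simp add: S_def)
    show "\<exists>t\<in>S. \<exists>b\<in>carrier ?T. a \<otimes>\<^bsub>?T\<^esub> t = s \<otimes>\<^bsub>?T\<^esub> b" if "a \<in> carrier ?T" "s \<in> S" for a s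
      using X.cyclic_ore[of "e k" a s] that X_domain by (auto simp: S_def)
    show "\<iota>X s \<in> Units FX" if "s \<in> S" for s using that \<iota>X_unit by (simp add: S_def)
    show "(\<iota>A \<circ> pstar_alg p) s \<in> Units FA" if "s \<in> S" for s
      using that pstar_alg_nonzero[of p s] inj_on_subset[OF inj_p_cyclic] \<iota>A_unit[OF keys_pstar]
      by (simp add: S_def)
    show "?H \<subseteq> \<iota>X ` carrier ?T \<union> (\<lambda>s. inv\<^bsub>FX\<^esub> \<iota>X s) ` S"
      using X_factor_keys X_factor_nonzero index_nonzero by (auto simp: S_def X_torus_eq)
  qed (simp_all add: FX.ring_axioms FA.ring_axioms)
  then obtain Q where Q: "Q \<in> ring_hom (FX\<lparr>carrier := generate_ring FX ?H\<rparr>) FA"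
    "\<forall>x. \<iota>X x \<in> generate_ring FX ?H \<longrightarrow> Q (\<iota>X x) = \<iota>A (pstar_alg p x)" by auto
  have "\<iota>X x \<in> generate_ring FX ?H" for x
    by (rule generate_ring.incl) (simp add: carrier_X)
  then have "extends_to_localization D FX \<iota>X FA \<iota>A (e, c) k (pstar_alg p) Q"
    using Q by (simp add: extends_to_localization_def X_localization_def)
  then show ?thesis by blast
qed

lemma \<iota>X_in_G: "\<iota>X x \<in> G"
  unfolding X_localization_def by (rule generate_ring.incl) (simp add: carrier_X)

lemma zmon_units_in_G: "\<iota>X (zmon n) \<in> units_in FX G"
  using \<iota>X_unit[OF zmon_nonzero] \<iota>X_in_G by (simp add: units_in_def inv_\<iota>X_zmon)

lemma units_in_G_mult: "u \<in> units_in FX G \<Longrightarrow> v \<in> units_in FX G \<Longrightarrow> u \<otimes>\<^bsub>FX\<^esub> v \<in> units_in FX G"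
  unfolding X_localization_def by (rule FX.units_in_mult)

lemma X_factor_units_in_G:
  assumes "i \<noteq> k" "l \<in> set (X_factor_index D (e, c) k i)"
  shows "\<iota>X (X_factor D (e, c) k i l) \<in> units_in FX G"
proof -
  have "inv\<^bsub>FX\<^esub> (\<iota>X (X_factor D (e, c) k i l)) \<in> G"
    unfolding X_localization_def using assms by (intro generate_ring.incl) blast
  then show ?thesis
    using \<iota>X_unit[OF X_factor_nonzero[OF index_nonzero[OF assms(2)]]] \<iota>X_in_G
    by (simp add: units_in_def)
qed


subsection \<open>Mutation of monomials on the \<open>\<A>\<close>-side\<close>

text \<open>
  For \<open>i \<noteq> k\<close> the dual vectors \<open>f'\<^sub>i\<close> and \<open>f\<^sub>i\<close> coincide, and the fixed monomials are closed under
  products and quotients up to central powers of v.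
\<close>

lemma g_fixed:
  assumes g: "A_mutation D FA \<iota>A (e, c) k g" and m: "m \<in> Mcirc D" "coord e' m k = 0"
  shows "g (\<iota>A (zmon m)) = \<iota>A (zmon m)"
proof -
  have hom: "g \<in> ring_hom FA FA"
    using g by (simp add: A_mutation_def Let_def ring_iso_def)
  have g_scalar: "g (\<iota>A (scalar c')) = \<iota>A (scalar c')" for c'
    using g by (simp add: A_mutation_def Let_def)
  define M where "M = {m \<in> Mcirc D. g (\<iota>A (zmon m)) = \<iota>A (zmon m)}"
  have "sublattice M"
    unfolding sublattice_def
  proof (intro conjI ballI)
    show "0 \<in> M"
      using sublattice_zero[OF sublattice_Mcirc] ring_hom_one[OF hom] by (simp add: M_def \<iota>A_one)
  next
    fix a b assume "a \<in> M" "b \<in> M"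
    then have ab: "a \<in> Mcirc D" "b \<in> Mcirc D" "a - b \<in> Mcirc D"
      and g_ab: "g (\<iota>A (zmon a)) = \<iota>A (zmon a)" "g (\<iota>A (zmon b)) = \<iota>A (zmon b)"
      by (simp_all add: M_def sublattice_diff[OF sublattice_Mcirc])
    note keys = keys_zmon_A[OF ab(1)] keys_zmon_A[OF ab(2)] keys_zmon_A[OF ab(3)]
    note cl = keys[THEN \<iota>A_closed]
    have sc: "Poly_Mapping.keys (scalar c' :: _ \<Rightarrow>\<^sub>0 'i coeff) \<subseteq> Mcirc D" for c'
      using A.scalar_in[of c'] by simp
    let ?v = "scalar (vpow (\<Lambda> (a - b) b)) :: _ \<Rightarrow>\<^sub>0 'i coeff"
    have eq: "\<iota>A (zmon (a - b)) \<otimes>\<^bsub>FA\<^esub> \<iota>A (zmon b) = \<iota>A ?v \<otimes>\<^bsub>FA\<^esub> \<iota>A (zmon a)"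
      using arg_cong[OF A.zmon_mult[OF ab(3,2)], of \<iota>A] \<iota>A_mult[OF keys(3,2)] \<iota>A_mult[OF sc keys(1)] by simp
    have "g (\<iota>A (zmon (a - b))) \<otimes>\<^bsub>FA\<^esub> \<iota>A (zmon b) = g (\<iota>A ?v \<otimes>\<^bsub>FA\<^esub> \<iota>A (zmon a))"
      using ring_hom_mult[OF hom cl(3,2)] g_ab eq by simp
    also have "\<dots> = \<iota>A (zmon (a - b)) \<otimes>\<^bsub>FA\<^esub> \<iota>A (zmon b)"
      using ring_hom_mult[OF hom \<iota>A_closed[OF sc] cl(1)] g_ab g_scalar eq by simp
    finally have *: "g (\<iota>A (zmon (a - b))) \<otimes>\<^bsub>FA\<^esub> \<iota>A (zmon b) = \<iota>A (zmon (a - b)) \<otimes>\<^bsub>FA\<^esub> \<iota>A (zmon b)" .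
    let ?b = "\<iota>A (zmon b)"
    have b: "?b \<in> Units FA" by (rule \<iota>A_unit[OF keys(2) zmon_nonzero])
    have "x \<otimes>\<^bsub>FA\<^esub> ?b \<otimes>\<^bsub>FA\<^esub> inv\<^bsub>FA\<^esub> ?b = x" if "x \<in> carrier FA" for x
      using that b by (simp add: FA.m_assoc FA.Units_closed)
    then have "g (\<iota>A (zmon (a - b))) = \<iota>A (zmon (a - b))"
      using * cl ring_hom_closed[OF hom cl(3)] by metis
    then show "a - b \<in> M" using ab by (simp add: M_def)
  qed
  moreover have "m = (\<Sum>j\<in>UNIV - {k}. zmul (coord e' m j) (dual_basis D e' j))"
  proof -
    have "m = (\<Sum>j\<in>UNIV. zmul (coord e' m j) (dual_basis D e' j))"
      by (rule Mcirc_expand[OF e' m(1)])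
    also have "\<dots> = (\<Sum>j\<in>UNIV - {k}. zmul (coord e' m j) (dual_basis D e' j))"
      by (rule sum.mono_neutral_right) (auto simp: m(2))
    finally show ?thesis .
  qed
  moreover have "dual_basis D e' j \<in> M" if "j \<in> UNIV - {k}" for j
  proof -
    have j: "j \<noteq> k" using that by simp
    have "g (\<iota>A (zmon (dual_basis D e' j))) = \<iota>A (zmon (dual_basis D e j))"
      using g j by (simp add: A_mutation_def Let_def mut_def)
    then show ?thesis
      using dual_basis_in[OF e(1)] by (simp add: M_def dual_basis_mut_other[OF e k j])
  qed
  ultimately have "m \<in> M"
    using sublattice_sum[of M "UNIV - {k}"] sublattice_zmul[of M] by (metis (no_types, lifting))
  then show ?thesis by (simp add: M_def)
qed

text \<open>
  The two ways to read the exchange relation: as \<open>(T_minus + T_plus v\<^sup>\<delta> A\<^sup>y) A\<^sup>f\<^sup>'\<close>, or as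
  \<open>(T_plus + T_minus v\<^sup>-\<^sup>\<delta> A\<^sup>-\<^sup>y) A\<^sup>f\<^sup>'\<^sup>+\<^sup>y\<close>. The first matches the factors of the \<open>\<X>\<close>-side
  if \<open>\<epsilon>\<^sub>i\<^sub>k < 0\<close>, the second if \<open>\<epsilon>\<^sub>i\<^sub>k > 0\<close>.
\<close>

lemma exchange_homs:
  assumes g: "A_mutation D FA \<iota>A (e, c) k g"
  shows "exchange_hom (Mcirc D) \<Lambda> FA \<iota>A g (\<lambda>m. coord e' m k) f' 0 y T_minus T_plus (delta k) 0"
    and "exchange_hom (Mcirc D) \<Lambda> FA \<iota>A g (\<lambda>m. coord e' m k) f' y (- y) T_plus T_minus
      (- delta k) (delta k)"
proof -
  have hom: "g \<in> ring_hom FA FA"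
    and g_scalar: "g (\<iota>A (scalar c')) = \<iota>A (scalar c')" for c'
    using g by (simp_all add: A_mutation_def Let_def ring_iso_def)
  have g_f: "g (\<iota>A (zmon f')) =
      \<iota>A (Poly_Mapping.single (f' + y) T_plus + Poly_Mapping.single f' T_minus)"
  proof -
    have "g (\<iota>A (zmon f')) = \<iota>A (Poly_Mapping.single (- dual_basis D e k +
          (\<Sum>j | exch D e k j > 0. zmul (exch D e k j) (dual_basis D e j))) T_plus +
        Poly_Mapping.single (- dual_basis D e k -
          (\<Sum>j | exch D e k j < 0. zmul (exch D e k j) (dual_basis D e j))) T_minus)"
      using g by (simp add: A_mutation_def Let_def mut_def)
    then show ?thesis
      by (simp only: exchange_exponents[OF e k] dual_basis_mut_same[OF e k, symmetric])
  qed
  have coord_y: "coord e' y k = 0"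
    by (simp add: coord_mut_basis[OF e k y_in] coord_form_map[OF e k] exch_self[OF e(2)])
  have Lam_y: "\<Lambda> m y = delta k * coord e' m k" if "m \<in> Mcirc D" for m
    using Lam_skew[OF that y_in] Lam_seed[OF e(1) k that] coord_mut_basis[OF e k that, of k] by simp
  have additive: "additive_on (Mcirc D) (\<lambda>m. coord e' m k)"
    by (simp add: additive_on_def coord_add)
  note facts = \<iota>A_hom hom g_scalar dual_basis_in[OF e'] y_in additive coord_y coord_0 coord_uminus
    coord_dual_basis[OF e'] Lam_y g_fixed[OF g] g_f A.right_0 A.right_uminus
    sublattice_zero[OF sublattice_Mcirc] sublattice_uminus[OF sublattice_Mcirc]
  show "exchange_hom (Mcirc D) \<Lambda> FA \<iota>A g (\<lambda>m. coord e' m k) f' 0 y T_minus T_plus (delta k) 0"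
    by unfold_locales (simp_all add: facts add.commute)
  show "exchange_hom (Mcirc D) \<Lambda> FA \<iota>A g (\<lambda>m. coord e' m k) f' y (- y) T_plus T_minus
      (- delta k) (delta k)"
    by unfold_locales (simp_all add: facts)
qed


subsection \<open>Commutation with mutation\<close>

context
  fixes \<mu> :: "'x \<Rightarrow> 'x" and g :: "'a \<Rightarrow> 'a" and Q :: "'x \<Rightarrow> 'a"
  assumes \<mu>: "X_mutation D FX \<iota>X (e, c) k \<mu>" and g: "A_mutation D FA \<iota>A (e, c) k g"
    and ext: "extends_to_localization D FX \<iota>X FA \<iota>A (e, c) k (pstar_alg p) Q"
begin

lemma \<mu>_hom: "\<mu> \<in> ring_hom FX FX"
  and \<mu>_scalar: "\<mu> (\<iota>X (scalar c')) = \<iota>X (scalar c')"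
  using \<mu> by (simp_all add: X_mutation_def ring_iso_def)

lemma g_hom: "g \<in> ring_hom FA FA"
  and g_scalar: "g (\<iota>A (scalar c')) = \<iota>A (scalar c')"
  using g by (simp_all add: A_mutation_def Let_def ring_iso_def)

lemma Q_hom: "Q \<in> ring_hom (FX\<lparr>carrier := G\<rparr>) FA"
  and Q_\<iota>X: "Q (\<iota>X x) = \<iota>A (pstar_alg p x)"
  using ext carrier_X by (auto simp: extends_to_localization_def)

lemma Q_mult: "u \<in> G \<Longrightarrow> v \<in> G \<Longrightarrow> Q (u \<otimes>\<^bsub>FX\<^esub> v) = Q u \<otimes>\<^bsub>FA\<^esub> Q v"
  using ring_hom_mult[OF Q_hom, of u v] by simp

lemma Q_add: "u \<in> G \<Longrightarrow> v \<in> G \<Longrightarrow> Q (u \<oplus>\<^bsub>FX\<^esub> v) = Q u \<oplus>\<^bsub>FA\<^esub> Q v"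
  using ring_hom_add[OF Q_hom, of u v] by simp

abbreviation (input) "factor_product i \<equiv>
  foldr (\<lambda>l z. \<iota>X (X_factor D (e, c) k i l) \<otimes>\<^bsub>FX\<^esub> z) (X_factor_index D (e, c) k i) \<one>\<^bsub>FX\<^esub>"

lemma factor_product_units_in_G: "i \<noteq> k \<Longrightarrow> factor_product i \<in> units_in FX G"
  using X_factor_units_in_G unfolding X_localization_def by (intro FX.units_in_foldr) blast

lemma Q_factor_product:
  "Q (factor_product i) = foldr (\<lambda>l z. \<iota>A (pstar_alg p (X_factor D (e, c) k i l)) \<otimes>\<^bsub>FA\<^esub> z)
    (X_factor_index D (e, c) k i) \<one>\<^bsub>FA\<^esub>"
  using FX.hom_foldr[OF Q_hom[unfolded X_localization_def],
      where h = "\<lambda>l. \<iota>X (X_factor D (e, c) k i l)" and ls = "X_factor_index D (e, c) k i"]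
    \<iota>X_in_G by (simp add: X_localization_def Q_\<iota>X)

lemma \<mu>_generator:
  "i \<noteq> k \<Longrightarrow> \<mu> (\<iota>X (zmon (e' i))) =
    \<iota>X (zmon (e i)) \<otimes>\<^bsub>FX\<^esub> factor_product i [^]\<^bsub>FX\<^esub> (- sgn (exch D e i k))"
  using \<mu> by (simp add: X_mutation_def mut_def)

lemma coord_p_e': "i \<noteq> k \<Longrightarrow> coord e' (p (e i)) k = - exch D e i k"
proof -
  have "rat_of_int (coord e (p (e i)) k) = rat_of_int (exch D e i k)"
    using seed_Nuf[OF e(1) k] seed_scaled_in[OF e(1)]
    by (simp add: coord_def p_restrict sublattice_zmul[OF sublattice_Nuf] form_zmul_right exch_eq[OF e(2)])
  then show ?thesis by (simp add: coord_mut_basis[OF e k p_in])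
qed

text \<open>
  The element \<open>p e'\<^sub>i\<close> has degree \<open>- \<epsilon>\<^sub>i\<^sub>k\<close>. If this is nonnegative, \<open>exchange_zmon\<close> expands the right
  hand side as a product of factors times \<open>A\<^sup>p\<^sup>(\<^sup>e\<^sub>i\<^sup>)\<close>; moving the monomial to the left shifts the
  indices and yields the factors of the \<open>\<X>\<close>-side in reverse order. If it is negative, the
  same expansion is applied to \<open>- p e'\<^sub>i\<close> and inverted.
\<close>

lemma commute_generator:
  assumes i: "i \<noteq> k"
  shows "\<mu> (\<iota>X (zmon (e' i))) \<in> units_in FX G"
    and "Q (\<mu> (\<iota>X (zmon (e' i)))) = g (\<iota>A (zmon (p (e' i))))"
proof -
  let ?\<epsilon> = "exch D e i k" and ?P = "factor_product i"
  let ?m = "p (e i)"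
  have P: "?P \<in> units_in FX G" "?P \<in> Units FX" "?P \<in> carrier FX"
    using factor_product_units_in_G[OF i] FX.Units_closed by (auto simp: units_in_def)
  note zm = keys_zmon_A[OF p_in] \<iota>A_closed[OF keys_zmon_A[OF p_in]]
  have "\<mu> (\<iota>X (zmon (e' i))) \<in> units_in FX G \<and>
    Q (\<mu> (\<iota>X (zmon (e' i)))) = g (\<iota>A (zmon (p (e' i))))"
  proof (cases "?\<epsilon> \<le> 0")
    case True
    define n where "n = nat (- ?\<epsilon>)"
    have n: "- ?\<epsilon> = int n" "nat \<bar>?\<epsilon>\<bar> = n" using True by (auto simp: n_def)
    interpret A: exchange_hom "Mcirc D" \<Lambda> FA \<iota>A g "\<lambda>m. coord e' m k" f' 0 y T_minus T_plus "delta k" 0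
      by (rule exchange_homs(1)[OF g])
    have e'_i: "e' i = e i" using True i by (simp add: mut_basis_def)
    \<comment> \<open>If \<open>\<epsilon>\<^sub>i\<^sub>k = 0\<close> there are no factors and the exponent is 0 instead of 1, to the same effect.\<close>
    have pow: "?P [^]\<^bsub>FX\<^esub> (- sgn ?\<epsilon>) = ?P"
    proof (cases "?\<epsilon> = 0")
      case True
      then show ?thesis by (simp add: X_factor_index_def int_pow_def2)
    next
      case False
      then have "- sgn ?\<epsilon> = 1" using True by (simp add: sgn_if)
      then show ?thesis using P(3) by (simp add: int_pow_def2)
    qed
    have image: "pstar_alg p (X_factor D (e, c) k i l) = A.factor (1 - int l)" if "?\<epsilon> \<noteq> 0" for l
    proof -
      have \<sigma>: "sgn ?\<epsilon> = - 1" using True that by (simp add: sgn_if)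
      show ?thesis
        by (simp add: X_factor_def Let_def \<sigma> pstar_alg_add pstar_scalar pstar_alg_single
            A.factor_def vbar_mult vbar_tmon vbar_vpow p_e_k p_0 scalar_def algebra_simps flip: delta_def)
    qed
    have QP: "Q ?P = A.factors (map (\<lambda>l. 1 - int l) [1..<Suc n])"
    proof (cases "?\<epsilon> = 0")
      case True
      then show ?thesis
        using n ring_hom_one[OF Q_hom] by (simp add: X_factor_index_def A.factors_Nil)
    next
      case False
      then show ?thesis
        unfolding Q_factor_product unfolding X_factor_index_def
        by (simp add: n(2) A.factors_def foldr_map comp_def image del: upt_Suc)
    qed
    have shift: "map (\<lambda>l. l + int n) (map (\<lambda>l. 1 - int l) [1..<Suc n]) = rev (map int [1..<Suc n])"
      by (rule nth_equalityI) (simp_all add: rev_nth del: upt_Suc)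
    have m: "coord e' ?m k = int n" using coord_p_e'[OF i] n by simp
    have "Q (\<iota>X (zmon (e i)) \<otimes>\<^bsub>FX\<^esub> ?P) = \<iota>A (zmon ?m) \<otimes>\<^bsub>FA\<^esub> Q ?P"
      using P(1) \<iota>X_in_G by (simp add: Q_mult Q_\<iota>X pstar_zmon units_in_def)
    also have "\<dots> = A.factors (rev (map int [1..<Suc n])) \<otimes>\<^bsub>FA\<^esub> \<iota>A (zmon ?m)"
      unfolding QP A.zmon_factors[OF p_in] m shift ..
    also have "\<dots> = g (\<iota>A (zmon ?m))"
      using A.exchange_zmon[OF p_in m] additive_on_0[of UNIV "zmul (int n) :: _ \<Rightarrow> 'n \<Rightarrow> int"]
      by (simp add: A.factors_rev additive_on_def zmul_add_right del: upt_Suc)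
    finally have "Q (\<iota>X (zmon (e i)) \<otimes>\<^bsub>FX\<^esub> ?P) = g (\<iota>A (zmon ?m))" .
    then show ?thesis
      unfolding \<mu>_generator[OF i] pow
      using units_in_G_mult[OF zmon_units_in_G P(1)] by (simp add: e'_i)
  next
    case False
    define n where "n = nat ?\<epsilon>"
    have n: "?\<epsilon> = int n" "nat \<bar>?\<epsilon>\<bar> = n" using False by (auto simp: n_def)
    interpret A: exchange_hom "Mcirc D" \<Lambda> FA \<iota>A g "\<lambda>m. coord e' m k" f' y "- y" T_plus T_minus
      "- delta k" "delta k"
      by (rule exchange_homs(2)[OF g])
    have \<sigma>: "sgn ?\<epsilon> = 1" using False by simp
    have e'_i: "e' i = e i + zmul (int n) (e k)" using False i n by (simp add: mut_basis_def)
    let ?m' = "p (e' i)"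
    have m': "?m' = ?m + zmul (int n) y" by (simp add: e'_i p_add p_zmul p_e_k)
    have image: "pstar_alg p (X_factor D (e, c) k i l) = A.factor (int l)" for l
      by (simp add: X_factor_def Let_def \<sigma> pstar_alg_add pstar_scalar pstar_alg_single
          A.factor_def vbar_mult vbar_tmon vbar_vpow p_e_k p_0 p_uminus zmul_uminus scalar_def algebra_simps
          flip: delta_def)
    have QP: "Q ?P = A.factors (map int [1..<Suc n])"
      unfolding Q_factor_product unfolding X_factor_index_def
      by (simp add: n(2) A.factors_def foldr_map comp_def image del: upt_Suc)
    have pow: "?P [^]\<^bsub>FX\<^esub> (- sgn ?\<epsilon>) = inv\<^bsub>FX\<^esub> ?P"
      unfolding \<sigma> using P(3) by (simp add: int_pow_def2)
    have "coord e' ?m' k = - int n"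
      using coord_p_e'[OF i] n coord_mut_basis[OF e k y_in, of k] coord_form_map[OF e k] exch_self[OF e(2)]
      by (simp add: m' coord_add coord_zmul)
    then have deg: "coord e' (- ?m') k = int n" by (simp add: coord_uminus)
    have neg_in: "- ?m' \<in> Mcirc D" by (rule sublattice_uminus[OF sublattice_Mcirc p_in])
    have "- ?m' + zmul (int n) y = - ?m" by (simp add: m')
    then have exch: "g (\<iota>A (zmon (- ?m'))) = Q ?P \<otimes>\<^bsub>FA\<^esub> \<iota>A (zmon (- ?m))"
      using A.exchange_zmon[OF neg_in deg] by (simp add: QP del: upt_Suc)
    have QPu: "Q ?P \<in> Units FA" "Q (inv\<^bsub>FX\<^esub> ?P) = inv\<^bsub>FA\<^esub> (Q ?P)"
      using FX.hom_units_in[OF Q_hom FA.ring_axioms P(1)] by simp_all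
    have units_m: "\<iota>A (zmon (- ?m)) \<in> Units FA" "inv\<^bsub>FA\<^esub> (\<iota>A (zmon (- ?m))) = \<iota>A (zmon ?m)"
      using inv_\<iota>A_zmon[OF p_in, of "- e i"] \<iota>A_unit[OF keys_zmon_A[OF p_in] zmon_nonzero, of "- e i"]
      by (simp_all add: p_uminus)
    have "g (\<iota>A (zmon ?m')) \<otimes>\<^bsub>FA\<^esub> g (\<iota>A (zmon (- ?m'))) = \<one>\<^bsub>FA\<^esub>"
      using ring_hom_mult[OF g_hom zm(2) \<iota>A_closed[OF keys_zmon_A[OF neg_in]]] ring_hom_one[OF g_hom]
        \<iota>A_mult[OF zm(1) keys_zmon_A[OF neg_in]] A.zmon_uminus[OF p_in] \<iota>A_one by metis
    then have "g (\<iota>A (zmon ?m')) = inv\<^bsub>FA\<^esub> (Q ?P \<otimes>\<^bsub>FA\<^esub> \<iota>A (zmon (- ?m)))"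
      unfolding exch
      using FA.inv_unique[of "g (\<iota>A (zmon ?m'))" "Q ?P \<otimes>\<^bsub>FA\<^esub> \<iota>A (zmon (- ?m))"
          "inv\<^bsub>FA\<^esub> (Q ?P \<otimes>\<^bsub>FA\<^esub> \<iota>A (zmon (- ?m)))"]
        ring_hom_closed[OF g_hom zm(2)] QPu(1) units_m(1) FA.Units_m_closed[of "Q ?P" "\<iota>A (zmon (- ?m))"]
      by (metis FA.Units_closed FA.Units_inv_closed FA.Units_r_inv)
    also have "\<dots> = \<iota>A (zmon ?m) \<otimes>\<^bsub>FA\<^esub> Q (inv\<^bsub>FX\<^esub> ?P)"
      using FA.inv_mult_Units[OF QPu(1) units_m(1)] units_m(2) QPu(2) by simp
    also have "\<dots> = Q (\<iota>X (zmon (e i)) \<otimes>\<^bsub>FX\<^esub> inv\<^bsub>FX\<^esub> ?P)"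
      using P(1) \<iota>X_in_G by (simp add: Q_mult Q_\<iota>X pstar_zmon units_in_def)
    finally show ?thesis
      unfolding \<mu>_generator[OF i] pow
      using units_in_G_mult[OF zmon_units_in_G FX.units_in_inv[OF P(1)]] by simp
  qed
  then show "\<mu> (\<iota>X (zmon (e' i))) \<in> units_in FX G"
    and "Q (\<mu> (\<iota>X (zmon (e' i)))) = g (\<iota>A (zmon (p (e' i))))" by simp_all
qed

lemma commute_generator_k:
  shows "\<mu> (\<iota>X (zmon (e' k))) \<in> units_in FX G"
    and "Q (\<mu> (\<iota>X (zmon (e' k)))) = g (\<iota>A (zmon (p (e' k))))"
proof -
  have \<mu>_k: "\<mu> (\<iota>X (zmon (e' k))) = \<iota>X (zmon (- e k))"
    using \<mu> by (simp add: X_mutation_def mut_def inv_\<iota>X_zmon)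
  then show "\<mu> (\<iota>X (zmon (e' k))) \<in> units_in FX G" using zmon_units_in_G by simp
  have "coord e' (- y) k = 0"
    by (simp add: coord_uminus coord_mut_basis[OF e k y_in] coord_form_map[OF e k] exch_self[OF e(2)])
  then have "g (\<iota>A (zmon (- y))) = \<iota>A (zmon (- y))"
    using g_fixed[OF g sublattice_uminus[OF sublattice_Mcirc y_in]] by blast
  moreover have "p (e' k) = - y" by (simp add: mut_basis_def p_uminus p_e_k)
  ultimately show "Q (\<mu> (\<iota>X (zmon (e' k)))) = g (\<iota>A (zmon (p (e' k))))"
    by (simp add: \<mu>_k Q_\<iota>X pstar_zmon p_uminus p_e_k)
qed

definition commuting :: "('n \<Rightarrow>\<^sub>0 'i coeff) \<Rightarrow> bool" where
  "commuting x \<longleftrightarrow> \<mu> (\<iota>X x) \<in> G \<and> Q (\<mu> (\<iota>X x)) = g (\<iota>A (pstar_alg p x))"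

lemma commuting_add: "commuting x \<Longrightarrow> commuting x' \<Longrightarrow> commuting (x + x')"
  unfolding commuting_def pstar_alg_add
  by (simp add: \<iota>X_add ring_hom_add[OF \<mu>_hom] \<iota>X_closed Q_add \<iota>A_add keys_pstar
      ring_hom_add[OF g_hom] \<iota>A_closed)
    (simp add: X_localization_def generate_ring.eng_add)

lemma commuting_mult: "commuting x \<Longrightarrow> commuting x' \<Longrightarrow> commuting (qmul BX x x')"
  unfolding commuting_def pstar_mult
  by (simp add: \<iota>X_mult ring_hom_mult[OF \<mu>_hom] \<iota>X_closed Q_mult \<iota>A_mult keys_pstar
      ring_hom_mult[OF g_hom] \<iota>A_closed)
    (simp add: X_localization_def generate_ring.eng_mult)

lemma commuting_scalar: "commuting (scalar c')"
  unfolding commuting_def \<mu>_scalar by (simp add: \<iota>X_in_G Q_\<iota>X pstar_scalar g_scalar)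

lemma commuting_zmon_uminus:
  assumes "\<mu> (\<iota>X (zmon n)) \<in> units_in FX G" "Q (\<mu> (\<iota>X (zmon n))) = g (\<iota>A (zmon (p n)))"
  shows "commuting (zmon (- n))"
proof -
  note zm = keys_zmon_A[OF p_in] \<iota>A_closed[OF keys_zmon_A[OF p_in]]
  have "\<mu> (\<iota>X (zmon (- n))) \<otimes>\<^bsub>FX\<^esub> \<mu> (\<iota>X (zmon n)) = \<one>\<^bsub>FX\<^esub>"
    using ring_hom_mult[OF \<mu>_hom \<iota>X_closed \<iota>X_closed, of "zmon (- n)" "zmon n"] ring_hom_one[OF \<mu>_hom]
      \<iota>X_mult[of "zmon (- n)" "zmon n"] arg_cong[OF X.zmon_uminus_left[of n], of \<iota>X] \<iota>X_one by simp
  then have \<mu>_inv: "\<mu> (\<iota>X (zmon (- n))) = inv\<^bsub>FX\<^esub> (\<mu> (\<iota>X (zmon n)))"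
    using FX.inv_unique[of "\<mu> (\<iota>X (zmon (- n)))" "\<mu> (\<iota>X (zmon n))" "inv\<^bsub>FX\<^esub> (\<mu> (\<iota>X (zmon n)))"]
      assms(1) ring_hom_closed[OF \<mu>_hom \<iota>X_closed] by (auto simp: units_in_def)
  have "g (\<iota>A (zmon (- p n))) \<otimes>\<^bsub>FA\<^esub> g (\<iota>A (zmon (p n))) = \<one>\<^bsub>FA\<^esub>"
    using ring_hom_mult[OF g_hom zm(2) zm(2), of "- n" n] ring_hom_one[OF g_hom]
      \<iota>A_mult[OF zm(1) zm(1), of "- n" n] arg_cong[OF A.zmon_uminus_left[OF p_in, of n], of \<iota>A] \<iota>A_one
    by (simp add: p_uminus)
  then have g_inv: "g (\<iota>A (zmon (- p n))) = inv\<^bsub>FA\<^esub> (g (\<iota>A (zmon (p n))))"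
    using FA.inv_unique[of "g (\<iota>A (zmon (- p n)))" "g (\<iota>A (zmon (p n)))" "inv\<^bsub>FA\<^esub> (g (\<iota>A (zmon (p n))))"]
      ring_hom_closed[OF g_hom zm(2)] ring_hom_closed[OF g_hom zm(2), of "- n"]
      FX.hom_units_in(1)[OF Q_hom FA.ring_axioms assms(1)] assms(2) by (auto simp: p_uminus)
  show ?thesis
    unfolding commuting_def pstar_zmon p_uminus \<mu>_inv g_inv
    using FX.hom_units_in(2)[OF Q_hom FA.ring_axioms assms(1)] assms by (simp add: units_in_def)
qed

text \<open>
  The exponents n for which the monomials of \<open>n\<close> and \<open>- n\<close> are both commuting form a subgroup.
  It contains the basis of the mutated seed.
\<close>

lemma commuting_all: "commuting x"
proof -
  have add: "commuting (zmon (a + b))" if "commuting (zmon a)" "commuting (zmon b)" for a b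
  proof -
    have "(zmon (a + b) :: _ \<Rightarrow>\<^sub>0 'i coeff) =
        qmul BX (scalar (vpow (- BX a b))) (qmul BX (zmon a) (zmon b))"
      by (simp add: zmon_def qmul_single X.scalar_single vpow_0 flip: vpow_add)
    then show ?thesis
      using commuting_mult[OF commuting_scalar[of "vpow (- BX a b)"] commuting_mult[OF that]] by simp
  qed
  have gen: "commuting (zmon (e' j)) \<and> commuting (zmon (- e' j))" for j
    using commuting_zmon_uminus commute_generator commute_generator_k
    by (cases "j = k") (auto simp: commuting_def pstar_zmon units_in_def)
  have "commuting (zmon n) \<and> commuting (zmon (- n))" for n
  proof (rule zbasis_induct[OF seed_bases(1)[OF e'], of n])
    show "commuting (zmon 0) \<and> commuting (zmon (- 0))"
      using commuting_scalar[of 1] by (simp add: zmon_def scalar_def)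
    show "commuting (zmon (x - z)) \<and> commuting (zmon (- (x - z)))"
      if "commuting (zmon x) \<and> commuting (zmon (- x))" "commuting (zmon z) \<and> commuting (zmon (- z))"
      for x z
      using that add[of x "- z"] add[of z "- x"] by simp
  qed (use gen in simp_all)
  then have zmon: "commuting (zmon n)" for n by blast
  show ?thesis
  proof (induction x rule: poly_mapping_additive_induct_UNIV)
    case zero
    show ?case using commuting_scalar[of 0] by (simp add: scalar_def)
  next
    case (single a c')
    have "Poly_Mapping.single a c' = qmul BX (scalar c') (zmon a)"
      by (simp add: zmon_def X.scalar_single)
    then show ?case using commuting_mult[OF commuting_scalar zmon] by simp
  qed (rule commuting_add)
qed

end

end

end

theorem proposition1p3:
  fixes D :: "('i::finite, 'n::ab_group_add) fixed_data"
    and e0 :: "'i \<Rightarrow> 'n"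
    and \<Lambda> :: "('n \<Rightarrow> int) \<Rightarrow> ('n \<Rightarrow> int) \<Rightarrow> int"
    and p :: "'n \<Rightarrow> ('n \<Rightarrow> int)"
    and FX :: "'x ring" and \<iota>X :: "('n \<Rightarrow>\<^sub>0 'i coeff) \<Rightarrow> 'x"
    and FA :: "'a ring" and \<iota>A :: "(('n \<Rightarrow> int) \<Rightarrow>\<^sub>0 'i coeff) \<Rightarrow> 'a"
    and \<mu>X :: "('i, 'n) cseed \<Rightarrow> 'i \<Rightarrow> 'x \<Rightarrow> 'x"
    and \<mu>A :: "('i, 'n) cseed \<Rightarrow> 'i \<Rightarrow> 'a \<Rightarrow> 'a"
  assumes "is_fixed_data D" and "is_seed D e0" and "exch_integral D e0"
    and "compatible_form D e0 \<Lambda>"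
    and "is_pstar D p"
    and "frozen_compatible D e0 \<Lambda> p"
    and "fraction_skew_field (X_torus D) FX \<iota>X"
    and "fraction_skew_field (A_torus D \<Lambda>) FA \<iota>A"
    and "\<forall>s\<in>reachable D e0. \<forall>k\<in>Iuf D. X_mutation D FX \<iota>X s k (\<mu>X s k)"
    and "\<forall>s\<in>reachable D e0. \<forall>k\<in>Iuf D. A_mutation D FA \<iota>A s k (\<mu>A s k)"
  shows "star_alg_hom D \<Lambda> (pstar_alg p) \<and>
    (\<forall>n. pstar_alg p (zmon n :: 'n \<Rightarrow>\<^sub>0 'i coeff) = zmon (p n)) \<and>
    (\<forall>s\<in>reachable D e0. \<forall>k\<in>Iuf D.
       (\<exists>Q. extends_to_localization D FX \<iota>X FA \<iota>A s k (pstar_alg p) Q) \<and>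
       (\<forall>Q i. extends_to_localization D FX \<iota>X FA \<iota>A s k (pstar_alg p) Q \<longrightarrow>
          \<mu>X s k (\<iota>X (zmon (fst (mut D k s) i))) \<in> X_localization D FX \<iota>X s k \<and>
          Q (\<mu>X s k (\<iota>X (zmon (fst (mut D k s) i)))) =
            \<mu>A s k (\<iota>A (pstar_alg p (zmon (fst (mut D k s) i)))))) \<and>
    quantum_cluster_map D e0 \<Lambda> FX \<iota>X \<mu>X FA \<iota>A \<mu>A (\<lambda>s. pstar_alg p)"
proof -
  interpret quantum_data D e0 \<Lambda> p FX \<iota>X FA \<iota>A
    by unfold_locales (fact assms)+
  have exists: "\<exists>Q. extends_to_localization D FX \<iota>X FA \<iota>A s k (pstar_alg p) Q"
    if "s \<in> reachable D e0" "k \<in> Iuf D" for s k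
    using extension_exists[of "fst s" k "snd s"] reachable_seed[OF assms(2,3) that(1)] that(2) by simp
  have commute: "\<mu>X s k (\<iota>X x) \<in> X_localization D FX \<iota>X s k \<and>
      Q (\<mu>X s k (\<iota>X x)) = \<mu>A s k (\<iota>A (pstar_alg p x))"
    if "s \<in> reachable D e0" "k \<in> Iuf D"
      "extends_to_localization D FX \<iota>X FA \<iota>A s k (pstar_alg p) Q" for s k Q x
  proof -
    have "X_mutation D FX \<iota>X s k (\<mu>X s k)" "A_mutation D FA \<iota>A s k (\<mu>A s k)"
      using assms(9,10) that by blast+
    then show ?thesis
      using commuting_all[of "fst s" k "snd s" "\<mu>X s k" "\<mu>A s k" Q x]
        reachable_seed[OF assms(2,3) that(1)] that(2,3)
      by (simp add: commuting_def)
  qed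
  show ?thesis
    unfolding quantum_cluster_map_def
    using pstar_star_alg_hom pstar_zmon exists commute by blast
qed

end
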